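(* There is an operator space $X$, isometric as a Banach space to $\ell_2$, which has a closed subspace $Y$ completely isomorphic to $OH$ such that the quotient $X/Y$ is also completely isomorphic to $OH$, but $X$ is not completely isomorphic to $OH$.
   Context: Operator spaces $X$ carry matrix norms on $M_n(X)$ (Ruan's axioms); subspaces carry the restricted norms, and quotients carry $M_n(X/Y)=M_n(X)/M_n(Y)$. A linear map $T$ is completely bounded if $\sup_n\|T_n\|<\infty$, where $T_n((x_{ij}))=(T(x_{ij}))$; it is a complete isomorphism if it is invertible with $T$, $T^{-1}$ completely bounded. $OH$ is Pisier's operator Hilbert space: the operator space structure on $\ell_2$ given by $\|\sum_k x_k\otimes e_k\|_{M_n(OH)}=\|\sum_k x_k\otimes\overline{x_k}\|^{1/2}$ for $x_k\in M_n$ and $(e_k)$ an orthonormal basis of $\ell_2$. *)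

theory Defs
  imports
    "HOL-Analysis.L2_Norm"
    "HOL-Analysis.Abstract_Metric_Spaces"
    "HOL-Library.Extended_Nonnegative_Real"
    "HOL-Algebra.AbelCoset"
    "HOL-Algebra.Module"
    "Jordan_Normal_Form.Matrix"
begin

section \<open>Complex matrices\<close>

definition complex_ring :: "complex ring" where
  "complex_ring = \<lparr>carrier = UNIV, monoid.mult = (*), one = 1, zero = 0, add = (+)\<rparr>"

definition cvec_norm :: "complex vec \<Rightarrow> real" where
  "cvec_norm v = L2_set (\<lambda>i. cmod (v $ i)) {..<dim_vec v}"

definition op_norm :: "complex mat \<Rightarrow> real" where
  "op_norm \<alpha> = (SUP v \<in> {v \<in> carrier_vec (dim_col \<alpha>). cvec_norm v \<le> 1}. cvec_norm (\<alpha> *\<^sub>v v))"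

definition kronecker :: "complex mat \<Rightarrow> complex mat \<Rightarrow> complex mat" where
  "kronecker A B = mat (dim_row A * dim_row B) (dim_col A * dim_col B)
     (\<lambda>(i, j). A $$ (i div dim_row B, j div dim_col B) * B $$ (i mod dim_row B, j mod dim_col B))"


section \<open>Operator spaces\<close>

text \<open>The field \<open>mnorm\<close> holds all matrix norms at once, since a matrix determines its size.
  As usual for modules in HOL-Algebra, the ring fields \<open>mult\<close> and \<open>one\<close> play no role.\<close>

record 'a opspace = "(complex, 'a) module" +
  mnorm :: "'a mat \<Rightarrow> real"

definition matrices :: "('a, 'm) ring_scheme \<Rightarrow> nat \<Rightarrow> 'a mat set" where
  "matrices X n = {A \<in> carrier_mat n n. \<forall>i<n. \<forall>j<n. A $$ (i, j) \<in> carrier X}"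

definition mat_zero :: "('a, 'm) ring_scheme \<Rightarrow> nat \<Rightarrow> nat \<Rightarrow> 'a mat" where
  "mat_zero X m n = mat m n (\<lambda>_. \<zero>\<^bsub>X\<^esub>)"

definition mat_add :: "('a, 'm) ring_scheme \<Rightarrow> 'a mat \<Rightarrow> 'a mat \<Rightarrow> 'a mat" where
  "mat_add X A B = mat (dim_row A) (dim_col A) (\<lambda>ij. A $$ ij \<oplus>\<^bsub>X\<^esub> B $$ ij)"

definition mat_scale :: "(complex, 'a, 'm) module_scheme \<Rightarrow> complex \<Rightarrow> 'a mat \<Rightarrow> 'a mat" where
  "mat_scale X c A = map_mat (\<lambda>x. c \<odot>\<^bsub>X\<^esub> x) A"

definition mat_sandwich ::
  "(complex, 'a, 'm) module_scheme \<Rightarrow> complex mat \<Rightarrow> 'a mat \<Rightarrow> complex mat \<Rightarrow> 'a mat" where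
  "mat_sandwich X \<alpha> A \<beta> = mat (dim_row \<alpha>) (dim_col \<beta>) (\<lambda>(i, j).
     \<Oplus>\<^bsub>X\<^esub>k\<in>{..<dim_row A}. \<Oplus>\<^bsub>X\<^esub>l\<in>{..<dim_col A}. (\<alpha> $$ (i, k) * \<beta> $$ (l, j)) \<odot>\<^bsub>X\<^esub> (A $$ (k, l)))"

definition mat_dsum :: "('a, 'm) ring_scheme \<Rightarrow> 'a mat \<Rightarrow> 'a mat \<Rightarrow> 'a mat" where
  "mat_dsum X A B =
     four_block_mat A (mat_zero X (dim_row A) (dim_col B)) (mat_zero X (dim_row B) (dim_col A)) B"

text \<open>The degenerate size \<open>n = 0\<close> is included below: the only matrix of that size has norm \<open>0\<close>
  by \<open>mnorm_eq_0_iff\<close>, so it carries no information.\<close>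

locale operator_space = module complex_ring X for X :: "'a opspace" (structure) +
  assumes mnorm_nonneg: "A \<in> matrices X n \<Longrightarrow> 0 \<le> mnorm X A"
    and mnorm_eq_0_iff: "A \<in> matrices X n \<Longrightarrow> mnorm X A = 0 \<longleftrightarrow> A = mat_zero X n n"
    and mnorm_scale: "A \<in> matrices X n \<Longrightarrow> mnorm X (mat_scale X c A) = cmod c * mnorm X A"
    and mnorm_triangle: "A \<in> matrices X n \<Longrightarrow> B \<in> matrices X n \<Longrightarrow>
           mnorm X (mat_add X A B) \<le> mnorm X A + mnorm X B"
    and ruan_sandwich: "A \<in> matrices X n \<Longrightarrow> \<alpha> \<in> carrier_mat m n \<Longrightarrow> \<beta> \<in> carrier_mat n m \<Longrightarrow>
           mnorm X (mat_sandwich X \<alpha> A \<beta>) \<le> op_norm \<alpha> * mnorm X A * op_norm \<beta>"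
    and ruan_dsum: "A \<in> matrices X m \<Longrightarrow> B \<in> matrices X n \<Longrightarrow>
           mnorm X (mat_dsum X A B) = max (mnorm X A) (mnorm X B)"

definition space_norm :: "'a opspace \<Rightarrow> 'a \<Rightarrow> real" where
  "space_norm X x = mnorm X (mat 1 1 (\<lambda>_. x))"

text \<open>The locale \<open>Metric_space\<close> requires non-negativity and symmetry on the whole type,
  hence the default value outside the carrier.\<close>

definition space_dist :: "'a opspace \<Rightarrow> 'a \<Rightarrow> 'a \<Rightarrow> real" where
  "space_dist X x y =
     (if x \<in> carrier X \<and> y \<in> carrier X then space_norm X (x \<ominus>\<^bsub>X\<^esub> y) else 0)"

definition closed_subspace :: "'a set \<Rightarrow> 'a opspace \<Rightarrow> bool" where
  "closed_subspace Y X \<longleftrightarrow> submodule Y complex_ring X \<and>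
     closedin (Metric_space.mtopology (carrier X) (space_dist X)) Y"

definition subspace_opspace :: "'a opspace \<Rightarrow> 'a set \<Rightarrow> 'a opspace" where
  "subspace_opspace X Y = X\<lparr>carrier := Y\<rparr>"

text \<open>Scalar multiplication adds \<open>Y\<close> after scaling so that \<open>0 \<odot> (Y +> x)\<close> is \<open>Y\<close> and not \<open>{0}\<close>.\<close>

definition quotient_opspace :: "'a opspace \<Rightarrow> 'a set \<Rightarrow> 'a set opspace" where
  "quotient_opspace X Y =
    \<lparr>carrier = a_rcosets\<^bsub>X\<^esub> Y, monoid.mult = undefined, one = undefined, zero = Y, add = set_add X,
     smult = (\<lambda>c U. set_add X ((\<lambda>x. c \<odot>\<^bsub>X\<^esub> x) ` U) Y),
     mnorm = (\<lambda>U. Inf {mnorm X A | A. A \<in> matrices X (dim_row U) \<and> map_mat (\<lambda>x. Y +>\<^bsub>X\<^esub> x) A = U})\<rparr>"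


section \<open>Completely bounded maps\<close>

definition linear_map ::
  "(complex, 'a, 'm) module_scheme \<Rightarrow> (complex, 'b, 'k) module_scheme \<Rightarrow> ('a \<Rightarrow> 'b) \<Rightarrow> bool" where
  "linear_map X Z T \<longleftrightarrow> T \<in> hom (add_monoid X) (add_monoid Z) \<and>
     (\<forall>c. \<forall>x\<in>carrier X. T (c \<odot>\<^bsub>X\<^esub> x) = c \<odot>\<^bsub>Z\<^esub> T x)"

text \<open>The norm of the \<open>n\<close>-th amplification, with value \<open>\<infinity>\<close> if it is unbounded.\<close>

definition amp_norm :: "'a opspace \<Rightarrow> 'b opspace \<Rightarrow> ('a \<Rightarrow> 'b) \<Rightarrow> nat \<Rightarrow> ennreal" where
  "amp_norm X Z T n =
     (SUP A \<in> {A \<in> matrices X n. mnorm X A \<le> 1}. ennreal (mnorm Z (map_mat T A)))"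

definition completely_bounded :: "'a opspace \<Rightarrow> 'b opspace \<Rightarrow> ('a \<Rightarrow> 'b) \<Rightarrow> bool" where
  "completely_bounded X Z T \<longleftrightarrow> linear_map X Z T \<and> (SUP n. amp_norm X Z T n) < \<infinity>"

definition complete_isomorphism :: "'a opspace \<Rightarrow> 'b opspace \<Rightarrow> ('a \<Rightarrow> 'b) \<Rightarrow> bool" where
  "complete_isomorphism X Z T \<longleftrightarrow> bij_betw T (carrier X) (carrier Z) \<and>
     completely_bounded X Z T \<and> completely_bounded Z X (inv_into (carrier X) T)"

definition completely_isomorphic :: "'a opspace \<Rightarrow> 'b opspace \<Rightarrow> bool" where
  "completely_isomorphic X Z \<longleftrightarrow> (\<exists>T. complete_isomorphism X Z T)"


section \<open>The operator Hilbert space\<close>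

definition ell2 :: "(complex, nat \<Rightarrow> complex) module" where
  "ell2 = \<lparr>carrier = {x. summable (\<lambda>k. (cmod (x k))\<^sup>2)}, monoid.mult = undefined, one = undefined,
     zero = (\<lambda>_. 0), add = (\<lambda>x y k. x k + y k), smult = (\<lambda>c x k. c * x k)\<rparr>"

definition ell2_norm :: "(nat \<Rightarrow> complex) \<Rightarrow> real" where
  "ell2_norm x = sqrt (\<Sum>k. (cmod (x k))\<^sup>2)"

definition isometric_to_ell2 :: "'a opspace \<Rightarrow> bool" where
  "isometric_to_ell2 X \<longleftrightarrow> (\<exists>T. linear_map X ell2 T \<and> bij_betw T (carrier X) (carrier ell2) \<and>
     (\<forall>x\<in>carrier X. ell2_norm (T x) = space_norm X x))"

text \<open>With \<open>(e\<^sub>k)\<close> the standard basis of \<open>ell2\<close>, a matrix \<open>A\<close> over \<open>ell2\<close> is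
  \<open>\<Sum>\<^sub>k x\<^sub>k \<otimes> e\<^sub>k\<close>, where \<open>x\<^sub>k\<close> is the scalar matrix of \<open>k\<close>-th coordinates of the entries.
  The series \<open>\<Sum>\<^sub>k x\<^sub>k \<otimes> cnj x\<^sub>k\<close> of matrices of fixed finite size is summed entrywise.\<close>

definition coord_mat :: "nat \<Rightarrow> (nat \<Rightarrow> complex) mat \<Rightarrow> complex mat" where
  "coord_mat k A = map_mat (\<lambda>x. x k) A"

definition oh_gram :: "(nat \<Rightarrow> complex) mat \<Rightarrow> complex mat" where
  "oh_gram A = mat (dim_row A * dim_row A) (dim_col A * dim_col A)
     (\<lambda>ij. \<Sum>k. kronecker (coord_mat k A) (map_mat cnj (coord_mat k A)) $$ ij)"

definition OH :: "(nat \<Rightarrow> complex) opspace" where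
  "OH = module.extend ell2 (opspace.fields (\<lambda>A. sqrt (op_norm (oh_gram A))))"

end

(* X carries the norms of the extension of OH by OH that a real interpolation method produces between the
   column and the row Hilbert spaces.  A finitely supported family (u_m), m an integer, of matrices over l2 has
   J-norm at most c if the column norm of (2^(m/2) u_m) and the row norm of (2^(-m/2) u_m) are at most c.  The
   norm of a pair (w, x) of matrices over l2 is the infimum of the J-norms of the families with sum_m u_m = x and
   sum_m m u_m = w; the maximum with the minimal operator space structure makes X isometric to l2.  Y is {x = 0}.

   The infimum over families with sum_m u_m = z only is equivalent to the OH norm of z.  That it dominates OH is
   Cauchy-Schwarz over m after diagonalizing the Hilbert-Schmidt test matrices; since m may be replaced by m - m0
   with m0 adapted to the matrix entry, the same estimate bounds w when x = 0.  Conversely, if z has OH norm at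
   most 1 then Phi a = sum_k z_k a z_k^* contracts the Hilbert-Schmidt norm, and the series sum_r 2^(-r) Phi^r 1
   (Phi alternating with its adjoint) gives positive a, b with Phi a <= 2 b and Phi^* b <= 2 a; u_m is the part of
   z that lives on the pairs of eigenvalues of b and a with ratio about 2^m.

   For the last claim take N = 4^M.  The row (M e_k, e_k), k < N, and the column (-M e_k, e_k), k < N, both have
   norm about N^(1/4) in X, since one u_m suffices.  If T : X -> OH is completely bounded, then
   sum_k |T(0, e_k) + M T(e_k, 0)|^2 and sum_k |T(0, e_k) - M T(e_k, 0)|^2 are O(N), because rows and columns have
   the same norm in OH.  By the parallelogram law M^2 sum_k |T(e_k, 0)|^2 = O(N), so T is not bounded below. *)

theory Submission
  imports Defs "Jordan_Normal_Form.Spectral_Radius"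
begin

text \<open>The sums sum_m u_m and sum_m m u_m are the value and, up to the factor log 2, the
  derivative at 1/2 of the function z -> sum_m 2^((z - 1/2) m) u_m, so X is a discrete analogue of
  the derived space of an interpolation scale. On single vectors the column and the row norm both
  agree with the norm of l2, so the twisting is invisible there and shows up only on matrices. This
  is why X can be Hilbertian as a Banach space without being OH, and why all estimates must hold for
  every matrix size with constants that do not depend on it. The minimal structure restores the
  exact norm on vectors; the J-norms dominate it up to a constant, so the maximum changes the matrix
  norms only by a bounded factor. Limits are kept to the edge: families have finite support,
  sequences are truncated and the geometric series is cut off, so that the core consists of algebra
  with finite sums and diagonalization of Hermitian matrices.\<close>

section \<open>Squared Euclidean norms of vectors given as functions on indices\<close>

definition nsq :: "nat \<Rightarrow> (nat \<Rightarrow> complex) \<Rightarrow> real" where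
  "nsq n \<xi> = (\<Sum>j<n. (cmod (\<xi> j))\<^sup>2)"

definition kdelta :: "nat \<Rightarrow> nat \<Rightarrow> complex" where
  "kdelta i j = (if i = j then 1 else 0)"

lemma nsq_nonneg [simp]: "0 \<le> nsq n \<xi>"
  by (simp add: nsq_def sum_nonneg)

lemma of_real_nsq: "of_real (nsq n \<xi>) = (\<Sum>j<n. \<xi> j * cnj (\<xi> j))"
  by (simp add: nsq_def complex_norm_square[symmetric])

lemma nsq_scale: "nsq n (\<lambda>j. c * \<xi> j) = (cmod c)\<^sup>2 * nsq n \<xi>"
  by (simp add: nsq_def norm_mult power_mult_distrib sum_distrib_left)

lemma nsq_cnj [simp]: "nsq n (\<lambda>j. cnj (\<xi> j)) = nsq n \<xi>"
  by (simp add: nsq_def)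

lemma nsq_cong: "(\<And>j. j < n \<Longrightarrow> \<xi> j = \<eta> j) \<Longrightarrow> nsq n \<xi> = nsq n \<eta>"
  by (simp add: nsq_def)

lemma kdelta_sum [simp]:
  assumes "j < n"
  shows "(\<Sum>k<n. kdelta j k * f k) = f j" "(\<Sum>k<n. kdelta k j * f k) = f j"
    "(\<Sum>k<n. f k * kdelta j k) = f j" "(\<Sum>k<n. f k * kdelta k j) = f j"
  using assms by (simp_all add: kdelta_def if_distrib if_distribR cong: if_cong)

lemma cnj_kdelta [simp]: "cnj (kdelta i j) = kdelta i j"
  by (simp add: kdelta_def)

lemma nsq_kdelta: "j < n \<Longrightarrow> nsq n (kdelta j) = 1"
  by (simp add: nsq_def kdelta_def if_distrib if_distribR cong: if_cong)

section \<open>The spectral theorem for Hermitian matrices\<close>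

text \<open>Matrices are functions of which only the values below \<open>n\<close> count; passing to
  a block is then a mere shift of the indices.\<close>

definition hermitian :: "nat \<Rightarrow> (nat \<Rightarrow> nat \<Rightarrow> complex) \<Rightarrow> bool" where
  "hermitian n h \<longleftrightarrow> (\<forall>i<n. \<forall>j<n. h i j = cnj (h j i))"

text \<open>Orthonormality of the columns and of the rows are both recorded, so that the adjoint is
  unitary by symmetry.\<close>

definition unitary :: "nat \<Rightarrow> (nat \<Rightarrow> nat \<Rightarrow> complex) \<Rightarrow> bool" where
  "unitary n F \<longleftrightarrow> (\<forall>l<n. \<forall>l'<n. (\<Sum>i<n. cnj (F i l) * F i l') = kdelta l l') \<and>
    (\<forall>i<n. \<forall>j<n. (\<Sum>l<n. F i l * cnj (F j l)) = kdelta i j)"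

text \<open>The phase makes \<open>1 - v 0\<close> equal to \<open>1 + r\<close>, which is positive,
  so that the difference of the first basis vector and \<open>v\<close> does not vanish. A
  reflection along this difference will exchange the two.\<close>

lemma eigenvector_exists:
  assumes "0 < n"
  shows "\<exists>v e r. nsq n v = 1 \<and> 0 \<le> r \<and> v 0 = - complex_of_real r \<and>
           (\<forall>i<n. (\<Sum>j<n. h i j * v j) = e * v i)"
proof -
  define A where "A = mat n n (\<lambda>(i, j). h i j)"
  have A: "A \<in> carrier_mat n n" by (simp add: A_def)
  from spectrum_non_empty[OF A assms] obtain e where "eigenvalue A e"
    by (auto simp: spectrum_def)
  then obtain w where w: "w \<in> carrier_vec n" "w \<noteq> 0\<^sub>v n" "A *\<^sub>v w = e \<cdot>\<^sub>v w"
    using A by (auto simp: eigenvalue_def eigenvector_def)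
  have ev: "(\<Sum>j<n. h i j * w $ j) = e * w $ i" if "i < n" for i
  proof -
    have "(A *\<^sub>v w) $ i = (\<Sum>j<n. h i j * w $ j)"
      using that w(1) by (simp add: A_def scalar_prod_def lessThan_atLeast0)
    then show ?thesis using w that by simp
  qed
  define q where "q = nsq n (\<lambda>j. w $ j)"
  have "q \<noteq> 0"
  proof
    assume "q = 0"
    then have "\<forall>j<n. w $ j = 0" by (simp add: q_def nsq_def sum_nonneg_eq_0_iff)
    then show False using w by (auto intro: eq_vecI)
  qed
  then have q: "0 < q" by (simp add: q_def order_less_le)
  define p where "p = (if w $ 0 = 0 then 1 else - cnj (w $ 0) / cmod (w $ 0))"
  have p: "cmod p = 1" by (simp add: p_def norm_divide)
  have p0: "p * w $ 0 = - complex_of_real (cmod (w $ 0))"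
    by (auto simp: p_def field_simps complex_norm_square[symmetric] power2_eq_square)
  define v where "v = (\<lambda>j. (p / of_real (sqrt q)) * w $ j)"
  have "nsq n v = 1"
    unfolding v_def nsq_scale using q p by (simp add: norm_divide q_def[symmetric] power_divide)
  moreover have "v 0 = - complex_of_real (cmod (w $ 0) / sqrt q)"
    using p0 by (simp add: v_def)
  moreover have "(\<Sum>j<n. h i j * v j) = e * v i" if "i < n" for i
  proof -
    have "(\<Sum>j<n. h i j * v j) = (p / of_real (sqrt q)) * (\<Sum>j<n. h i j * w $ j)"
      by (simp add: v_def sum_distrib_left algebra_simps)
    then show ?thesis using ev[OF that] by (simp add: v_def)
  qed
  ultimately show ?thesis using q by (intro exI[of _ v] exI[of _ e] exI[of _ "cmod (w $ 0) / sqrt q"]) auto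
qed

text \<open>The Householder reflection that exchanges \<open>v\<close> and the first basis vector.\<close>

lemma unitary_with_first_column:
  assumes n: "0 < n" and v: "nsq n v = 1" and r: "0 \<le> r" "v 0 = - complex_of_real r"
  shows "\<exists>W. (\<forall>i j. W j i = cnj (W i j)) \<and> (\<forall>i<n. \<forall>j<n. (\<Sum>k<n. W i k * W k j) = kdelta i j) \<and>
           (\<forall>i. W i 0 = v i)"
proof -
  define u where "u = (\<lambda>j. kdelta j 0 - v j)"
  \<comment> \<open>As \<open>v\<close> is a unit vector with first coordinate -r, the squared
    length of \<open>u\<close> is 2 (1 + r), and \<open>c\<close> is 2 divided by it.\<close>
  define c where "c = complex_of_real (1 / (1 + r))"
  define W where "W = (\<lambda>i j. kdelta i j - c * u i * cnj (u j))"
  have r1: "1 + complex_of_real r \<noteq> 0"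
    using r(1) by (metis add_nonneg_eq_0_iff of_real_1 of_real_add of_real_eq_0_iff zero_le_one zero_neq_one)
  have "(\<Sum>k<n. cnj (u k) * u k) = (\<Sum>k<n. kdelta k 0 * kdelta k 0) - (\<Sum>k<n. kdelta k 0 * v k)
      - (\<Sum>k<n. kdelta k 0 * cnj (v k)) + (\<Sum>k<n. v k * cnj (v k))"
    by (simp add: u_def algebra_simps sum.distrib sum_subtractf)
  also have "\<dots> = 1 - v 0 - cnj (v 0) + 1"
    using n v by (simp add: of_real_nsq[symmetric]) (simp add: kdelta_def)
  finally have u2: "c * (\<Sum>k<n. cnj (u k) * u k) = 2"
    using r r1 by (simp add: c_def field_simps)
  have W2: "(\<Sum>k<n. W i k * W k j) = kdelta i j" if "i < n" "j < n" for i j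
  proof -
    have "(\<Sum>k<n. W i k * W k j) = (\<Sum>k<n. kdelta i k * kdelta k j) - (\<Sum>k<n. kdelta i k * (c * u k * cnj (u j)))
        - (\<Sum>k<n. (c * u i * cnj (u k)) * kdelta k j) + c * u i * cnj (u j) * (c * (\<Sum>k<n. cnj (u k) * u k))"
      by (simp add: W_def algebra_simps sum.distrib sum_subtractf sum_distrib_left)
    also have "\<dots> = kdelta i j"
      using that unfolding u2 by simp
    finally show ?thesis .
  qed
  have "W i 0 = v i" for i
    using r r1 by (simp add: W_def u_def c_def kdelta_def field_simps)
  moreover have "W j i = cnj (W i j)" for i j
    by (simp add: W_def c_def kdelta_def)
  ultimately show ?thesis using W2 by blast
qed

text \<open>Deflation: after conjugation with \<open>W\<close> the first basis vector is an
  eigenvector, and the Hermitian symmetry of \<open>g\<close> clears the first row along with the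
  first column, so that the induction hypothesis applies to the remaining block.\<close>

lemma spectral_decomposition:
  assumes "hermitian n h"
  shows "\<exists>F s. unitary n F \<and> (\<forall>i<n. \<forall>j<n. h i j = (\<Sum>l<n. complex_of_real (s l) * F i l * cnj (F j l)))"
  using assms
proof (induction n arbitrary: h)
  case 0
  then show ?case by (simp add: unitary_def)
next
  case (Suc n)
  let ?N = "Suc n"
  have herm: "cnj (h j i) = h i j" if "i < ?N" "j < ?N" for i j
    using Suc.prems that unfolding hermitian_def by metis
  obtain v e r where v: "nsq ?N v = 1" "0 \<le> r" "v 0 = - complex_of_real r"
      and ev: "\<And>i. i < ?N \<Longrightarrow> (\<Sum>j<?N. h i j * v j) = e * v i"
    using eigenvector_exists[of ?N h] by blast
  obtain W where Wh: "\<And>i j. W j i = cnj (W i j)"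
      and W2: "\<And>i j. i < ?N \<Longrightarrow> j < ?N \<Longrightarrow> (\<Sum>k<?N. W i k * W k j) = kdelta i j"
      and Wv: "\<And>i. W i 0 = v i"
    using unitary_with_first_column[OF _ v] by blast
  define g where "g = (\<lambda>i j. \<Sum>k<?N. \<Sum>l<?N. W i k * h k l * W l j)"
  have recon: "h i j = (\<Sum>k<?N. \<Sum>l<?N. W i k * g k l * W l j)" if ij: "i < ?N" "j < ?N" for i j
  proof -
    have "(\<Sum>k<?N. \<Sum>l<?N. W i k * g k l * W l j) =
        (\<Sum>k<?N. \<Sum>l<?N. \<Sum>p<?N. \<Sum>q<?N. (W i k * W k p) * h p q * (W q l * W l j))"
      unfolding g_def by (simp only: sum_distrib_left sum_distrib_right mult.assoc)
    also have "\<dots> = (\<Sum>p<?N. \<Sum>q<?N. \<Sum>k<?N. \<Sum>l<?N. (W i k * W k p) * h p q * (W q l * W l j))"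
      by (subst sum.swap, subst (2) sum.swap, subst (3) sum.swap,
          subst sum.swap, subst (2) sum.swap, subst (3) sum.swap) (rule refl)
    also have "\<dots> = (\<Sum>p<?N. \<Sum>q<?N. (\<Sum>k<?N. W i k * W k p) * h p q * (\<Sum>l<?N. W q l * W l j))"
      unfolding sum_distrib_left sum_distrib_right
      by (rule sum.cong[OF refl], rule sum.cong[OF refl], subst sum.swap) (simp only: mult.assoc)
    also have "\<dots> = (\<Sum>p<?N. \<Sum>q<?N. kdelta i p * (h p q * kdelta q j))"
      using ij by (intro sum.cong refl) (simp add: W2 mult.assoc del: sum.lessThan_Suc)
    also have "\<dots> = h i j"
      using ij by (simp add: sum_distrib_left[symmetric] del: sum.lessThan_Suc)
    finally show ?thesis by simp
  qed
  have gherm: "g i j = cnj (g j i)" for i j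
  proof -
    have "cnj (g j i) = (\<Sum>k<?N. \<Sum>l<?N. W i l * h l k * W k j)"
      unfolding g_def cnj_sum complex_cnj_mult
      by (intro sum.cong refl) (simp add: herm Wh[symmetric] mult.commute mult.left_commute)
    also have "\<dots> = g i j" unfolding g_def by (rule sum.swap)
    finally show ?thesis by simp
  qed
  have g0: "g i 0 = e * kdelta i 0" if i: "i < ?N" for i
  proof -
    have "g i 0 = (\<Sum>k<?N. W i k * (\<Sum>l<?N. h k l * v l))"
      unfolding g_def Wv by (simp only: sum_distrib_left mult.assoc)
    also have "\<dots> = (\<Sum>k<?N. e * (W i k * W k 0))"
      by (rule sum.cong[OF refl]) (simp add: ev Wv del: sum.lessThan_Suc)
    also have "\<dots> = e * (\<Sum>k<?N. W i k * W k 0)"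
      by (simp only: sum_distrib_left)
    finally show ?thesis using W2[OF i, of 0] by simp
  qed
  have "e = cnj e" using g0[of 0] gherm[of 0 0] by (simp add: kdelta_def)
  then obtain e' where e': "e = complex_of_real e'" by (metis Reals_cnj_iff Reals_cases)
  have g0': "g 0 (Suc j) = 0" if "j < n" for j
    using g0[of "Suc j"] gherm[of 0 "Suc j"] that by (simp add: kdelta_def)
  have "hermitian n (\<lambda>i j. g (Suc i) (Suc j))"
    using gherm unfolding hermitian_def by blast
  from Suc.IH[OF this] obtain F s where F: "unitary n F"
    and gF: "\<And>i j. i < n \<Longrightarrow> j < n \<Longrightarrow> g (Suc i) (Suc j) = (\<Sum>l<n. complex_of_real (s l) * F i l * cnj (F j l))"
    by blast
  \<comment> \<open>\<open>E\<close> is the product of \<open>W\<close> and the block diagonal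
    matrix with blocks 1 and \<open>F\<close>.\<close>
  define E where "E = (\<lambda>i l. case l of 0 \<Rightarrow> W i 0 | Suc l \<Rightarrow> (\<Sum>k<n. W i (Suc k) * F k l))"
  define t where "t = (\<lambda>l. case l of 0 \<Rightarrow> e' | Suc l \<Rightarrow> s l)"
  have E0: "E i 0 = W i 0" and ES: "E i (Suc l) = (\<Sum>k<n. W i (Suc k) * F k l)" for i l
    by (simp_all add: E_def)
  have F1: "(\<Sum>i<n. cnj (F i l) * F i l') = kdelta l l'" if "l < n" "l' < n" for l l'
    using F that by (simp add: unitary_def)
  have F2: "(\<Sum>l<n. F i l * cnj (F j l)) = kdelta i j" if "i < n" "j < n" for i j
    using F that by (simp add: unitary_def)
  have WW: "(\<Sum>i<?N. cnj (W i k) * W i l) = kdelta k l" if "k < ?N" "l < ?N" for k l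
    using W2[OF that] by (simp only: Wh[symmetric])
  \<comment> \<open>Kept general in the diagonal \<open>q\<close>: the eigenvalues \<open>t\<close>
    give the decomposition of \<open>h\<close>, the constant 1 gives orthonormality of the rows of
    \<open>E\<close>.\<close>
  have rows: "(\<Sum>l<?N. complex_of_real (q l) * E i l * cnj (E j l)) =
     complex_of_real (q 0) * W i 0 * W 0 j + (\<Sum>k<n. \<Sum>k'<n. W i (Suc k) *
        (\<Sum>l<n. complex_of_real (q (Suc l)) * F k l * cnj (F k' l)) * W (Suc k') j)" for q i j
  proof -
    have "(\<Sum>l<n. complex_of_real (q (Suc l)) * E i (Suc l) * cnj (E j (Suc l))) =
       (\<Sum>l<n. \<Sum>k<n. \<Sum>k'<n. W i (Suc k) * (complex_of_real (q (Suc l)) * F k l * cnj (F k' l)) * W (Suc k') j)"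
      unfolding ES cnj_sum complex_cnj_mult Wh[symmetric] sum_distrib_left sum_distrib_right
      by (rule sum.cong[OF refl], subst sum.swap, intro sum.cong refl) (simp add: algebra_simps)
    also have "\<dots> = (\<Sum>k<n. \<Sum>k'<n. \<Sum>l<n. W i (Suc k) * (complex_of_real (q (Suc l)) * F k l * cnj (F k' l)) * W (Suc k') j)"
      by (subst sum.swap, subst (2) sum.swap) (rule refl)
    finally show ?thesis
      by (simp only: sum.lessThan_Suc_shift E0 Wh[symmetric] sum_distrib_left sum_distrib_right)
  qed
  have hE: "h i j = (\<Sum>l<?N. complex_of_real (t l) * E i l * cnj (E j l))" if "i < ?N" "j < ?N" for i j
  proof -
    have "h i j = W i 0 * g 0 0 * W 0 j + (\<Sum>k<n. \<Sum>k'<n. W i (Suc k) * g (Suc k) (Suc k') * W (Suc k') j)"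
      unfolding recon[OF that] by (simp add: sum.lessThan_Suc_shift g0 g0' kdelta_def del: sum.lessThan_Suc)
    also have "\<dots> = e * W i 0 * W 0 j + (\<Sum>k<n. \<Sum>k'<n. W i (Suc k) * g (Suc k) (Suc k') * W (Suc k') j)"
      using g0[of 0] by (simp add: kdelta_def)
    also have "\<dots> = (\<Sum>l<?N. complex_of_real (t l) * E i l * cnj (E j l))"
      unfolding rows by (simp add: t_def e' gF del: sum.lessThan_Suc)
    finally show ?thesis .
  qed
  have EE: "(\<Sum>l<?N. E i l * cnj (E j l)) = kdelta i j" if "i < ?N" "j < ?N" for i j
  proof -
    have "(\<Sum>l<?N. E i l * cnj (E j l)) = W i 0 * W 0 j + (\<Sum>k<n. \<Sum>k'<n. W i (Suc k) * (\<Sum>l<n. F k l * cnj (F k' l)) * W (Suc k') j)"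
      using rows[of "\<lambda>_. 1"] by simp
    also have "\<dots> = W i 0 * W 0 j + (\<Sum>k<n. W i (Suc k) * W (Suc k) j)"
    proof -
      have "(\<Sum>k'<n. W i (Suc k) * (\<Sum>l<n. F k l * cnj (F k' l)) * W (Suc k') j) = W i (Suc k) * W (Suc k) j" if "k < n" for k
      proof -
        have "(\<Sum>k'<n. W i (Suc k) * (\<Sum>l<n. F k l * cnj (F k' l)) * W (Suc k') j) =
           (\<Sum>k'<n. W i (Suc k) * (kdelta k k' * W (Suc k') j))"
          by (rule sum.cong[OF refl]) (simp add: F2 that)
        then show ?thesis using that by (simp add: sum_distrib_left[symmetric])
      qed
      then show ?thesis by simp
    qed
    also have "\<dots> = (\<Sum>k<?N. W i k * W k j)" by (simp add: sum.lessThan_Suc_shift del: sum.lessThan_Suc)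
    finally show ?thesis using W2[OF that] by simp
  qed
  have cSS: "(\<Sum>i<?N. cnj (E i (Suc l)) * E i (Suc l')) = kdelta (Suc l) (Suc l')" if l: "l < n" "l' < n" for l l'
  proof -
    have "(\<Sum>i<?N. cnj (E i (Suc l)) * E i (Suc l')) =
        (\<Sum>i<?N. \<Sum>k<n. \<Sum>k'<n. cnj (F k l) * (cnj (W i (Suc k)) * W i (Suc k')) * F k' l')"
      unfolding ES cnj_sum complex_cnj_mult sum_distrib_left sum_distrib_right
      by (rule sum.cong[OF refl], subst sum.swap, intro sum.cong refl) (simp add: algebra_simps)
    also have "\<dots> = (\<Sum>k<n. \<Sum>k'<n. \<Sum>i<?N. cnj (F k l) * (cnj (W i (Suc k)) * W i (Suc k')) * F k' l')"
      by (subst sum.swap, subst (2) sum.swap) (rule refl)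
    also have "\<dots> = (\<Sum>k<n. \<Sum>k'<n. cnj (F k l) * (\<Sum>i<?N. cnj (W i (Suc k)) * W i (Suc k')) * F k' l')"
      by (simp only: sum_distrib_left sum_distrib_right)
    also have "\<dots> = (\<Sum>k<n. \<Sum>k'<n. cnj (F k l) * (kdelta k k' * F k' l'))"
      by (intro sum.cong refl) (simp add: WW kdelta_def del: sum.lessThan_Suc)
    also have "\<dots> = kdelta l l'" using l by (simp add: F1 sum_distrib_left[symmetric])
    finally show ?thesis by (simp add: kdelta_def)
  qed
  have c0S: "(\<Sum>i<?N. cnj (E i 0) * E i (Suc l')) = 0" if l: "l' < n" for l'
  proof -
    have "(\<Sum>i<?N. cnj (E i 0) * E i (Suc l')) = (\<Sum>i<?N. \<Sum>k<n. (cnj (W i 0) * W i (Suc k)) * F k l')"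
      unfolding E0 ES by (simp only: sum_distrib_left mult.assoc)
    also have "\<dots> = (\<Sum>k<n. (\<Sum>i<?N. cnj (W i 0) * W i (Suc k)) * F k l')"
      by (subst sum.swap) (simp only: sum_distrib_right)
    also have "\<dots> = 0"
      by (intro sum.neutral ballI) (simp add: WW kdelta_def del: sum.lessThan_Suc)
    finally show ?thesis .
  qed
  have cS0: "(\<Sum>i<?N. cnj (E i (Suc l')) * E i 0) = 0" if l: "l' < n" for l'
    using arg_cong[OF c0S[OF that], of cnj] unfolding cnj_sum complex_cnj_mult by (simp add: mult.commute)
  have "(\<Sum>i<?N. cnj (E i l) * E i l') = kdelta l l'" if l: "l < ?N" "l' < ?N" for l l'
  proof (cases l)
    case 0
    show ?thesis
    proof (cases l')
      case 0
      then show ?thesis using \<open>l = 0\<close> WW[of 0 0] by (simp only: E0)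
    next
      case (Suc m)
      then show ?thesis using \<open>l = 0\<close> c0S[of m] l by (simp add: kdelta_def del: sum.lessThan_Suc)
    qed
  next
    case (Suc m)
    show ?thesis
    proof (cases l')
      case 0
      then show ?thesis using Suc cS0[of m] l by (simp add: kdelta_def del: sum.lessThan_Suc)
    next
      case (Suc m')
      then show ?thesis using \<open>l = Suc m\<close> cSS[of m m'] l by (simp del: sum.lessThan_Suc)
    qed
  qed
  then have "unitary ?N E" using EE unfolding unitary_def by blast
  then show ?case using hE by blast
qed

lemma cauchy_schwarz_complex:
  "(cmod (\<Sum>j<n. \<xi> j * \<eta> j))\<^sup>2 \<le> nsq n \<xi> * nsq n \<eta>"
proof -
  have "cmod (\<Sum>j<n. \<xi> j * \<eta> j) \<le> (\<Sum>j<n. cmod (\<xi> j) * cmod (\<eta> j))"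
    by (rule sum_norm_le) (simp add: norm_mult)
  then have "(cmod (\<Sum>j<n. \<xi> j * \<eta> j))\<^sup>2 \<le> (\<Sum>j<n. cmod (\<xi> j) * cmod (\<eta> j))\<^sup>2"
    by (rule power_mono) simp
  also have "\<dots> \<le> nsq n \<xi> * nsq n \<eta>"
    unfolding nsq_def by (rule Cauchy_Schwarz_ineq_sum)
  finally show ?thesis .
qed

lemma sum_lessThan_add:
  fixes f :: "nat \<Rightarrow> 'a::comm_monoid_add"
  shows "(\<Sum>i<m + n. f i) = (\<Sum>i<m. f i) + (\<Sum>i<n. f (m + i))"
  by (induction n) (simp_all add: add.assoc)

section \<open>Bounds for scalar matrices\<close>

text \<open>A bound for the operator norm instead of the norm itself: bounds can be composed and
  transposed without handling suprema.\<close>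

definition opbd :: "nat \<Rightarrow> nat \<Rightarrow> (nat \<Rightarrow> nat \<Rightarrow> complex) \<Rightarrow> real \<Rightarrow> bool" where
  "opbd p n \<alpha> s \<longleftrightarrow> 0 \<le> s \<and> (\<forall>\<xi>. nsq p (\<lambda>i. \<Sum>j<n. \<alpha> i j * \<xi> j) \<le> s\<^sup>2 * nsq n \<xi>)"

lemma opbdD: "opbd p n \<alpha> s \<Longrightarrow> nsq p (\<lambda>i. \<Sum>j<n. \<alpha> i j * \<xi> j) \<le> s\<^sup>2 * nsq n \<xi>"
  by (simp add: opbd_def)

text \<open>The squared length of z = \<alpha>^T \<eta> is the pairing of \<eta> with \<alpha>
  applied to the conjugate of z. Cauchy-Schwarz bounds it by s |\<eta>| |z|, and one factor |z|
  cancels.\<close>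

lemma opbd_transpose:
  assumes "opbd p n \<alpha> s"
  shows "opbd n p (\<lambda>i j. \<alpha> j i) s"
  unfolding opbd_def
proof (intro conjI allI)
  show "0 \<le> s" using assms by (simp add: opbd_def)
  fix \<eta>
  define z where "z = (\<lambda>j. \<Sum>i<p. \<alpha> i j * \<eta> i)"
  have "complex_of_real (nsq n z) = (\<Sum>i<p. \<eta> i * (\<Sum>j<n. \<alpha> i j * cnj (z j)))"
  proof -
    have "complex_of_real (nsq n z) = (\<Sum>j<n. \<Sum>i<p. \<eta> i * (\<alpha> i j * cnj (z j)))"
    proof -
      have "z j * w = (\<Sum>i<p. \<eta> i * (\<alpha> i j * w))" for j w
        by (simp only: z_def sum_distrib_right) (simp only: mult_ac)
      then show ?thesis by (simp only: of_real_nsq)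
    qed
    then show ?thesis by (subst (asm) sum.swap) (simp add: sum_distrib_left)
  qed
  then have "(nsq n z)\<^sup>2 = (cmod (\<Sum>i<p. \<eta> i * (\<Sum>j<n. \<alpha> i j * cnj (z j))))\<^sup>2"
    by (metis norm_of_real power2_abs)
  also have "\<dots> \<le> nsq p \<eta> * nsq p (\<lambda>i. \<Sum>j<n. \<alpha> i j * cnj (z j))"
    by (rule cauchy_schwarz_complex)
  also have "\<dots> \<le> nsq p \<eta> * (s\<^sup>2 * nsq n (\<lambda>j. cnj (z j)))"
    by (intro mult_left_mono opbdD[OF assms]) simp
  finally have "(nsq n z) * nsq n z \<le> (s\<^sup>2 * nsq p \<eta>) * nsq n z"
    by (simp add: power2_eq_square mult_ac)
  then have "nsq n z \<le> s\<^sup>2 * nsq p \<eta>"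
    by (cases "nsq n z = 0") (auto simp: order_less_le)
  then show "nsq n (\<lambda>i. \<Sum>j<p. \<alpha> j i * \<eta> j) \<le> s\<^sup>2 * nsq p \<eta>"
    by (simp add: z_def)
qed

lemma unitary_isometry:
  assumes "unitary n F"
  shows "nsq n (\<lambda>i. \<Sum>j<n. F i j * \<xi> j) = nsq n \<xi>"
proof -
  have "complex_of_real (nsq n (\<lambda>i. \<Sum>j<n. F i j * \<xi> j)) =
      (\<Sum>i<n. \<Sum>l<n. \<Sum>j<n. cnj (F i j) * F i l * (cnj (\<xi> j) * \<xi> l))"
    unfolding of_real_nsq by (simp add: cnj_sum sum_product mult_ac)
  also have "\<dots> = (\<Sum>l<n. \<Sum>j<n. (\<Sum>i<n. cnj (F i j) * F i l) * (cnj (\<xi> j) * \<xi> l))"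
    by (subst sum.swap, rule sum.cong[OF refl], subst sum.swap) (simp add: sum_distrib_right)
  also have "\<dots> = (\<Sum>l<n. \<Sum>j<n. kdelta j l * (cnj (\<xi> j) * \<xi> l))"
    using assms by (simp add: unitary_def)
  also have "\<dots> = complex_of_real (nsq n \<xi>)"
    by (simp add: of_real_nsq mult.commute)
  finally show ?thesis by (simp only: of_real_eq_iff)
qed

lemma unitary_opbd: "unitary n F \<Longrightarrow> opbd n n F 1"
  by (simp add: opbd_def unitary_isometry)

lemma unitary_adjoint: "unitary n F \<Longrightarrow> unitary n (\<lambda>i j. cnj (F j i))"
  by (auto simp: unitary_def)

section \<open>The J-method bounds\<close>

type_synonym cube = "nat \<Rightarrow> nat \<Rightarrow> nat \<Rightarrow> complex"

text \<open>The quadratic form of sum_k v_k^* v_k over k < K. The norm of this sum is the square of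
  the norm of \<open>v\<close> in matrices over the column Hilbert space.\<close>

definition colq :: "nat \<Rightarrow> nat \<Rightarrow> cube \<Rightarrow> (nat \<Rightarrow> complex) \<Rightarrow> real" where
  "colq n K v \<xi> = (\<Sum>k<K. nsq n (\<lambda>i. \<Sum>j<n. v i j k * \<xi> j))"

text \<open>The coordinates of \<open>ell2\<close> are the last argument of a cube. Truncating them at an arbitrary
  \<open>K\<close> avoids convergence questions; a bound uniform in \<open>K\<close> forces the entries to be square summable.\<close>

definition col_bd :: "nat \<Rightarrow> nat \<Rightarrow> (int \<Rightarrow> cube) \<Rightarrow> real \<Rightarrow> bool" where
  "col_bd n M u c \<longleftrightarrow>
     (\<forall>K \<xi>. (\<Sum>m=-int M..int M. 2 powi m * colq n K (u m) \<xi>) \<le> c\<^sup>2 * nsq n \<xi>)"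

text \<open>Transposing the matrices exchanges column and row norms, and negating \<open>m\<close>
  exchanges the weights 2^m and 2^(-m). Hence the row half of a J-bound is the column half for the
  flipped family, and each estimate is proved for columns only.\<close>

definition flip :: "(int \<Rightarrow> cube) \<Rightarrow> int \<Rightarrow> cube" where
  "flip u m i j k = u (- m) j i k"

definition J_bd :: "nat \<Rightarrow> nat \<Rightarrow> (int \<Rightarrow> cube) \<Rightarrow> real \<Rightarrow> bool" where
  "J_bd n M u c \<longleftrightarrow> 0 \<le> c \<and> col_bd n M u c \<and> col_bd n M (flip u) c"

text \<open>The bound \<open>M\<close> may be enlarged at will, which lets two families share the
  same range of summation.\<close>

definition supp :: "nat \<Rightarrow> (int \<Rightarrow> cube) \<Rightarrow> bool" where
  "supp M u \<longleftrightarrow> (\<forall>m. int M < \<bar>m\<bar> \<longrightarrow> u m = (\<lambda>_ _ _. 0))"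

definition sandwich :: "nat \<Rightarrow> (nat \<Rightarrow> nat \<Rightarrow> complex) \<Rightarrow> cube \<Rightarrow> (nat \<Rightarrow> nat \<Rightarrow> complex) \<Rightarrow> cube" where
  "sandwich n \<alpha> v \<beta> i j k = (\<Sum>a<n. \<Sum>b<n. \<alpha> i a * \<beta> b j * v a b k)"

definition block_sum :: "nat \<Rightarrow> cube \<Rightarrow> cube \<Rightarrow> cube" where
  "block_sum m A B i j k = (if i < m \<and> j < m then A i j k else if m \<le> i \<and> m \<le> j then B (i - m) (j - m) k else 0)"

lemma flip_flip [simp]: "flip (flip u) = u"
  by (simp add: flip_def fun_eq_iff)

lemma supp_flip [simp]: "supp M (flip u) \<longleftrightarrow> supp M u"
proof -
  have "supp M (flip v)" if "supp M v" for v
    using that by (auto simp: supp_def flip_def fun_eq_iff)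
  from this[of u] this[of "flip u"] show ?thesis by auto
qed

lemma supp_mono: "supp M u \<Longrightarrow> M \<le> M' \<Longrightarrow> supp M' u"
  by (auto simp: supp_def)

lemma supp_sum:
  fixes f :: "int \<Rightarrow> 'a::comm_monoid_add"
  assumes "supp M u" "M \<le> M'" "\<And>m. u m = (\<lambda>_ _ _. 0) \<Longrightarrow> f m = 0"
  shows "(\<Sum>m=-int M'..int M'. f m) = (\<Sum>m=-int M..int M. f m)"
proof (rule sum.mono_neutral_right)
  show "\<forall>m\<in>{-int M'..int M'} - {-int M..int M}. f m = 0"
  proof
    fix m assume "m \<in> {-int M'..int M'} - {-int M..int M}"
    then have "int M < \<bar>m\<bar>" by auto
    then show "f m = 0" using assms(1,3) by (simp add: supp_def)
  qed
qed (use assms(2) in auto)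

lemma colq_nonneg [simp]: "0 \<le> colq n K v \<xi>"
  by (simp add: colq_def sum_nonneg)

lemma colq_zero [simp]: "colq n K (\<lambda>_ _ _. 0) \<xi> = 0"
  by (simp add: colq_def nsq_def)

lemma col_bd_supp: "supp M u \<Longrightarrow> M \<le> M' \<Longrightarrow> col_bd n M u c \<Longrightarrow> col_bd n M' u c"
proof -
  assume u: "supp M u" "M \<le> M'" "col_bd n M u c"
  have "(\<Sum>m=-int M'..int M'. 2 powi m * colq n K (u m) \<xi>) = (\<Sum>m=-int M..int M. 2 powi m * colq n K (u m) \<xi>)" for K \<xi>
    by (rule supp_sum[OF u(1,2)]) (simp only: colq_zero mult_zero_right)
  then show "col_bd n M' u c" using u(3) by (auto simp only: col_bd_def)
qed

lemma J_bd_supp: "supp M u \<Longrightarrow> M \<le> M' \<Longrightarrow> J_bd n M u c \<Longrightarrow> J_bd n M' u c"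
  by (simp add: J_bd_def col_bd_supp)

lemma J_bd_flip: "J_bd n M (flip u) c \<longleftrightarrow> J_bd n M u c"
  by (auto simp: J_bd_def)

lemma col_bd_mono: "col_bd n M u c \<Longrightarrow> 0 \<le> c \<Longrightarrow> c \<le> d \<Longrightarrow> col_bd n M u d"
  unfolding col_bd_def by (meson mult_right_mono nsq_nonneg order_trans power_mono)

lemma J_bd_mono: "J_bd n M u c \<Longrightarrow> c \<le> d \<Longrightarrow> J_bd n M u d"
  by (auto simp: J_bd_def intro: col_bd_mono)

section \<open>Stability of J-bounds under sums, scalars, two-sided multiplication and direct
  sums\<close>

text \<open>Read as an \<open>L2_set\<close> norm over all triples (m, k, i), the column bound is
  subadditive by Minkowski's inequality.\<close>

lemma col_bd_L2:
  assumes "0 \<le> c"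
  shows "col_bd n M u c \<longleftrightarrow> (\<forall>K \<xi>. L2_set (\<lambda>(m, k, i). sqrt (2 powi m) * cmod (\<Sum>j<n. u m i j k * \<xi> j))
     ({-int M..int M} \<times> {..<K} \<times> {..<n}) \<le> c * sqrt (nsq n \<xi>))"
proof -
  have "L2_set (\<lambda>(m, k, i). sqrt (2 powi m) * cmod (\<Sum>j<n. u m i j k * \<xi> j))
     ({-int M..int M} \<times> {..<K} \<times> {..<n}) = sqrt (\<Sum>m=-int M..int M. 2 powi m * colq n K (u m) \<xi>)" for K \<xi>
    unfolding L2_set_def
    by (simp add: sum.cartesian_product case_prod_unfold colq_def nsq_def power_mult_distrib sum_distrib_left)
  moreover have "c * sqrt (nsq n \<xi>) = sqrt (c\<^sup>2 * nsq n \<xi>)" for \<xi>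
    using assms by (simp add: real_sqrt_mult)
  ultimately show ?thesis by (simp add: col_bd_def)
qed

lemma col_bd_add:
  assumes "col_bd n M u c" "col_bd n M v d" "0 \<le> c" "0 \<le> d"
  shows "col_bd n M (\<lambda>m i j k. u m i j k + v m i j k) (c + d)"
proof -
  have "0 \<le> c + d" using assms by simp
  note iff = col_bd_L2[OF this]
  show ?thesis unfolding iff
  proof (intro allI)
    fix K :: nat and \<xi>
    let ?S = "{-int M..int M} \<times> {..<K} \<times> {..<n}"
    let ?f = "\<lambda>u (m, k, i). sqrt (2 powi m) * cmod (\<Sum>j<n. u m i j k * \<xi> j)"
    have "sqrt (2 powi m) * cmod (\<Sum>j<n. (u m i j k + v m i j k) * \<xi> j) \<le>
        sqrt (2 powi m) * cmod (\<Sum>j<n. u m i j k * \<xi> j) + sqrt (2 powi m) * cmod (\<Sum>j<n. v m i j k * \<xi> j)" for m i k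
      unfolding distrib_right sum.distrib distrib_left[symmetric]
      by (intro mult_left_mono norm_triangle_ineq) simp
    then have "L2_set (?f (\<lambda>m i j k. u m i j k + v m i j k)) ?S \<le> L2_set (\<lambda>x. ?f u x + ?f v x) ?S"
      by (intro L2_set_mono) auto
    also have "\<dots> \<le> L2_set (?f u) ?S + L2_set (?f v) ?S" by (rule L2_set_triangle_ineq)
    also have "\<dots> \<le> c * sqrt (nsq n \<xi>) + d * sqrt (nsq n \<xi>)"
      using assms by (intro add_mono) (simp_all add: col_bd_L2)
    finally show "L2_set (?f (\<lambda>m i j k. u m i j k + v m i j k)) ?S \<le> (c + d) * sqrt (nsq n \<xi>)"
      by (simp add: distrib_right)
  qed
qed

lemma J_bd_add:
  assumes "J_bd n M u c" "J_bd n M v d"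
  shows "J_bd n M (\<lambda>m i j k. u m i j k + v m i j k) (c + d)"
proof -
  have "flip (\<lambda>m i j k. u m i j k + v m i j k) = (\<lambda>m i j k. flip u m i j k + flip v m i j k)"
    by (simp add: flip_def fun_eq_iff)
  then show ?thesis using assms by (simp add: J_bd_def col_bd_add)
qed

lemma colq_scale: "colq n K (\<lambda>i j k. c * v i j k) \<xi> = (cmod c)\<^sup>2 * colq n K v \<xi>"
  by (simp add: colq_def sum_distrib_left nsq_scale[symmetric] mult.assoc)

lemma J_bd_scale:
  assumes "J_bd n M u c"
  shows "J_bd n M (\<lambda>m i j k. a * u m i j k) (cmod a * c)"
proof -
  have "col_bd n M (\<lambda>m i j k. a * v m i j k) (cmod a * c)" if "col_bd n M v c" for v
    unfolding col_bd_def
  proof (intro allI)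
    fix K \<xi>
    have "(\<Sum>m=-int M..int M. 2 powi m * colq n K (\<lambda>i j k. a * v m i j k) \<xi>) =
       (cmod a)\<^sup>2 * (\<Sum>m=-int M..int M. 2 powi m * colq n K (v m) \<xi>)"
      by (simp add: colq_scale sum_distrib_left mult_ac)
    also have "\<dots> \<le> (cmod a)\<^sup>2 * (c\<^sup>2 * nsq n \<xi>)"
      using that by (intro mult_left_mono) (simp_all add: col_bd_def)
    finally show "(\<Sum>m=-int M..int M. 2 powi m * colq n K (\<lambda>i j k. a * v m i j k) \<xi>) \<le> (cmod a * c)\<^sup>2 * nsq n \<xi>"
      by (simp add: power_mult_distrib mult_ac)
  qed
  moreover have "flip (\<lambda>m i j k. a * u m i j k) = (\<lambda>m i j k. a * flip u m i j k)"
    by (simp add: flip_def fun_eq_iff)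
  ultimately show ?thesis using assms by (simp add: J_bd_def)
qed

lemma colq_sandwich:
  assumes "opbd p n \<alpha> s"
  shows "colq p K (sandwich n \<alpha> v \<beta>) \<xi> \<le> s\<^sup>2 * colq n K v (\<lambda>b. \<Sum>j<p. \<beta> b j * \<xi> j)"
proof -
  have "(\<Sum>j<p. sandwich n \<alpha> v \<beta> i j k * \<xi> j) =
      (\<Sum>a<n. \<alpha> i a * (\<Sum>b<n. v a b k * (\<Sum>j<p. \<beta> b j * \<xi> j)))" for i k
  proof -
    have "(\<Sum>j<p. sandwich n \<alpha> v \<beta> i j k * \<xi> j) = (\<Sum>j<p. \<Sum>a<n. \<Sum>b<n. \<alpha> i a * (v a b k * (\<beta> b j * \<xi> j)))"
      unfolding sandwich_def sum_distrib_right by (intro sum.cong refl) (simp only: mult_ac)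
    also have "\<dots> = (\<Sum>a<n. \<Sum>b<n. \<Sum>j<p. \<alpha> i a * (v a b k * (\<beta> b j * \<xi> j)))"
      by (subst sum.swap, subst (2) sum.swap) (rule refl)
    finally show ?thesis by (simp add: sum_distrib_left)
  qed
  then show ?thesis
    unfolding colq_def by (subst sum_distrib_left, intro sum_mono) (simp only: opbdD[OF assms])
qed

lemma col_bd_sandwich:
  assumes "col_bd n M u c" "opbd p n \<alpha> s" "opbd n p \<beta> t"
  shows "col_bd p M (\<lambda>m. sandwich n \<alpha> (u m) \<beta>) (s * c * t)"
  unfolding col_bd_def
proof (intro allI)
  fix K \<xi>
  let ?z = "\<lambda>b. \<Sum>j<p. \<beta> b j * \<xi> j"
  have "(\<Sum>m=-int M..int M. 2 powi m * colq p K (sandwich n \<alpha> (u m) \<beta>) \<xi>) \<le>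
     (\<Sum>m=-int M..int M. 2 powi m * (s\<^sup>2 * colq n K (u m) ?z))"
    by (intro sum_mono mult_left_mono colq_sandwich assms) simp
  also have "\<dots> = s\<^sup>2 * (\<Sum>m=-int M..int M. 2 powi m * colq n K (u m) ?z)"
    by (simp add: sum_distrib_left mult_ac)
  also have "\<dots> \<le> s\<^sup>2 * (c\<^sup>2 * nsq n ?z)"
    using assms(1) by (intro mult_left_mono) (simp_all add: col_bd_def)
  also have "\<dots> \<le> s\<^sup>2 * (c\<^sup>2 * (t\<^sup>2 * nsq p \<xi>))"
    by (intro mult_left_mono opbdD assms) simp_all
  finally show "(\<Sum>m=-int M..int M. 2 powi m * colq p K (sandwich n \<alpha> (u m) \<beta>) \<xi>) \<le> (s * c * t)\<^sup>2 * nsq p \<xi>"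
    by (simp add: power_mult_distrib mult_ac)
qed

lemma sandwich_transpose:
  "sandwich n \<alpha> v \<beta> i j k = sandwich n (\<lambda>i j. \<beta> j i) (\<lambda>a b. v b a) (\<lambda>i j. \<alpha> j i) j i k"
proof -
  have "sandwich n \<alpha> v \<beta> i j k = (\<Sum>b<n. \<Sum>a<n. \<alpha> i a * \<beta> b j * v a b k)"
    unfolding sandwich_def by (rule sum.swap)
  also have "\<dots> = (\<Sum>b<n. \<Sum>a<n. \<beta> b j * \<alpha> i a * v a b k)"
    by (intro sum.cong refl) simp
  finally show ?thesis by (simp only: sandwich_def)
qed

text \<open>Flipping turns the product into one with transposed and exchanged factors, so the row
  half is again the column estimate.\<close>

lemma J_bd_sandwich:
  assumes "J_bd n M u c" "opbd p n \<alpha> s" "opbd n p \<beta> t"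
  shows "J_bd p M (\<lambda>m. sandwich n \<alpha> (u m) \<beta>) (s * c * t)"
proof -
  have "flip (\<lambda>m. sandwich n \<alpha> (u m) \<beta>) = (\<lambda>m. sandwich n (\<lambda>i j. \<beta> j i) (flip u m) (\<lambda>i j. \<alpha> j i))"
  proof (intro ext)
    fix m i j k
    have "flip u m = (\<lambda>a b. u (- m) b a)" by (simp add: flip_def fun_eq_iff)
    then show "flip (\<lambda>m. sandwich n \<alpha> (u m) \<beta>) m i j k = sandwich n (\<lambda>i j. \<beta> j i) (flip u m) (\<lambda>i j. \<alpha> j i) i j k"
      using sandwich_transpose[of n \<alpha> "u (- m)" \<beta> j i k] by (simp only: flip_def)
  qed
  moreover have "col_bd p M (\<lambda>m. sandwich n (\<lambda>i j. \<beta> j i) (flip u m) (\<lambda>i j. \<alpha> j i)) (t * c * s)"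
    using assms(1) by (intro col_bd_sandwich opbd_transpose[OF assms(2)] opbd_transpose[OF assms(3)]) (simp add: J_bd_def)
  ultimately show ?thesis
    using assms col_bd_sandwich[of n M u c p \<alpha> s \<beta> t] by (simp add: J_bd_def mult_ac opbd_def)
qed

lemma supp_sandwich: "supp M u \<Longrightarrow> supp M (\<lambda>m. sandwich n \<alpha> (u m) \<beta>)"
  by (auto simp: supp_def sandwich_def fun_eq_iff)

text \<open>The form of a direct sum has no cross terms; this is why two bounds combine to their
  maximum and not to their sum.\<close>

lemma colq_block_sum:
  "colq (m + n) K (block_sum m A B) \<xi> = colq m K A \<xi> + colq n K B (\<lambda>j. \<xi> (m + j))"
proof -
  have "nsq (m + n) (\<lambda>i. \<Sum>j<m + n. block_sum m A B i j k * \<xi> j) =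
     nsq m (\<lambda>i. \<Sum>j<m. A i j k * \<xi> j) + nsq n (\<lambda>i. \<Sum>j<n. B i j k * \<xi> (m + j))" for k
    by (simp add: nsq_def sum_lessThan_add block_sum_def)
  then show ?thesis by (simp add: colq_def sum.distrib)
qed

lemma nsq_add: "nsq (m + n) \<xi> = nsq m \<xi> + nsq n (\<lambda>j. \<xi> (m + j))"
  by (simp add: nsq_def sum_lessThan_add)

lemma col_bd_block_sum:
  assumes "col_bd m M u c" "col_bd n M v c"
  shows "col_bd (m + n) M (\<lambda>l. block_sum m (u l) (v l)) c"
  unfolding col_bd_def colq_block_sum nsq_add distrib_left sum.distrib
  using assms by (auto simp: col_bd_def intro: add_mono)

lemma J_bd_block_sum:
  assumes "J_bd m M u c" "J_bd n M v c"
  shows "J_bd (m + n) M (\<lambda>l. block_sum m (u l) (v l)) c"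
proof -
  have "flip (\<lambda>l. block_sum m (u l) (v l)) = (\<lambda>l. block_sum m (flip u l) (flip v l))"
    by (auto simp: flip_def block_sum_def fun_eq_iff)
  then show ?thesis using assms by (simp add: J_bd_def col_bd_block_sum)
qed

lemma supp_block_sum: "supp M u \<Longrightarrow> supp M v \<Longrightarrow> supp M (\<lambda>l. block_sum m (u l) (v l))"
  by (auto simp: supp_def block_sum_def fun_eq_iff)

section \<open>Test matrices against a J-bounded family\<close>

text \<open>The series bounds the sum over one side of \<open>m0\<close>. One factor 2 accounts for
  the two sides, the other for rounding a ratio to a power of 2.\<close>

definition gauge_const :: real where
  "gauge_const = 4 * (\<Sum>d. (1 + real d)\<^sup>2 / 2 ^ d)"

text \<open>The freedom in \<open>m0\<close> is what bounds \<open>y = \<Sum>m. m * u m\<close> when \<open>\<Sum>m. u m = 0\<close>: then also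
  \<open>y = \<Sum>m. (m - m0) * u m\<close>.\<close>

definition gauged :: "nat \<Rightarrow> nat \<Rightarrow> (int \<Rightarrow> cube) \<Rightarrow> cube \<Rightarrow> bool" where
  "gauged n M u y \<longleftrightarrow> (\<forall>m0. \<exists>e. (\<forall>m. cmod (e m) \<le> 1 + real_of_int \<bar>m - m0\<bar>) \<and>
     (\<forall>i<n. \<forall>j<n. \<forall>k. y i j k = (\<Sum>m=-int M..int M. e m * u m i j k)))"

lemma gauged_sandwich:
  assumes "gauged n M u y"
  shows "gauged p M (\<lambda>m. sandwich n \<alpha> (u m) \<beta>) (sandwich n \<alpha> y \<beta>)"
  unfolding gauged_def
proof
  fix m0
  obtain e where e: "(\<forall>m. cmod (e m) \<le> 1 + real_of_int \<bar>m - m0\<bar>) \<and>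
      (\<forall>i<n. \<forall>j<n. \<forall>k. y i j k = (\<Sum>m=-int M..int M. e m * u m i j k))"
    using assms[unfolded gauged_def, THEN spec, of m0] by (rule exE)
  have "sandwich n \<alpha> y \<beta> i j k = (\<Sum>m=-int M..int M. e m * sandwich n \<alpha> (u m) \<beta> i j k)" for i j k
  proof -
    have "sandwich n \<alpha> y \<beta> i j k = (\<Sum>a<n. \<Sum>b<n. \<Sum>m=-int M..int M. e m * (\<alpha> i a * \<beta> b j * u m a b k))"
    proof -
      have "\<alpha> i a * \<beta> b j * y a b k = (\<Sum>m=-int M..int M. e m * (\<alpha> i a * \<beta> b j * u m a b k))" if "a < n" "b < n" for a b
        unfolding conjunct2[OF e, rule_format, OF that] sum_distrib_left by (intro sum.cong refl) (simp only: mult_ac)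
      then show ?thesis unfolding sandwich_def by (intro sum.cong refl) simp
    qed
    also have "\<dots> = (\<Sum>m=-int M..int M. \<Sum>a<n. \<Sum>b<n. e m * (\<alpha> i a * \<beta> b j * u m a b k))"
      by (subst sum.swap, subst (2) sum.swap, rule refl)
    finally show ?thesis by (simp add: sandwich_def sum_distrib_left)
  qed
  then show "\<exists>e. (\<forall>m. cmod (e m) \<le> 1 + real_of_int \<bar>m - m0\<bar>) \<and>
     (\<forall>i<p. \<forall>j<p. \<forall>k. sandwich n \<alpha> y \<beta> i j k = (\<Sum>m=-int M..int M. e m * sandwich n \<alpha> (u m) \<beta> i j k))"
    using conjunct1[OF e] by (intro exI[of _ e]) simp
qed

lemma summable_gauge: "summable (\<lambda>d. (1 + real d)\<^sup>2 / 2 ^ d)"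
proof (rule summable_ratio_test)
  fix d :: nat assume "4 \<le> d"
  \<comment> \<open>The ratio 3/4 requires 2 (d + 2)^2 <= 3 (d + 1)^2, that is d^2 - 2 d - 5 >=
    0.\<close>
  then have "0 \<le> (real d - 4) * (real d + 2)" by simp
  then have "0 \<le> real d * real d - 2 * real d - 5 - 3" by (simp add: algebra_simps)
  then have "2 * (2 + real d)\<^sup>2 \<le> 3 * (1 + real d)\<^sup>2"
    by (simp add: power2_eq_square algebra_simps)
  then show "norm ((1 + real (Suc d))\<^sup>2 / 2 ^ Suc d) \<le> (3 / 4) * norm ((1 + real d)\<^sup>2 / 2 ^ d)"
    by (simp add: field_simps)
qed simp

lemma gauge_const_nonneg: "0 \<le> gauge_const"
  unfolding gauge_const_def by (intro mult_nonneg_nonneg suminf_nonneg summable_gauge) simp_all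

lemma sum_gauge_le:
  assumes "finite A"
  shows "(\<Sum>m\<in>A. (1 + real_of_int \<bar>m - m0\<bar>)\<^sup>2 / 2 powi \<bar>m - m0\<bar>) \<le> gauge_const / 2"
proof -
  let ?f = "\<lambda>d. (1 + real d)\<^sup>2 / 2 ^ d"
  have f: "(1 + real_of_int \<bar>m - m0\<bar>)\<^sup>2 / 2 powi \<bar>m - m0\<bar> = ?f (nat \<bar>m - m0\<bar>)" for m
    by (simp add: power_int_def)
  have half: "(\<Sum>m\<in>B. ?f (nat \<bar>m - m0\<bar>)) \<le> gauge_const / 4"
    if "finite B" "inj_on (\<lambda>m. nat \<bar>m - m0\<bar>) B" for B
  proof -
    have "(\<Sum>m\<in>B. ?f (nat \<bar>m - m0\<bar>)) = sum ?f ((\<lambda>m. nat \<bar>m - m0\<bar>) ` B)"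
      by (simp add: sum.reindex[OF that(2)])
    also have "\<dots> \<le> suminf ?f"
      by (rule sum_le_suminf[OF summable_gauge]) (use that(1) in auto)
    finally show ?thesis by (simp add: gauge_const_def)
  qed
  have "(\<Sum>m\<in>A. ?f (nat \<bar>m - m0\<bar>)) = (\<Sum>m\<in>{m\<in>A. m0 \<le> m}. ?f (nat \<bar>m - m0\<bar>)) + (\<Sum>m\<in>{m\<in>A. \<not> m0 \<le> m}. ?f (nat \<bar>m - m0\<bar>))"
    using assms by (subst sum.union_disjoint[symmetric]) (auto intro!: sum.cong)
  also have "\<dots> \<le> gauge_const / 4 + gauge_const / 4"
    by (intro add_mono half) (use assms in \<open>auto simp: inj_on_def\<close>)
  finally show ?thesis unfolding f by simp
qed

lemma dyadic_bracket:
  assumes "0 < (x::real)"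
  shows "\<exists>m::int. 2 powi m \<le> x \<and> x < 2 * 2 powi m"
proof -
  define m where "m = \<lfloor>log 2 x\<rfloor>"
  have "2 powr real_of_int m \<le> x"
    using assms by (simp add: m_def powr_le_iff)
  moreover have "x < 2 powr (real_of_int m + 1)"
    using assms by (simp add: m_def less_powr_iff)
  ultimately show ?thesis
    by (intro exI[of _ m]) (simp add: powr_add powr_real_of_int' mult.commute)
qed

text \<open>The weight 2^m s^2 + 2^(-m) t^2 is smallest near \<open>m0\<close>, where it is about s
  t, and it grows like s t 2^|m - m0| away from it. Cauchy-Schwarz with the weights 2^|m - m0|
  leaves the series of (1 + |m - m0|)^2 / 2^|m - m0|: the linear growth of the coefficients is
  absorbed by the geometric decay.\<close>

lemma bracketed_pointwise:
  fixes s t :: real and v e :: "int \<Rightarrow> complex"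
  assumes m0: "2 powi m0 \<le> t / s" "t / s < 2 * 2 powi m0" and st: "0 < s" "0 < t"
    and e: "\<And>m. cmod (e m) \<le> 1 + real_of_int \<bar>m - m0\<bar>"
  shows "t * s * (cmod (\<Sum>m=-int M..int M. e m * v m))\<^sup>2 \<le>
    gauge_const * (\<Sum>m=-int M..int M. (2 powi m * s\<^sup>2 + 2 powi (-m) * t\<^sup>2) * (cmod (v m))\<^sup>2)"
proof -
  let ?I = "{-int M..int M}" and ?d = "\<lambda>m. \<bar>m - m0\<bar>"
  have "cmod (\<Sum>m\<in>?I. e m * v m) \<le> (\<Sum>m\<in>?I. (1 + real_of_int (?d m)) / sqrt (2 powi ?d m) * (sqrt (2 powi ?d m) * cmod (v m)))"
      proof (rule sum_norm_le)
    fix m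
    show "cmod (e m * v m) \<le> (1 + real_of_int (?d m)) / sqrt (2 powi ?d m) * (sqrt (2 powi ?d m) * cmod (v m))"
      using mult_right_mono[OF e[of m], of "cmod (v m)"] by (simp add: norm_mult)
  qed
  then have "(cmod (\<Sum>m\<in>?I. e m * v m))\<^sup>2 \<le> (\<Sum>m\<in>?I. (1 + real_of_int (?d m)) / sqrt (2 powi ?d m) * (sqrt (2 powi ?d m) * cmod (v m)))\<^sup>2"
    by (rule power_mono) simp
  also have "\<dots> \<le> (\<Sum>m\<in>?I. ((1 + real_of_int (?d m)) / sqrt (2 powi ?d m))\<^sup>2) * (\<Sum>m\<in>?I. (sqrt (2 powi ?d m) * cmod (v m))\<^sup>2)"
    by (rule Cauchy_Schwarz_ineq_sum)
  also have "\<dots> = (\<Sum>m\<in>?I. (1 + real_of_int (?d m))\<^sup>2 / 2 powi ?d m) * (\<Sum>m\<in>?I. 2 powi ?d m * (cmod (v m))\<^sup>2)"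
    by (simp add: power_divide power_mult_distrib)
  also have "\<dots> \<le> gauge_const / 2 * (\<Sum>m\<in>?I. 2 powi ?d m * (cmod (v m))\<^sup>2)"
    by (intro mult_right_mono sum_gauge_le sum_nonneg) simp_all
  finally have "t * s * (cmod (\<Sum>m\<in>?I. e m * v m))\<^sup>2 \<le> t * s * (gauge_const / 2 * (\<Sum>m\<in>?I. 2 powi ?d m * (cmod (v m))\<^sup>2))"
    using st by (intro mult_left_mono) simp_all
  also have "\<dots> = gauge_const / 2 * (\<Sum>m\<in>?I. t * s * 2 powi ?d m * (cmod (v m))\<^sup>2)"
    by (simp add: sum_distrib_left mult_ac)
  also have "\<dots> \<le> gauge_const / 2 * (\<Sum>m\<in>?I. 2 * ((2 powi m * s\<^sup>2 + 2 powi (-m) * t\<^sup>2) * (cmod (v m))\<^sup>2))"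
  proof (intro mult_left_mono sum_mono)
    fix m
    \<comment> \<open>One weight suffices on each side of \<open>m0\<close>: the one with
      \<open>s\<close> from \<open>m0\<close> on, the one with \<open>t\<close> below. The rounding
      of t / s costs a factor 2 on the first side.\<close>
    have "t * s * 2 powi ?d m \<le> 2 * (2 powi m * s\<^sup>2 + 2 powi (-m) * t\<^sup>2)"
    proof (cases "m0 \<le> m")
      case True
      have "t * s \<le> (2 * 2 powi m0 * s) * s"
        using m0(2) st by (simp add: field_simps)
      from mult_right_mono[OF this, of "2 powi (m - m0)"]
      have "t * s * 2 powi ?d m \<le> (2 * 2 powi m0 * s) * s * 2 powi (m - m0)"
        using True by simp
      also have "\<dots> = 2 * (2 powi m * s\<^sup>2)"
        by (simp add: power_int_diff power2_eq_square)
      finally show ?thesis by (rule order_trans) simp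
    next
      case False
      have "t * s * 2 powi ?d m = t * (s * 2 powi m0) * 2 powi (- m)"
        using False by (simp add: power_int_diff power_int_minus field_simps)
      also have "\<dots> \<le> t * t * 2 powi (- m)"
        using m0(1) st by (intro mult_right_mono mult_left_mono) (simp_all add: field_simps)
      also have "\<dots> = 2 powi (-m) * t\<^sup>2" by (simp add: power2_eq_square)
      also have "\<dots> \<le> 2 * (2 powi m * s\<^sup>2 + 2 powi (-m) * t\<^sup>2)" by simp
      finally show ?thesis .
    qed
    then have "t * s * 2 powi ?d m * (cmod (v m))\<^sup>2 \<le> 2 * (2 powi m * s\<^sup>2 + 2 powi (-m) * t\<^sup>2) * (cmod (v m))\<^sup>2"
      by (rule mult_right_mono) simp
    then show "t * s * 2 powi ?d m * (cmod (v m))\<^sup>2 \<le> 2 * ((2 powi m * s\<^sup>2 + 2 powi (-m) * t\<^sup>2) * (cmod (v m))\<^sup>2)"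
      by (simp only: mult.assoc)
  qed (simp add: gauge_const_nonneg)
  finally show ?thesis by (simp add: sum_distrib_left[symmetric])
qed

text \<open>Here \<open>m0\<close> is read off from t / s, which differs from entry to entry once
  \<open>s\<close> and \<open>t\<close> are eigenvalues. This is why the coefficients in
  \<open>gauged\<close> may depend on \<open>m0\<close>.\<close>

lemma gauged_pointwise:
  fixes s t :: real
  assumes y: "gauged n M u y" and ij: "i < n" "j < n" and st: "0 < s" "0 < t"
  shows "t * s * (cmod (y i j k))\<^sup>2 \<le>
    gauge_const * (\<Sum>m=-int M..int M. (2 powi m * s\<^sup>2 + 2 powi (-m) * t\<^sup>2) * (cmod (u m i j k))\<^sup>2)"
proof -
  obtain m0 :: int where m0: "2 powi m0 \<le> t / s" "t / s < 2 * 2 powi m0"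
    using dyadic_bracket[of "t / s"] st by auto
  obtain e where e: "\<And>m. cmod (e m) \<le> 1 + real_of_int \<bar>m - m0\<bar>"
      "y i j k = (\<Sum>m=-int M..int M. e m * u m i j k)"
    using y ij unfolding gauged_def by blast
  show ?thesis
    unfolding e(2) by (rule bracketed_pointwise[OF m0 st e(1)])
qed

lemma sum_int_uminus:
  fixes f :: "int \<Rightarrow> 'a::comm_monoid_add"
  shows "(\<Sum>m=-int M..int M. f (- m)) = (\<Sum>m=-int M..int M. f m)"
  by (rule sum.reindex_bij_witness[of _ uminus uminus]) auto

lemma col_bd_basis:
  assumes "col_bd n M u c" "j < n"
  shows "(\<Sum>m=-int M..int M. 2 powi m * (\<Sum>k<K. \<Sum>i<n. (cmod (u m i j k))\<^sup>2)) \<le> c\<^sup>2"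
proof -
  have "colq n K v (kdelta j) = (\<Sum>k<K. \<Sum>i<n. (cmod (v i j k))\<^sup>2)" for v
    using assms(2) by (simp add: colq_def nsq_def)
  moreover have "(\<Sum>m=-int M..int M. 2 powi m * colq n K (u m) (kdelta j)) \<le> c\<^sup>2 * nsq n (kdelta j)"
    using assms(1) by (simp add: col_bd_def)
  ultimately show ?thesis by (simp add: nsq_kdelta[OF assms(2)])
qed

text \<open>The case of diagonal test matrices with entries \<open>s\<close> and \<open>t\<close>.
  When the pointwise bounds are summed, the terms with \<open>s j\<close> collect the j-th columns
  and those with \<open>t i\<close> the i-th rows of the family; each contributes at most c^2, by
  testing the J-bound on basis vectors.\<close>

lemma J_bd_weighted:
  assumes J: "J_bd n M u c" and y: "gauged n M u y"
    and st: "\<And>i. 0 \<le> s i" "\<And>i. 0 \<le> t i"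
  shows "(\<Sum>k<K. \<Sum>i<n. \<Sum>j<n. t i * s j * (cmod (y i j k))\<^sup>2) \<le>
    gauge_const * c\<^sup>2 * ((\<Sum>j<n. (s j)\<^sup>2) + (\<Sum>i<n. (t i)\<^sup>2))"
proof -
  let ?I = "{-int M..int M}"
  have pt: "t i * s j * (cmod (y i j k))\<^sup>2 \<le>
      gauge_const * (\<Sum>m\<in>?I. (2 powi m * (s j)\<^sup>2 + 2 powi (-m) * (t i)\<^sup>2) * (cmod (u m i j k))\<^sup>2)"
    if "i < n" "j < n" for i j k
  proof (cases "t i = 0 \<or> s j = 0")
    case True
    then show ?thesis by (auto intro!: mult_nonneg_nonneg sum_nonneg gauge_const_nonneg)
  next
    case False
    then show ?thesis
      using st by (intro gauged_pointwise[OF y that]) (simp_all add: order_less_le)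
  qed
  have "(\<Sum>k<K. \<Sum>i<n. \<Sum>j<n. t i * s j * (cmod (y i j k))\<^sup>2) \<le>
      (\<Sum>k<K. \<Sum>i<n. \<Sum>j<n. gauge_const * (\<Sum>m\<in>?I. (2 powi m * (s j)\<^sup>2 + 2 powi (-m) * (t i)\<^sup>2) * (cmod (u m i j k))\<^sup>2))"
    by (intro sum_mono pt) simp_all
  also have "\<dots> = (\<Sum>k<K. \<Sum>i<n. \<Sum>j<n. gauge_const * ((\<Sum>m\<in>?I. (s j)\<^sup>2 * (2 powi m * (cmod (u m i j k))\<^sup>2)) +
      (\<Sum>m\<in>?I. (t i)\<^sup>2 * (2 powi (-m) * (cmod (u m i j k))\<^sup>2))))"
    unfolding sum.distrib[symmetric] by (intro sum.cong refl arg_cong[where f="(*) gauge_const"]) (simp only: distrib_left distrib_right mult_ac)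
  also have "\<dots> = gauge_const * ((\<Sum>k<K. \<Sum>i<n. \<Sum>j<n. \<Sum>m\<in>?I. (s j)\<^sup>2 * (2 powi m * (cmod (u m i j k))\<^sup>2)) +
      (\<Sum>k<K. \<Sum>i<n. \<Sum>j<n. \<Sum>m\<in>?I. (t i)\<^sup>2 * (2 powi (-m) * (cmod (u m i j k))\<^sup>2)))"
    by (simp only: sum.distrib sum_distrib_left[symmetric])
  also have "\<dots> \<le> gauge_const * ((\<Sum>j<n. (s j)\<^sup>2 * c\<^sup>2) + (\<Sum>i<n. (t i)\<^sup>2 * c\<^sup>2))"
  proof (intro mult_left_mono add_mono)
  show "(\<Sum>k<K. \<Sum>i<n. \<Sum>j<n. \<Sum>m\<in>?I. (s j)\<^sup>2 * (2 powi m * (cmod (u m i j k))\<^sup>2)) \<le> (\<Sum>j<n. (s j)\<^sup>2 * c\<^sup>2)"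
  proof -
    have "(\<Sum>k<K. \<Sum>i<n. \<Sum>j<n. \<Sum>m\<in>?I. (s j)\<^sup>2 * (2 powi m * (cmod (u m i j k))\<^sup>2)) =
        (\<Sum>j<n. \<Sum>m\<in>?I. \<Sum>k<K. \<Sum>i<n. (s j)\<^sup>2 * (2 powi m * (cmod (u m i j k))\<^sup>2))"
      by (subst (2) sum.swap, subst sum.swap, subst (3) sum.swap, subst (2) sum.swap) (rule refl)
    also have "\<dots> = (\<Sum>j<n. (s j)\<^sup>2 * (\<Sum>m\<in>?I. 2 powi m * (\<Sum>k<K. \<Sum>i<n. (cmod (u m i j k))\<^sup>2)))"
      by (simp add: sum_distrib_left)
    also have "\<dots> \<le> (\<Sum>j<n. (s j)\<^sup>2 * c\<^sup>2)"
      using J by (intro sum_mono mult_left_mono col_bd_basis) (simp_all add: J_bd_def)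
    finally show ?thesis .
  qed
  show "(\<Sum>k<K. \<Sum>i<n. \<Sum>j<n. \<Sum>m\<in>?I. (t i)\<^sup>2 * (2 powi (-m) * (cmod (u m i j k))\<^sup>2)) \<le> (\<Sum>i<n. (t i)\<^sup>2 * c\<^sup>2)"
  proof -
    have "(\<Sum>k<K. \<Sum>i<n. \<Sum>j<n. \<Sum>m\<in>?I. (t i)\<^sup>2 * (2 powi (-m) * (cmod (u m i j k))\<^sup>2)) =
        (\<Sum>i<n. \<Sum>m\<in>?I. \<Sum>k<K. \<Sum>j<n. (t i)\<^sup>2 * (2 powi (-m) * (cmod (u m i j k))\<^sup>2))"
      by (subst sum.swap, subst (3) sum.swap, subst (2) sum.swap) (rule refl)
    also have "\<dots> = (\<Sum>i<n. (t i)\<^sup>2 * (\<Sum>m\<in>?I. 2 powi (-m) * (\<Sum>k<K. \<Sum>j<n. (cmod (u m i j k))\<^sup>2)))"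
      by (simp add: sum_distrib_left)
    also have "\<dots> = (\<Sum>i<n. (t i)\<^sup>2 * (\<Sum>m\<in>?I. 2 powi m * (\<Sum>k<K. \<Sum>j<n. (cmod (flip u m j i k))\<^sup>2)))"
      using sum_int_uminus[of "\<lambda>m. 2 powi m * (\<Sum>k<K. \<Sum>j<n. (cmod (flip u m j i k))\<^sup>2)" M for i]
      by (simp add: flip_def)
    also have "\<dots> \<le> (\<Sum>i<n. (t i)\<^sup>2 * c\<^sup>2)"
      using J by (intro sum_mono mult_left_mono col_bd_basis) (simp_all add: J_bd_def)
    finally show ?thesis .
  qed
  qed (rule gauge_const_nonneg)
  finally show ?thesis
    unfolding sum_distrib_right[symmetric] by (simp only: distrib_left mult_ac)
qed

section \<open>The Gram form of a cube on pairs of test matrices\<close>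

lemma sum_move_in4:
  "(\<Sum>i\<in>A. \<Sum>i'\<in>B. \<Sum>j\<in>C. \<Sum>j'\<in>D. \<Sum>p\<in>P. g i i' j j' p) =
   (\<Sum>p\<in>P. \<Sum>i\<in>A. \<Sum>i'\<in>B. \<Sum>j\<in>C. \<Sum>j'\<in>D. g i i' j j' p)"
  by (simp only: sum.swap[where B=P])

definition fro :: "nat \<Rightarrow> (nat \<Rightarrow> nat \<Rightarrow> complex) \<Rightarrow> real" where
  "fro n v = (\<Sum>i<n. \<Sum>j<n. (cmod (v i j))\<^sup>2)"

text \<open>This is the sum over k < K of the traces of w^T z_k v z_k^*, in other words the bilinear
  form of the matrix sum_k z_k \<otimes> cnj z_k that defines the norm of OH, with vectors of length
  n^2 read as matrices.\<close>

definition gform :: "nat \<Rightarrow> nat \<Rightarrow> cube \<Rightarrow> (nat \<Rightarrow> nat \<Rightarrow> complex) \<Rightarrow> (nat \<Rightarrow> nat \<Rightarrow> complex) \<Rightarrow> complex" where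
  "gform n K z w v = (\<Sum>k<K. \<Sum>i<n. \<Sum>i'<n. \<Sum>j<n. \<Sum>j'<n. w i i' * (z i j k * cnj (z i' j' k)) * v j j')"

lemma fro_nonneg [simp]: "0 \<le> fro n v"
  by (simp add: fro_def sum_nonneg)

lemma fro_spectral:
  assumes F: "unitary n F" and v: "\<And>i j. i < n \<Longrightarrow> j < n \<Longrightarrow> v i j = (\<Sum>l<n. complex_of_real (s l) * F i l * cnj (F j l))"
  shows "fro n v = (\<Sum>l<n. (s l)\<^sup>2)"
proof -
  have "complex_of_real (fro n v) = (\<Sum>i<n. \<Sum>j<n. v i j * cnj (v i j))"
    by (simp add: fro_def complex_norm_square[symmetric])
  also have "\<dots> = (\<Sum>i<n. \<Sum>j<n. \<Sum>l<n. \<Sum>l'<n. complex_of_real (s l * s l') * (cnj (F i l') * F i l) * (cnj (F j l) * F j l'))"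
    by (intro sum.cong refl) (simp add: v cnj_sum sum_product mult_ac)
  also have "\<dots> = (\<Sum>l<n. \<Sum>l'<n. \<Sum>i<n. \<Sum>j<n. complex_of_real (s l * s l') * (cnj (F i l') * F i l) * (cnj (F j l) * F j l'))"
    by (subst (2) sum.swap, subst sum.swap, subst (3) sum.swap, subst (2) sum.swap) (rule refl)
  also have "\<dots> = (\<Sum>l<n. \<Sum>l'<n. complex_of_real (s l * s l') * (\<Sum>i<n. cnj (F i l') * F i l) * (\<Sum>j<n. cnj (F j l) * F j l'))"
    by (simp only: sum_distrib_left[symmetric] sum_distrib_right[symmetric])
  also have "\<dots> = (\<Sum>l<n. \<Sum>l'<n. complex_of_real (s l * s l') * kdelta l' l * kdelta l l')"
    using F by (simp add: unitary_def)
  also have "\<dots> = (\<Sum>l<n. complex_of_real (s l * s l) * kdelta l l)"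
    by simp
  also have "\<dots> = complex_of_real (\<Sum>l<n. (s l)\<^sup>2)"
    by (simp add: kdelta_def power2_eq_square)
  finally show ?thesis by (simp only: of_real_eq_iff)
qed

text \<open>In eigenbases of both test matrices the form becomes a weighted sum of squared moduli of
  the entries of G^T z F. The transpose of \<open>G\<close> stems from the pairing with
  \<open>w\<close>, which is bilinear and not sesquilinear.\<close>

lemma gform_spectral:
  assumes v: "\<And>i j. i < n \<Longrightarrow> j < n \<Longrightarrow> v i j = (\<Sum>l<n. complex_of_real (s l) * F i l * cnj (F j l))"
    and w: "\<And>i j. i < n \<Longrightarrow> j < n \<Longrightarrow> w i j = (\<Sum>l<n. complex_of_real (t l) * G i l * cnj (G j l))"
  shows "gform n K z w v = complex_of_real
    (\<Sum>k<K. \<Sum>p<n. \<Sum>l<n. t p * s l * (cmod (sandwich n (\<lambda>p i. G i p) z F p l k))\<^sup>2)"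
proof -
  have "(\<Sum>i<n. \<Sum>i'<n. \<Sum>j<n. \<Sum>j'<n. w i i' * (z i j k * cnj (z i' j' k)) * v j j') =
     complex_of_real (\<Sum>p<n. \<Sum>l<n. t p * s l * (cmod (sandwich n (\<lambda>p i. G i p) z F p l k))\<^sup>2)" for k
  proof -
    have "(\<Sum>i<n. \<Sum>i'<n. \<Sum>j<n. \<Sum>j'<n. w i i' * (z i j k * cnj (z i' j' k)) * v j j') =
      (\<Sum>i<n. \<Sum>i'<n. \<Sum>j<n. \<Sum>j'<n. \<Sum>p<n. \<Sum>l<n. complex_of_real (t p * s l) *
         ((G i p * F j l * z i j k) * cnj (G i' p * F j' l * z i' j' k)))"
      by (intro sum.cong refl) (simp add: v w sum_product sum_distrib_left sum_distrib_right mult_ac)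
    also have "\<dots> = (\<Sum>p<n. \<Sum>i<n. \<Sum>i'<n. \<Sum>j<n. \<Sum>j'<n. \<Sum>l<n. complex_of_real (t p * s l) *
         ((G i p * F j l * z i j k) * cnj (G i' p * F j' l * z i' j' k)))"
      by (rule sum_move_in4)
    also have "\<dots> = (\<Sum>p<n. \<Sum>l<n. \<Sum>i<n. \<Sum>i'<n. \<Sum>j<n. \<Sum>j'<n. complex_of_real (t p * s l) *
         ((G i p * F j l * z i j k) * cnj (G i' p * F j' l * z i' j' k)))"
      by (rule sum.cong[OF refl], rule sum_move_in4)
    also have "\<dots> = (\<Sum>p<n. \<Sum>l<n. complex_of_real (t p * s l) *
         (sandwich n (\<lambda>p i. G i p) z F p l k * cnj (sandwich n (\<lambda>p i. G i p) z F p l k)))"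
    proof (intro sum.cong refl)
      fix p l
      let ?a = "\<lambda>i j. G i p * F j l * z i j k"
      have "(\<Sum>i<n. \<Sum>i'<n. \<Sum>j<n. \<Sum>j'<n. complex_of_real (t p * s l) * (?a i j * cnj (?a i' j'))) =
         complex_of_real (t p * s l) * ((\<Sum>i<n. \<Sum>j<n. ?a i j) * cnj (\<Sum>i<n. \<Sum>j<n. ?a i j))"
        unfolding cnj_sum sum_product by (simp only: sum_distrib_left)
      then show "(\<Sum>i<n. \<Sum>i'<n. \<Sum>j<n. \<Sum>j'<n. complex_of_real (t p * s l) * (?a i j * cnj (?a i' j'))) =
         complex_of_real (t p * s l) * (sandwich n (\<lambda>p i. G i p) z F p l k * cnj (sandwich n (\<lambda>p i. G i p) z F p l k))"
        by (simp only: sandwich_def)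
    qed
    also have "\<dots> = complex_of_real (\<Sum>p<n. \<Sum>l<n. t p * s l * (cmod (sandwich n (\<lambda>p i. G i p) z F p l k))\<^sup>2)"
      by (simp add: complex_norm_square[symmetric])
    finally show ?thesis .
  qed
  then show ?thesis by (simp add: gform_def)
qed

text \<open>Unitary rotation preserves the J-bound and \<open>gauged\<close>, so the diagonal case
  applies to the rotated cube.\<close>

lemma gform_hermitian_bound:
  assumes J: "J_bd n M u c" and y: "gauged n M u y" and v: "hermitian n v" and w: "hermitian n w"
  shows "cmod (gform n K y w v) \<le> gauge_const * c\<^sup>2 * (fro n v + fro n w)"
proof -
  obtain F s where F: "unitary n F"
    and Fv: "\<And>i j. i < n \<Longrightarrow> j < n \<Longrightarrow> v i j = (\<Sum>l<n. complex_of_real (s l) * F i l * cnj (F j l))"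
    using spectral_decomposition[OF v] by blast
  obtain G t where G: "unitary n G"
    and Gw: "\<And>i j. i < n \<Longrightarrow> j < n \<Longrightarrow> w i j = (\<Sum>l<n. complex_of_real (t l) * G i l * cnj (G j l))"
    using spectral_decomposition[OF w] by blast
  let ?y = "sandwich n (\<lambda>p i. G i p) y F"
  have J': "J_bd n M (\<lambda>m. sandwich n (\<lambda>p i. G i p) (u m) F) (1 * c * 1)"
    by (intro J_bd_sandwich[OF J] unitary_opbd F opbd_transpose[OF unitary_opbd[OF G]])
  have "cmod (gform n K y w v) = \<bar>\<Sum>k<K. \<Sum>p<n. \<Sum>l<n. t p * s l * (cmod (?y p l k))\<^sup>2\<bar>"
    by (simp only: gform_spectral[OF Fv Gw] norm_of_real)
  \<comment> \<open>The summands are squared moduli, so the signs of the eigenvalues can be removed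
    termwise.\<close>
  also have "\<dots> \<le> (\<Sum>k<K. \<Sum>p<n. \<Sum>l<n. \<bar>t p\<bar> * \<bar>s l\<bar> * (cmod (?y p l k))\<^sup>2)"
    by (intro order_trans[OF sum_abs] sum_mono) (simp add: abs_mult)
  also have "\<dots> \<le> gauge_const * (1 * c * 1)\<^sup>2 * ((\<Sum>j<n. \<bar>s j\<bar>\<^sup>2) + (\<Sum>i<n. \<bar>t i\<bar>\<^sup>2))"
    by (rule J_bd_weighted[OF J' gauged_sandwich[OF y]]) simp_all
  also have "\<dots> = gauge_const * c\<^sup>2 * (fro n v + fro n w)"
    by (simp add: fro_spectral[OF F Fv] fro_spectral[OF G Gw])
  finally show ?thesis .
qed

lemma hermitian_parts:
  "\<exists>a b. hermitian n a \<and> hermitian n b \<and> fro n a + fro n b = fro n v \<and> (\<forall>i j. v i j = a i j + \<i> * b i j)"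
proof -
  define a where "a = (\<lambda>i j. (v i j + cnj (v j i)) / 2)"
  define b where "b = (\<lambda>i j. (v i j - cnj (v j i)) / (2 * \<i>))"
  have eq: "v i j = a i j + \<i> * b i j" for i j
    by (simp add: a_def b_def field_simps)
  have "(cmod (a i j))\<^sup>2 + (cmod (b i j))\<^sup>2 = ((cmod (v i j))\<^sup>2 + (cmod (v j i))\<^sup>2) / 2" for i j
    by (simp add: a_def b_def norm_divide norm_mult cmod_power2 power_divide) (simp add: power2_eq_square field_simps)
  then have "fro n a + fro n b = (\<Sum>i<n. \<Sum>j<n. ((cmod (v i j))\<^sup>2 + (cmod (v j i))\<^sup>2) / 2)"
    by (simp only: fro_def sum.distrib[symmetric])
  also have "\<dots> = ((\<Sum>i<n. \<Sum>j<n. (cmod (v i j))\<^sup>2) + (\<Sum>i<n. \<Sum>j<n. (cmod (v j i))\<^sup>2)) / 2"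
    by (simp add: sum.distrib sum_divide_distrib add_divide_distrib)
  also have "\<dots> = fro n v"
    by (subst (2) sum.swap) (simp add: fro_def)
  finally have "fro n a + fro n b = fro n v" .
  moreover have "hermitian n a" "hermitian n b"
    by (simp_all add: hermitian_def a_def b_def field_simps)
  ultimately show ?thesis using eq by blast
qed

lemma gform_add_right: "gform n K z w (\<lambda>i j. v i j + c * v' i j) = gform n K z w v + c * gform n K z w v'"
  by (simp add: gform_def distrib_left sum.distrib sum_distrib_left mult_ac)

lemma gform_add_left: "gform n K z (\<lambda>i j. w i j + c * w' i j) v = gform n K z w v + c * gform n K z w' v"
  by (simp add: gform_def distrib_left distrib_right sum.distrib sum_distrib_left mult_ac)

lemma gform_scale: "gform n K z (\<lambda>i j. a * w i j) (\<lambda>i j. b * v i j) = a * b * gform n K z w v"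
  by (simp add: gform_def sum_distrib_left mult_ac)

lemma fro_scale: "fro n (\<lambda>i j. a * v i j) = (cmod a)\<^sup>2 * fro n v"
  by (simp add: fro_def norm_mult power_mult_distrib sum_distrib_left)

text \<open>Both test matrices are split into Hermitian parts, and each part occurs in two of the
  four resulting forms, whence the factor 2. Normalizing \<open>w\<close> and \<open>v\<close> to
  Hilbert-Schmidt norm 1 then turns the sum of squared norms into the product of norms, at the price
  of another factor 2.\<close>

lemma gform_bound:
  assumes J: "J_bd n M u c" and y: "gauged n M u y"
  shows "cmod (gform n K y w v) \<le> 4 * gauge_const * c\<^sup>2 * sqrt (fro n w) * sqrt (fro n v)"
proof -
  have general: "cmod (gform n K y w v) \<le> 2 * gauge_const * c\<^sup>2 * (fro n v + fro n w)" for w v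
  proof -
    obtain a b where v: "hermitian n a" "hermitian n b" "fro n a + fro n b = fro n v" "\<forall>i j. v i j = a i j + \<i> * b i j"
      using hermitian_parts[of n v] by blast
    have v4: "v = (\<lambda>i j. a i j + \<i> * b i j)" using v(4) by (intro ext) simp
    obtain a' b' where w: "hermitian n a'" "hermitian n b'" "fro n a' + fro n b' = fro n w" "\<forall>i j. w i j = a' i j + \<i> * b' i j"
      using hermitian_parts[of n w] by blast
    have w4: "w = (\<lambda>i j. a' i j + \<i> * b' i j)" using w(4) by (intro ext) simp
    have "cmod (gform n K y w v) \<le> (cmod (gform n K y a' a) + cmod (gform n K y a' b)) + (cmod (gform n K y b' a) + cmod (gform n K y b' b))"
      unfolding v4 w4 gform_add_left gform_add_right
      by (intro order_trans[OF norm_triangle_ineq] add_mono order_refl)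
        (simp_all add: norm_mult order_trans[OF norm_triangle_ineq])
    also have "\<dots> \<le> (gauge_const * c\<^sup>2 * (fro n a + fro n a') + gauge_const * c\<^sup>2 * (fro n b + fro n a'))
       + (gauge_const * c\<^sup>2 * (fro n a + fro n b') + gauge_const * c\<^sup>2 * (fro n b + fro n b'))"
      by (intro add_mono gform_hermitian_bound[OF J y] v w)
    also have "\<dots> = 2 * gauge_const * c\<^sup>2 * (fro n v + fro n w)"
      unfolding v(3)[symmetric] w(3)[symmetric] by (simp add: algebra_simps)
    finally show ?thesis .
  qed
  have zero: "gform n K y w v = 0" if "fro n w = 0 \<or> fro n v = 0"
  proof -
    have "(\<forall>i<n. \<forall>j<n. w i j = 0) \<or> (\<forall>i<n. \<forall>j<n. v i j = 0)"
      using that by (auto simp: fro_def sum_nonneg sum_nonneg_eq_0_iff)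
    then show ?thesis by (auto simp: gform_def intro!: sum.neutral)
  qed
  show ?thesis
  proof (cases "fro n w = 0 \<or> fro n v = 0")
    case True
    then show ?thesis using zero by (auto simp: gauge_const_nonneg)
  next
    case False
    let ?a = "sqrt (fro n w)" and ?b = "sqrt (fro n v)"
    have pos: "0 < ?a" "0 < ?b" using False by (simp_all add: order_less_le)
    have "cmod (gform n K y w v) / (?a * ?b) = cmod (gform n K y (\<lambda>i j. complex_of_real (1 / ?a) * w i j) (\<lambda>i j. complex_of_real (1 / ?b) * v i j))"
      unfolding gform_scale using pos by (simp add: norm_mult norm_divide)
    also have "\<dots> \<le> 2 * gauge_const * c\<^sup>2 * (1 + 1)"
      using general[of "\<lambda>i j. complex_of_real (1 / ?a) * w i j" "\<lambda>i j. complex_of_real (1 / ?b) * v i j"] False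
      unfolding fro_scale by (simp add: norm_divide power_divide)
    finally show ?thesis using pos by (simp add: field_simps)
  qed
qed

section \<open>Factorization of the unit ball of the operator Hilbert space\<close>

definition gram :: "cube \<Rightarrow> nat \<Rightarrow> nat \<Rightarrow> nat \<Rightarrow> nat \<Rightarrow> complex" where
  "gram z i i' j j' = (\<Sum>k. z i j k * cnj (z i' j' k))"

definition square_summable :: "nat \<Rightarrow> cube \<Rightarrow> bool" where
  "square_summable n z \<longleftrightarrow> (\<forall>i<n. \<forall>j<n. summable (\<lambda>k. (cmod (z i j k))\<^sup>2))"

definition gram_form :: "nat \<Rightarrow> cube \<Rightarrow> (nat \<Rightarrow> nat \<Rightarrow> complex) \<Rightarrow> (nat \<Rightarrow> nat \<Rightarrow> complex) \<Rightarrow> complex" where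
  "gram_form n z w v = (\<Sum>i<n. \<Sum>i'<n. \<Sum>j<n. \<Sum>j'<n. w i i' * gram z i i' j j' * v j j')"

text \<open>The unit ball of OH in the form used for the factorization: the Gram form is contractive
  in the Hilbert-Schmidt norms of its arguments.\<close>

definition gram_contractive :: "nat \<Rightarrow> cube \<Rightarrow> bool" where
  "gram_contractive n z \<longleftrightarrow> square_summable n z \<and> (\<forall>w v. (cmod (gram_form n z w v))\<^sup>2 \<le> fro n w * fro n v)"

definition cp_map :: "nat \<Rightarrow> cube \<Rightarrow> (nat \<Rightarrow> nat \<Rightarrow> complex) \<Rightarrow> nat \<Rightarrow> nat \<Rightarrow> complex" where
  "cp_map n z a i i' = (\<Sum>j<n. \<Sum>j'<n. gram z i i' j j' * a j j')"

text \<open>The adjoints z_k^*. The map a -> sum_k z_k^* a z_k formed with them is the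
  Hilbert-Schmidt adjoint of \<open>cp_map n z\<close>.\<close>

definition star :: "cube \<Rightarrow> cube" where
  "star z i j k = cnj (z j i k)"

text \<open>The real part makes the form real-valued on all functions, so that it can be compared
  with \<open>nsq\<close>; on Hermitian \<open>a\<close> it is the usual quadratic form.\<close>

definition qf :: "nat \<Rightarrow> (nat \<Rightarrow> nat \<Rightarrow> complex) \<Rightarrow> (nat \<Rightarrow> complex) \<Rightarrow> real" where
  "qf n a \<xi> = Re (\<Sum>j<n. \<Sum>j'<n. cnj (\<xi> j) * a j j' * \<xi> j')"

lemma star_star [simp]: "star (star z) = z"
  by (simp add: star_def fun_eq_iff)

lemma summable_mult_cnj:
  fixes f g :: "nat \<Rightarrow> complex"
  assumes "summable (\<lambda>k. (cmod (f k))\<^sup>2)" "summable (\<lambda>k. (cmod (g k))\<^sup>2)"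
  shows "summable (\<lambda>k. f k * cnj (g k))"
proof (rule summable_comparison_test)
  show "summable (\<lambda>k. (cmod (f k))\<^sup>2 + (cmod (g k))\<^sup>2)" by (intro summable_add assms)
  have "norm (f k * cnj (g k)) \<le> (cmod (f k))\<^sup>2 + (cmod (g k))\<^sup>2" for k
    using sum_squares_bound[of "cmod (f k)" "cmod (g k)"] mult_nonneg_nonneg[OF norm_ge_zero norm_ge_zero, of "f k" "g k"]
    unfolding norm_mult complex_mod_cnj mult.assoc by linarith
  then show "\<exists>N. \<forall>k\<ge>N. norm (f k * cnj (g k)) \<le> (cmod (f k))\<^sup>2 + (cmod (g k))\<^sup>2" by blast
qed

lemma gram_sums:
  assumes "square_summable n z" "i < n" "i' < n" "j < n" "j' < n"
  shows "(\<lambda>k. z i j k * cnj (z i' j' k)) sums gram z i i' j j'"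
  unfolding gram_def using assms
  by (intro summable_sums summable_mult_cnj) (simp_all add: square_summable_def)

lemma square_summable_star: "square_summable n z \<Longrightarrow> square_summable n (star z)"
  by (simp add: square_summable_def star_def)

lemma gram_star:
  assumes "square_summable n z" "i < n" "i' < n" "j < n" "j' < n"
  shows "gram (star z) j j' i i' = cnj (gram z i i' j j')"
proof -
  have "(\<lambda>k. cnj (z i j k * cnj (z i' j' k))) sums cnj (gram z i i' j j')"
    using gram_sums[OF assms] by (simp only: sums_cnj)
  then show ?thesis
    using gram_sums[OF square_summable_star[OF assms(1)] assms(4,5,2,3)]
    by (simp add: star_def sums_unique2)
qed

lemma gram_swap:
  assumes "square_summable n z" "i < n" "i' < n" "j < n" "j' < n"
  shows "gram z i' i j' j = cnj (gram z i i' j j')"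
proof -
  have "(\<lambda>k. cnj (z i j k * cnj (z i' j' k))) sums cnj (gram z i i' j j')"
    using gram_sums[OF assms] by (simp only: sums_cnj)
  then show ?thesis
    using gram_sums[OF assms(1,3,2,5,4)] by (simp add: mult.commute sums_unique2)
qed

text \<open>This carries bounds that are uniform in the truncation \<open>K\<close> over to the Gram
  form.\<close>

lemma gform_tendsto:
  assumes "square_summable n z"
  shows "(\<lambda>K. gform n K z w v) \<longlonglongrightarrow> gram_form n z w v"
proof -
  have "(\<lambda>k. \<Sum>i<n. \<Sum>i'<n. \<Sum>j<n. \<Sum>j'<n. w i i' * (z i j k * cnj (z i' j' k)) * v j j') sums gram_form n z w v"
    unfolding gram_form_def
    by (intro sums_sum sums_mult sums_mult2 gram_sums[OF assms]) simp_all
  then show ?thesis unfolding gform_def sums_def .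
qed

text \<open>Passing to adjoints exchanges the two test matrices and conjugates everything, and
  neither affects the bound.\<close>

lemma gram_contractive_star:
  assumes "gram_contractive n z"
  shows "gram_contractive n (star z)"
proof -
  have z: "square_summable n z" using assms by (simp add: gram_contractive_def)
  have "(cmod (gram_form n (star z) w v))\<^sup>2 \<le> fro n w * fro n v" for w v
  proof -
    have "gram_form n (star z) w v = (\<Sum>j<n. \<Sum>j'<n. \<Sum>i<n. \<Sum>i'<n. w j j' * cnj (gram z i i' j j') * v i i')"
      unfolding gram_form_def by (intro sum.cong refl) (simp add: gram_star[OF z])
    also have "\<dots> = (\<Sum>i<n. \<Sum>j<n. \<Sum>j'<n. \<Sum>i'<n. w j j' * cnj (gram z i i' j j') * v i i')"
      by (subst (2) sum.swap, subst sum.swap) (rule refl)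
    also have "\<dots> = (\<Sum>i<n. \<Sum>i'<n. \<Sum>j<n. \<Sum>j'<n. w j j' * cnj (gram z i i' j j') * v i i')"
      by (rule sum.cong[OF refl], subst (2) sum.swap, subst sum.swap) (rule refl)
    also have "\<dots> = cnj (gram_form n z (\<lambda>i j. cnj (v i j)) (\<lambda>i j. cnj (w i j)))"
      unfolding gram_form_def cnj_sum by (intro sum.cong refl) simp
    finally have "cmod (gram_form n (star z) w v) = cmod (gram_form n z (\<lambda>i j. cnj (v i j)) (\<lambda>i j. cnj (w i j)))"
      by simp
    then show ?thesis
      using assms[unfolded gram_contractive_def, THEN conjunct2, rule_format, of "\<lambda>i j. cnj (v i j)" "\<lambda>i j. cnj (w i j)"]
      by (simp add: fro_def mult.commute)
  qed
  then show ?thesis using square_summable_star[OF z] by (simp add: gram_contractive_def)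
qed

text \<open>The squared norm of the image is the Gram form tested on the conjugate of the image and
  on \<open>a\<close>; contractivity bounds it by the product of both norms, and the norm of the
  image cancels.\<close>

lemma fro_cp_map:
  assumes "gram_contractive n z"
  shows "fro n (cp_map n z a) \<le> fro n a"
proof -
  let ?b = "cp_map n z a"
  have "gram_form n z (\<lambda>i j. cnj (?b i j)) a = (\<Sum>i<n. \<Sum>i'<n. cnj (?b i i') * ?b i i')"
    unfolding gram_form_def cp_map_def[of n z a] by (simp only: sum_distrib_left mult.assoc)
  also have "\<dots> = complex_of_real (fro n ?b)"
    by (simp add: fro_def complex_norm_square[symmetric] mult.commute)
  finally have "(fro n ?b)\<^sup>2 = (cmod (gram_form n z (\<lambda>i j. cnj (?b i j)) a))\<^sup>2"
    by simp
  also have "\<dots> \<le> fro n (\<lambda>i j. cnj (?b i j)) * fro n a"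
    using assms by (simp add: gram_contractive_def)
  finally have "fro n ?b * fro n ?b \<le> fro n ?b * fro n a"
    by (simp add: fro_def power2_eq_square)
  then show ?thesis
    by (cases "fro n ?b = 0") (auto simp: order_less_le)
qed

lemma hermitianD: "hermitian n a \<Longrightarrow> i < n \<Longrightarrow> j < n \<Longrightarrow> a i j = cnj (a j i)"
  unfolding hermitian_def by blast

lemma cp_map_hermitian:
  assumes z: "square_summable n z" and a: "hermitian n a"
  shows "hermitian n (cp_map n z a)"
  unfolding hermitian_def
proof (intro allI impI)
  fix i i' assume i: "i < n" "i' < n"
  have "cnj (cp_map n z a i' i) = (\<Sum>j<n. \<Sum>j'<n. gram z i i' j' j * a j' j)"
    unfolding cp_map_def cnj_sum
  proof (intro sum.cong refl)
    fix j j' assume j: "j \<in> {..<n}" "j' \<in> {..<n}"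
    then have "gram z i' i j j' = cnj (gram z i i' j' j)" "a j j' = cnj (a j' j)"
      using gram_swap[OF z i, of j' j] hermitianD[OF a, of j j'] by simp_all
    then show "cnj (gram z i' i j j' * a j j') = gram z i i' j' j * a j' j"
      by (simp only: complex_cnj_mult complex_cnj_cnj)
  qed
  then show "cp_map n z a i i' = cnj (cp_map n z a i' i)"
    by (simp add: cp_map_def) (rule sum.swap)
qed

text \<open>The vectors on the left are z_k^* \<eta>. The identity expands the form of sum_k z_k a
  z_k^* at \<eta> over \<open>k\<close>; for positive \<open>a\<close> all terms are nonnegative, so
  it yields positivity of the image as well as bounds for partial sums.\<close>

lemma qf_cp_map_sums:
  assumes z: "square_summable n z"
  shows "(\<lambda>k. qf n a (\<lambda>j. cnj (\<Sum>i<n. cnj (\<eta> i) * z i j k))) sums qf n (cp_map n z a) \<eta>"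
proof -
  have "(\<lambda>k. \<Sum>i<n. \<Sum>i'<n. \<Sum>j<n. \<Sum>j'<n. cnj (\<eta> i) * (z i j k * cnj (z i' j' k) * a j j') * \<eta> i')
      sums (\<Sum>i<n. \<Sum>i'<n. \<Sum>j<n. \<Sum>j'<n. cnj (\<eta> i) * (gram z i i' j j' * a j j') * \<eta> i')"
    by (intro sums_sum sums_mult sums_mult2 gram_sums[OF z]) simp_all
  also have "(\<Sum>i<n. \<Sum>i'<n. \<Sum>j<n. \<Sum>j'<n. cnj (\<eta> i) * (gram z i i' j j' * a j j') * \<eta> i') =
      (\<Sum>i<n. \<Sum>i'<n. cnj (\<eta> i) * cp_map n z a i i' * \<eta> i')"
    by (simp only: cp_map_def sum_distrib_left sum_distrib_right)
  also have "(\<lambda>k. \<Sum>i<n. \<Sum>i'<n. \<Sum>j<n. \<Sum>j'<n. cnj (\<eta> i) * (z i j k * cnj (z i' j' k) * a j j') * \<eta> i') =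
      (\<lambda>k. \<Sum>j<n. \<Sum>j'<n. cnj (cnj (\<Sum>i<n. cnj (\<eta> i) * z i j k)) * a j j' * cnj (\<Sum>i<n. cnj (\<eta> i) * z i j' k))"
  proof
    fix k
    have "(\<Sum>j<n. \<Sum>j'<n. cnj (cnj (\<Sum>i<n. cnj (\<eta> i) * z i j k)) * a j j' * cnj (\<Sum>i<n. cnj (\<eta> i) * z i j' k)) =
       (\<Sum>j<n. \<Sum>j'<n. \<Sum>i<n. \<Sum>i'<n. cnj (\<eta> i) * (z i j k * cnj (z i' j' k) * a j j') * \<eta> i')"
    proof (intro sum.cong refl)
      fix j j'
      have "cnj (cnj (\<Sum>i<n. cnj (\<eta> i) * z i j k)) * a j j' * cnj (\<Sum>i<n. cnj (\<eta> i) * z i j' k) =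
         a j j' * ((\<Sum>i<n. cnj (\<eta> i) * z i j k) * (\<Sum>i'<n. \<eta> i' * cnj (z i' j' k)))"
        by (simp add: cnj_sum mult_ac)
      also have "\<dots> = (\<Sum>i<n. \<Sum>i'<n. a j j' * ((cnj (\<eta> i) * z i j k) * (\<eta> i' * cnj (z i' j' k))))"
        unfolding sum_product by (simp only: sum_distrib_left)
      also have "\<dots> = (\<Sum>i<n. \<Sum>i'<n. cnj (\<eta> i) * (z i j k * cnj (z i' j' k) * a j j') * \<eta> i')"
        by (intro sum.cong refl) (simp only: mult_ac)
      finally show "cnj (cnj (\<Sum>i<n. cnj (\<eta> i) * z i j k)) * a j j' * cnj (\<Sum>i<n. cnj (\<eta> i) * z i j' k) =
        (\<Sum>i<n. \<Sum>i'<n. cnj (\<eta> i) * (z i j k * cnj (z i' j' k) * a j j') * \<eta> i')" .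
    qed
    also have "\<dots> = (\<Sum>i<n. \<Sum>j<n. \<Sum>j'<n. \<Sum>i'<n. cnj (\<eta> i) * (z i j k * cnj (z i' j' k) * a j j') * \<eta> i')"
      by (subst (2) sum.swap, subst sum.swap) (rule refl)
    also have "\<dots> = (\<Sum>i<n. \<Sum>i'<n. \<Sum>j<n. \<Sum>j'<n. cnj (\<eta> i) * (z i j k * cnj (z i' j' k) * a j j') * \<eta> i')"
      by (rule sum.cong[OF refl], subst (2) sum.swap, subst sum.swap) (rule refl)
    finally show "(\<Sum>i<n. \<Sum>i'<n. \<Sum>j<n. \<Sum>j'<n. cnj (\<eta> i) * (z i j k * cnj (z i' j' k) * a j j') * \<eta> i') =
      (\<Sum>j<n. \<Sum>j'<n. cnj (cnj (\<Sum>i<n. cnj (\<eta> i) * z i j k)) * a j j' * cnj (\<Sum>i<n. cnj (\<eta> i) * z i j' k))" ..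
  qed
  finally show ?thesis unfolding qf_def by (rule sums_Re)
qed

definition psd :: "nat \<Rightarrow> (nat \<Rightarrow> nat \<Rightarrow> complex) \<Rightarrow> bool" where
  "psd n a \<longleftrightarrow> hermitian n a \<and> (\<forall>\<xi>. 0 \<le> qf n a \<xi>)"

lemma psd_cp_map:
  assumes "square_summable n z" "psd n a"
  shows "psd n (cp_map n z a)"
  unfolding psd_def
proof (intro conjI allI)
  show "hermitian n (cp_map n z a)" using assms by (simp add: psd_def cp_map_hermitian)
  show "0 \<le> qf n (cp_map n z a) \<eta>" for \<eta>
    by (rule sums_le[OF _ sums_zero qf_cp_map_sums[OF assms(1)]]) (use assms(2) in \<open>simp add: psd_def\<close>)
qed

lemma qf_cp_map_partial:
  assumes "square_summable n z" "psd n a"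
  shows "(\<Sum>k<K. qf n a (\<lambda>j. cnj (\<Sum>i<n. cnj (\<eta> i) * z i j k))) \<le> qf n (cp_map n z a) \<eta>"
  using qf_cp_map_sums[OF assms(1)] assms(2)
  by (metis (no_types, lifting) psd_def sum_le_suminf sums_summable sums_unique finite_lessThan)

lemma qf_kdelta: "qf n kdelta \<xi> = nsq n \<xi>"
proof -
  have "(\<Sum>j<n. \<Sum>j'<n. cnj (\<xi> j) * kdelta j j' * \<xi> j') = (\<Sum>j<n. \<xi> j * cnj (\<xi> j))"
  proof (intro sum.cong refl)
    fix j assume "j \<in> {..<n}"
    have "(\<Sum>j'<n. cnj (\<xi> j) * kdelta j j' * \<xi> j') = cnj (\<xi> j) * (\<Sum>j'<n. kdelta j j' * \<xi> j')"
      by (simp only: sum_distrib_left mult.assoc)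
    then show "(\<Sum>j'<n. cnj (\<xi> j) * kdelta j j' * \<xi> j') = \<xi> j * cnj (\<xi> j)"
      using \<open>j \<in> {..<n}\<close> by simp
  qed
  then show ?thesis by (simp add: qf_def of_real_nsq[symmetric])
qed

lemma qf_le_fro: "(qf n a \<xi>)\<^sup>2 \<le> fro n a * (nsq n \<xi>)\<^sup>2"
proof -
  let ?b = "\<lambda>i. \<Sum>j<n. a i j * \<xi> j"
  have "(\<Sum>j<n. \<Sum>j'<n. cnj (\<xi> j) * a j j' * \<xi> j') = (\<Sum>j<n. cnj (\<xi> j) * ?b j)"
    by (simp only: sum_distrib_left mult.assoc)
  then have "\<bar>qf n a \<xi>\<bar> \<le> cmod (\<Sum>j<n. cnj (\<xi> j) * ?b j)"
    unfolding qf_def by (simp only: abs_Re_le_cmod)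
  from power_mono[OF this abs_ge_zero, of 2]
  have "(qf n a \<xi>)\<^sup>2 \<le> (cmod (\<Sum>j<n. cnj (\<xi> j) * ?b j))\<^sup>2" by simp
  also have "\<dots> \<le> nsq n \<xi> * nsq n ?b"
    using cauchy_schwarz_complex[of "\<lambda>j. cnj (\<xi> j)" ?b n] by simp
  also have "\<dots> \<le> nsq n \<xi> * (\<Sum>i<n. nsq n (a i) * nsq n \<xi>)"
    unfolding nsq_def[of n ?b] by (intro mult_left_mono sum_mono cauchy_schwarz_complex) simp
  also have "(\<Sum>i<n. nsq n (a i) * nsq n \<xi>) = fro n a * nsq n \<xi>"
    by (simp add: fro_def nsq_def sum_distrib_right)
  finally show ?thesis by (simp add: power2_eq_square mult_ac)
qed

section \<open>Alternating iteration of the two positive maps\<close>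

text \<open>Two alternating words of length \<open>r\<close> applied to the identity: the outermost
  map of the first component is that of \<open>star z\<close>, the outermost map of the second is
  that of \<open>z\<close>. Replacing \<open>z\<close> by \<open>star z\<close> exchanges
  them.\<close>

fun iter_pair :: "nat \<Rightarrow> cube \<Rightarrow> nat \<Rightarrow> (nat \<Rightarrow> nat \<Rightarrow> complex) \<times> (nat \<Rightarrow> nat \<Rightarrow> complex)" where
  "iter_pair n z 0 = (kdelta, kdelta)"
| "iter_pair n z (Suc r) = (cp_map n (star z) (snd (iter_pair n z r)), cp_map n z (fst (iter_pair n z r)))"

lemma iter_pair_star: "snd (iter_pair n z r) = fst (iter_pair n (star z) r) \<and> fst (iter_pair n z r) = snd (iter_pair n (star z) r)"
  by (induction r) auto

lemma hermitian_kdelta: "hermitian n kdelta"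
  by (simp add: hermitian_def) (simp add: kdelta_def)

lemma fro_kdelta: "fro n kdelta = real n"
  using nsq_kdelta[of _ n] by (simp add: fro_def nsq_def)

lemma iter_pair_psd:
  assumes "gram_contractive n z"
  shows "psd n (fst (iter_pair n z r)) \<and> psd n (snd (iter_pair n z r)) \<and>
    fro n (fst (iter_pair n z r)) \<le> real n \<and> fro n (snd (iter_pair n z r)) \<le> real n"
proof (induction r)
  case 0
  then show ?case by (simp add: psd_def qf_kdelta hermitian_kdelta fro_kdelta)
next
  case (Suc r)
  have "square_summable n z" "square_summable n (star z)"
    using assms by (simp_all add: gram_contractive_def square_summable_star)
  then show ?case
    using Suc by (auto intro: psd_cp_map order_trans[OF fro_cp_map[OF assms]]
        order_trans[OF fro_cp_map[OF gram_contractive_star[OF assms]]])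
qed

definition geometric_sum :: "nat \<Rightarrow> (nat \<Rightarrow> nat \<Rightarrow> nat \<Rightarrow> complex) \<Rightarrow> nat \<Rightarrow> nat \<Rightarrow> complex" where
  "geometric_sum R a i j = (\<Sum>r<R. (1/2) ^ r * a r i j)"

lemma qf_geometric_sum: "qf n (geometric_sum R a) \<xi> = (\<Sum>r<R. (1/2) ^ r * qf n (a r) \<xi>)"
proof -
  have "(\<Sum>j<n. \<Sum>j'<n. cnj (\<xi> j) * geometric_sum R a j j' * \<xi> j') =
      (\<Sum>j<n. \<Sum>j'<n. \<Sum>r<R. complex_of_real ((1/2) ^ r) * (cnj (\<xi> j) * a r j j' * \<xi> j'))"
    unfolding geometric_sum_def sum_distrib_left sum_distrib_right by (intro sum.cong refl) simp
  also have "\<dots> = (\<Sum>r<R. \<Sum>j<n. \<Sum>j'<n. complex_of_real ((1/2) ^ r) * (cnj (\<xi> j) * a r j j' * \<xi> j'))"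
    by (simp only: sum.swap[where B="{..<R}"])
  also have "\<dots> = (\<Sum>r<R. complex_of_real ((1/2) ^ r) * (\<Sum>j<n. \<Sum>j'<n. cnj (\<xi> j) * a r j j' * \<xi> j'))"
    by (simp only: sum_distrib_left)
  moreover have "Re (complex_of_real x * w) = x * Re w" for x w by simp
  ultimately show ?thesis unfolding qf_def by (simp only: Re_sum)
qed

lemma cp_map_geometric_sum: "cp_map n z (geometric_sum R a) = geometric_sum R (\<lambda>r. cp_map n z (a r))"
proof (intro ext)
  fix i i'
  have "cp_map n z (geometric_sum R a) i i' = (\<Sum>j<n. \<Sum>j'<n. \<Sum>r<R. (1/2) ^ r * (gram z i i' j j' * a r j j'))"
    unfolding cp_map_def geometric_sum_def sum_distrib_left by (intro sum.cong refl) simp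
  also have "\<dots> = (\<Sum>r<R. \<Sum>j<n. \<Sum>j'<n. (1/2) ^ r * (gram z i i' j j' * a r j j'))"
    by (simp only: sum.swap[where B="{..<R}"])
  finally show "cp_map n z (geometric_sum R a) i i' = geometric_sum R (\<lambda>r. cp_map n z (a r)) i i'"
    by (simp add: geometric_sum_def cp_map_def sum_distrib_left)
qed

lemma hermitian_geometric_sum:
  assumes "\<And>r. hermitian n (a r)"
  shows "hermitian n (geometric_sum R a)"
  unfolding hermitian_def geometric_sum_def cnj_sum
proof (intro allI impI sum.cong refl)
  fix i j r assume "i < n" "j < n"
  then have "a r i j = cnj (a r j i)" using hermitianD[OF assms] by blast
  then show "(1 / 2) ^ r * a r i j = cnj ((1 / 2) ^ r * a r j i)"
    by (simp only: complex_cnj_mult complex_cnj_power complex_cnj_divide complex_cnj_one complex_cnj_numeral)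
qed

text \<open>\<open>A\<close> is the finite sum \<open>\<Sum>r\<le>R. (1/2) ^ r * a r\<close>, where \<open>a r\<close> applies the two maps alternately
  to the identity. The tail term is at most the identity for large \<open>R\<close>, by contractivity.\<close>

lemma subinvariant_pair:
  assumes z: "gram_contractive n z"
  shows "\<exists>A B. psd n A \<and> psd n B \<and> (\<forall>\<xi>. nsq n \<xi> \<le> qf n A \<xi>) \<and> (\<forall>\<xi>. nsq n \<xi> \<le> qf n B \<xi>) \<and>
    (\<forall>\<xi>. qf n (cp_map n z A) \<xi> \<le> 2 * qf n B \<xi>) \<and> (\<forall>\<xi>. qf n (cp_map n (star z) B) \<xi> \<le> 2 * qf n A \<xi>)"
proof -
  \<comment> \<open>\<open>real n\<close> is the squared Hilbert-Schmidt norm of the identity and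
    hence bounds that of every iterate.\<close>
  obtain R where R: "real n < 2 ^ R" using real_arch_pow[of 2 "real n"] by auto
  define a where "a = (\<lambda>z r. fst (iter_pair n z r))"
  define A where "A = (\<lambda>z. geometric_sum (Suc R) (a z))"
  have b: "snd (iter_pair n z r) = a (star z) r" for z r
    using iter_pair_star[of n z r] by (simp add: a_def)
  have psd_a: "psd n (a z r)" if "gram_contractive n z" for z r
    using iter_pair_psd[OF that] by (simp add: a_def)
  have qa: "nsq n \<xi> \<le> qf n (A z) \<xi>" if "gram_contractive n z" for z \<xi>
  proof -
    have "nsq n \<xi> = (\<Sum>r<1. (1/2) ^ r * qf n (a z r) \<xi>)" by (simp add: a_def qf_kdelta)
    also have "\<dots> \<le> qf n (A z) \<xi>"
      unfolding A_def qf_geometric_sum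
      by (rule sum_mono2) (use psd_a[OF that] in \<open>auto simp: psd_def\<close>)
    finally show ?thesis .
  qed
  have psd_A: "psd n (A z)" if "gram_contractive n z" for z
    using psd_a[OF that] qa[OF that] hermitian_geometric_sum[of n "a z" "Suc R"]
    unfolding psd_def A_def by (meson nsq_nonneg order_trans)
  have step: "qf n (cp_map n z (A z)) \<xi> \<le> 2 * qf n (A (star z)) \<xi>" if z: "gram_contractive n z" for z \<xi>
  proof -
    have next_a: "cp_map n z (a z r) = a (star z) (Suc r)" for r
      using b[of z r] by (simp add: a_def iter_pair_star[of n z, simplified])
    let ?f = "\<lambda>r. (1/2) ^ r * qf n (a (star z) r) \<xi>"
    \<comment> \<open>The map sends each iterate to the next one in the sequence of
      \<open>star z\<close>, whose weight is smaller by 1/2; this produces the factor 2. Compared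
      with the sum for \<open>A (star z)\<close> the term \<open>?f 0\<close> is lost and
      \<open>?f (Suc R)\<close> is gained.\<close>
    have "qf n (cp_map n z (A z)) \<xi> = (\<Sum>r<Suc R. 2 * ?f (Suc r))"
      unfolding A_def cp_map_geometric_sum qf_geometric_sum next_a by (intro sum.cong refl) simp
    also have "\<dots> = 2 * (\<Sum>r<Suc R. ?f (Suc r))" by (simp only: sum_distrib_left)
    also have "(\<Sum>r<Suc R. ?f (Suc r)) = (\<Sum>r<Suc R. ?f r) + ?f (Suc R) - ?f 0"
      using sum.lessThan_Suc_shift[of ?f "Suc R"] by simp
    \<comment> \<open>The lost term is the form of the identity. The gained one carries the weight
      2^(-R-1), which compensates its Hilbert-Schmidt norm, so the exchange does not increase the
      sum.\<close>
    moreover have "?f (Suc R) \<le> ?f 0"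
    proof -
      have "(qf n (a (star z) (Suc R)) \<xi>)\<^sup>2 \<le> fro n (a (star z) (Suc R)) * (nsq n \<xi>)\<^sup>2"
        by (rule qf_le_fro)
      also have "\<dots> \<le> (2 ^ R) * (nsq n \<xi>)\<^sup>2"
      proof (rule mult_right_mono)
        have "fro n (a (star z) (Suc R)) \<le> real n"
          using iter_pair_psd[OF gram_contractive_star[OF z]] unfolding a_def by blast
        then show "fro n (a (star z) (Suc R)) \<le> 2 ^ R" using R by linarith
      qed simp
      also have "\<dots> \<le> (2 ^ Suc R * nsq n \<xi>)\<^sup>2"
        unfolding power_mult_distrib
        by (intro mult_right_mono) (simp_all add: power2_eq_square order_trans[OF _ mult_left_mono[of 1]])
      finally have "qf n (a (star z) (Suc R)) \<xi> \<le> 2 ^ Suc R * nsq n \<xi>"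
        by (rule power2_le_imp_le) simp
      then show ?thesis by (simp add: a_def qf_kdelta field_simps)
    qed
    moreover have "qf n (A (star z)) \<xi> = (\<Sum>r<Suc R. ?f r)" unfolding A_def by (rule qf_geometric_sum)
    ultimately show ?thesis by linarith
  qed
  show ?thesis
    using psd_A qa step[OF z] step[OF gram_contractive_star[OF z]] z gram_contractive_star[OF z]
    by (intro exI[of _ "A z"] exI[of _ "A (star z)"]) auto
qed

section \<open>Eigenbases and dyadic bins\<close>

lemma qf_spectral:
  assumes "\<And>i j. i < n \<Longrightarrow> j < n \<Longrightarrow> v i j = (\<Sum>l<n. complex_of_real (s l) * F i l * cnj (F j l))"
  shows "qf n v \<xi> = (\<Sum>l<n. s l * (cmod (\<Sum>j<n. cnj (F j l) * \<xi> j))\<^sup>2)"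
proof -
  have "(\<Sum>i<n. \<Sum>j<n. cnj (\<xi> i) * v i j * \<xi> j) =
      (\<Sum>i<n. \<Sum>j<n. \<Sum>l<n. complex_of_real (s l) * ((cnj (F j l) * \<xi> j) * cnj (cnj (F i l) * \<xi> i)))"
    by (intro sum.cong refl) (simp add: assms sum_distrib_left sum_distrib_right mult_ac)
  also have "\<dots> = (\<Sum>l<n. \<Sum>j<n. \<Sum>i<n. complex_of_real (s l) * ((cnj (F j l) * \<xi> j) * cnj (cnj (F i l) * \<xi> i)))"
    by (subst sum.swap, subst (2) sum.swap, subst sum.swap) (rule refl)
  also have "\<dots> = (\<Sum>l<n. complex_of_real (s l) * ((\<Sum>j<n. cnj (F j l) * \<xi> j) * cnj (\<Sum>i<n. cnj (F i l) * \<xi> i)))"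
    unfolding cnj_sum sum_product by (simp only: sum_distrib_left)
  also have "\<dots> = complex_of_real (\<Sum>l<n. s l * (cmod (\<Sum>j<n. cnj (F j l) * \<xi> j))\<^sup>2)"
    by (simp only: complex_norm_square of_real_mult of_real_sum)
  finally show ?thesis by (simp only: qf_def Re_complex_of_real)
qed

text \<open>Each eigenvalue is the form at a unit eigenvector and thus at least 1. Strict positivity
  allows the eigenvalues to be rounded to powers of 2.\<close>

lemma spectral_psd:
  assumes "psd n A" "\<And>\<xi>. nsq n \<xi> \<le> qf n A \<xi>"
  obtains F s where "unitary n F" "\<And>l. l < n \<Longrightarrow> (0::real) < s l"
    "\<And>\<xi>. qf n A \<xi> = (\<Sum>l<n. s l * (cmod (\<Sum>j<n. cnj (F j l) * \<xi> j))\<^sup>2)"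
proof -
  obtain F s where F: "unitary n F" and s: "\<And>i j. i < n \<Longrightarrow> j < n \<Longrightarrow> A i j = (\<Sum>l<n. complex_of_real (s l) * F i l * cnj (F j l))"
    using spectral_decomposition assms(1) unfolding psd_def by blast
  have q: "qf n A \<xi> = (\<Sum>l<n. s l * (cmod (\<Sum>j<n. cnj (F j l) * \<xi> j))\<^sup>2)" for \<xi>
    by (rule qf_spectral[OF s])
  have "0 < s l" if l: "l < n" for l
  proof -
    have "nsq n (\<lambda>j. F j l) = 1"
    proof -
      have "complex_of_real (nsq n (\<lambda>j. F j l)) = kdelta l l"
        using F l unfolding of_real_nsq unitary_def by (simp add: mult.commute)
      then show ?thesis by (simp add: kdelta_def)
    qed
    then have "1 \<le> qf n A (\<lambda>j. F j l)" using assms(2)[of "\<lambda>j. F j l"] by simp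
    also have "\<dots> = (\<Sum>l'<n. s l' * (cmod (kdelta l' l))\<^sup>2)"
      unfolding q using F l by (intro sum.cong refl) (simp add: unitary_def)
    also have "\<dots> = s l"
      using l by (simp add: kdelta_def if_distrib if_distribR cong: if_cong)
    finally show ?thesis by simp
  qed
  then show ?thesis using that F q by blast
qed

text \<open>For fixed \<open>p\<close> the bins \<open>m\<close> correspond to the values \<open>\<sigma>\<close> of \<open>s\<close>, so the sum over \<open>m\<close> is a
  pinching of \<open>y\<close> to the level sets of \<open>s\<close>.\<close>

lemma col_bd_bins:
  fixes \<alpha> \<beta> :: "nat \<Rightarrow> real" and s t :: "nat \<Rightarrow> int"
  assumes bd: "\<And>K \<xi>. (\<Sum>p<n. \<beta> p * (\<Sum>k<K. (cmod (\<Sum>l<n. y p l k * \<xi> l))\<^sup>2)) \<le> 2 * (\<Sum>l<n. \<alpha> l * (cmod (\<xi> l))\<^sup>2)"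
    and t: "\<And>p. p < n \<Longrightarrow> 2 powi t p \<le> \<beta> p" and s: "\<And>l. l < n \<Longrightarrow> \<alpha> l \<le> 2 * 2 powi s l"
    and M: "\<And>p l. p < n \<Longrightarrow> l < n \<Longrightarrow> \<bar>t p - s l\<bar> \<le> int M"
    and u: "\<And>m p l k. p < n \<Longrightarrow> l < n \<Longrightarrow> u m p l k = (if t p - s l = m then y p l k else 0)"
  shows "col_bd n M u 2"
  unfolding col_bd_def
proof (intro allI)
  fix K :: nat and \<xi> :: "nat \<Rightarrow> complex"
  define S where "S = s ` {..<n}"
  \<comment> \<open>The restriction of \<xi> to one level set of \<open>s\<close>. For fixed
    \<open>p\<close>, the bin m = t p - \<sigma> of \<open>u\<close> sees only this part.\<close>
  define \<zeta> where "\<zeta> = (\<lambda>\<sigma> l. if s l = \<sigma> then \<xi> l else 0)"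
  let ?I = "{-int M..int M}"
  have row: "(\<Sum>m\<in>?I. 2 powi m * (cmod (\<Sum>l<n. u m p l k * \<xi> l))\<^sup>2) \<le>
     (\<Sum>\<sigma>\<in>S. 2 powi (- \<sigma>) * (\<beta> p * (cmod (\<Sum>l<n. y p l k * \<zeta> \<sigma> l))\<^sup>2))" if p: "p < n" for p k
  proof -
    have inj: "inj_on (\<lambda>\<sigma>. t p - \<sigma>) S" by (auto simp: inj_on_def)
    have "(\<Sum>m\<in>?I. 2 powi m * (cmod (\<Sum>l<n. u m p l k * \<xi> l))\<^sup>2) =
        (\<Sum>m\<in>(\<lambda>\<sigma>. t p - \<sigma>) ` S. 2 powi m * (cmod (\<Sum>l<n. u m p l k * \<xi> l))\<^sup>2)"
    proof (rule sum.mono_neutral_right)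
      show "(\<lambda>\<sigma>. t p - \<sigma>) ` S \<subseteq> ?I" using M[OF p] by (fastforce simp: S_def abs_le_iff)
      show "\<forall>m\<in>?I - (\<lambda>\<sigma>. t p - \<sigma>) ` S. 2 powi m * (cmod (\<Sum>l<n. u m p l k * \<xi> l))\<^sup>2 = 0"
      proof
        fix m assume "m \<in> ?I - (\<lambda>\<sigma>. t p - \<sigma>) ` S"
        then have "u m p l k = 0" if "l < n" for l
          using u[OF p that, of m k] that by (auto simp: S_def)
        then show "2 powi m * (cmod (\<Sum>l<n. u m p l k * \<xi> l))\<^sup>2 = 0" by simp
      qed
    qed simp
    also have "\<dots> = (\<Sum>\<sigma>\<in>S. 2 powi (t p - \<sigma>) * (cmod (\<Sum>l<n. u (t p - \<sigma>) p l k * \<xi> l))\<^sup>2)"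
      by (simp only: sum.reindex[OF inj] o_def)
    also have "\<dots> = (\<Sum>\<sigma>\<in>S. 2 powi (- \<sigma>) * (2 powi t p * (cmod (\<Sum>l<n. y p l k * \<zeta> \<sigma> l))\<^sup>2))"
    proof (intro sum.cong refl)
      fix \<sigma>
      have "(\<Sum>l<n. u (t p - \<sigma>) p l k * \<xi> l) = (\<Sum>l<n. y p l k * \<zeta> \<sigma> l)"
        by (intro sum.cong refl) (simp add: u p \<zeta>_def)
      then show "2 powi (t p - \<sigma>) * (cmod (\<Sum>l<n. u (t p - \<sigma>) p l k * \<xi> l))\<^sup>2 =
          2 powi (- \<sigma>) * (2 powi t p * (cmod (\<Sum>l<n. y p l k * \<zeta> \<sigma> l))\<^sup>2)"
        by (simp add: power_int_diff power_int_minus field_simps)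
    qed
    also have "\<dots> \<le> (\<Sum>\<sigma>\<in>S. 2 powi (- \<sigma>) * (\<beta> p * (cmod (\<Sum>l<n. y p l k * \<zeta> \<sigma> l))\<^sup>2))"
      by (intro sum_mono mult_left_mono mult_right_mono t p) simp_all
    finally show ?thesis .
  qed
  have "(\<Sum>m\<in>?I. 2 powi m * colq n K (u m) \<xi>) = (\<Sum>k<K. \<Sum>p<n. \<Sum>m\<in>?I. 2 powi m * (cmod (\<Sum>l<n. u m p l k * \<xi> l))\<^sup>2)"
    unfolding colq_def nsq_def sum_distrib_left by (subst sum.swap, rule sum.cong[OF refl], rule sum.swap)
  also have "\<dots> \<le> (\<Sum>k<K. \<Sum>p<n. \<Sum>\<sigma>\<in>S. 2 powi (- \<sigma>) * (\<beta> p * (cmod (\<Sum>l<n. y p l k * \<zeta> \<sigma> l))\<^sup>2))"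
    by (intro sum_mono row) simp
  also have "\<dots> = (\<Sum>\<sigma>\<in>S. \<Sum>p<n. \<Sum>k<K. 2 powi (- \<sigma>) * (\<beta> p * (cmod (\<Sum>l<n. y p l k * \<zeta> \<sigma> l))\<^sup>2))"
    by (subst (2) sum.swap, subst sum.swap, rule sum.cong[OF refl], rule sum.swap)
  also have "\<dots> = (\<Sum>\<sigma>\<in>S. 2 powi (- \<sigma>) * (\<Sum>p<n. \<beta> p * (\<Sum>k<K. (cmod (\<Sum>l<n. y p l k * \<zeta> \<sigma> l))\<^sup>2)))"
    by (simp only: sum_distrib_left)
  also have "\<dots> \<le> (\<Sum>\<sigma>\<in>S. 2 powi (- \<sigma>) * (2 * (\<Sum>l<n. \<alpha> l * (cmod (\<zeta> \<sigma> l))\<^sup>2)))"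
    by (intro sum_mono mult_left_mono bd) simp
  also have "\<dots> = (\<Sum>\<sigma>\<in>S. \<Sum>l<n. if s l = \<sigma> then 2 * (2 powi (- s l) * \<alpha> l) * (cmod (\<xi> l))\<^sup>2 else 0)"
    unfolding sum_distrib_left by (intro sum.cong refl) (simp add: \<zeta>_def)
  also have "\<dots> = (\<Sum>l<n. \<Sum>\<sigma>\<in>S. if s l = \<sigma> then 2 * (2 powi (- s l) * \<alpha> l) * (cmod (\<xi> l))\<^sup>2 else 0)"
    by (rule sum.swap)
  also have "\<dots> = (\<Sum>l<n. 2 * (2 powi (- s l) * \<alpha> l) * (cmod (\<xi> l))\<^sup>2)"
    by (intro sum.cong refl) (simp add: S_def)
  \<comment> \<open>The 2 in the hypothesis and the 2 lost by rounding \<alpha> down multiply to the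
    square of the bound 2.\<close>
  also have "\<dots> \<le> (\<Sum>l<n. 2\<^sup>2 * (cmod (\<xi> l))\<^sup>2)"
  proof (intro sum_mono mult_right_mono)
    fix l assume "l \<in> {..<n}"
    then show "2 * (2 powi (- s l) * \<alpha> l) \<le> 2\<^sup>2"
      using s[of l] by (simp add: power_int_minus field_simps)
  qed simp
  also have "\<dots> = 2\<^sup>2 * nsq n \<xi>" by (simp only: nsq_def sum_distrib_left)
  finally show "(\<Sum>m\<in>?I. 2 powi m * colq n K (u m) \<xi>) \<le> 2\<^sup>2 * nsq n \<xi>" .
qed

text \<open>The eigenvalues are rounded to 2^(s l) and 2^(t p), and the entry (p, l) goes to the bin
  t p - s l. The weight 2^m is then, up to rounding, the ratio of \<beta> p and \<alpha> l, which
  turns the two weighted inequalities into the two halves of a J-bound.\<close>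

lemma J_bd_bins:
  fixes \<alpha> \<beta> :: "nat \<Rightarrow> real"
  assumes 1: "\<And>K \<xi>. (\<Sum>p<n. \<beta> p * (\<Sum>k<K. (cmod (\<Sum>l<n. y p l k * \<xi> l))\<^sup>2)) \<le> 2 * (\<Sum>l<n. \<alpha> l * (cmod (\<xi> l))\<^sup>2)"
    and 2: "\<And>K \<xi>. (\<Sum>l<n. \<alpha> l * (\<Sum>k<K. (cmod (\<Sum>p<n. y p l k * \<xi> p))\<^sup>2)) \<le> 2 * (\<Sum>p<n. \<beta> p * (cmod (\<xi> p))\<^sup>2)"
    and pos: "\<And>l. l < n \<Longrightarrow> 0 < \<alpha> l" "\<And>p. p < n \<Longrightarrow> 0 < \<beta> p"
  shows "\<exists>M u. supp M u \<and> J_bd n M u 2 \<and> (\<forall>i<n. \<forall>j<n. \<forall>k. y i j k = (\<Sum>m=-int M..int M. u m i j k))"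
proof -
  have "\<forall>l\<in>{..<n}. \<exists>m::int. 2 powi m \<le> \<alpha> l \<and> \<alpha> l < 2 * 2 powi m"
    using dyadic_bracket pos(1) by blast
  from bchoice[OF this] obtain s :: "nat \<Rightarrow> int" where s: "\<And>l. l < n \<Longrightarrow> 2 powi s l \<le> \<alpha> l" "\<And>l. l < n \<Longrightarrow> \<alpha> l < 2 * 2 powi s l" by blast
  have "\<forall>p\<in>{..<n}. \<exists>m::int. 2 powi m \<le> \<beta> p \<and> \<beta> p < 2 * 2 powi m"
    using dyadic_bracket pos(2) by blast
  from bchoice[OF this] obtain t :: "nat \<Rightarrow> int" where t: "\<And>p. p < n \<Longrightarrow> 2 powi t p \<le> \<beta> p" "\<And>p. p < n \<Longrightarrow> \<beta> p < 2 * 2 powi t p" by blast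
  define M where "M = nat ((\<Sum>p<n. \<bar>t p\<bar>) + (\<Sum>l<n. \<bar>s l\<bar>))"
  have M: "\<bar>t p - s l\<bar> \<le> int M" if "p < n" "l < n" for p l
  proof -
    have "\<bar>t p\<bar> \<le> (\<Sum>p<n. \<bar>t p\<bar>)" "\<bar>s l\<bar> \<le> (\<Sum>l<n. \<bar>s l\<bar>)"
      using that by (auto intro!: member_le_sum)
    then show ?thesis unfolding M_def by linarith
  qed
  define u where "u = (\<lambda>m p l k. if p < n \<and> l < n \<and> t p - s l = m then y p l k else 0)"
  have "supp M u"
    using M unfolding supp_def u_def by (fastforce simp: fun_eq_iff)
  moreover have "col_bd n M u 2"
    by (rule col_bd_bins[OF 1 t(1) less_imp_le[OF s(2)] M]) (simp_all add: u_def)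
  moreover have "col_bd n M (flip u) 2"
  \<comment> \<open>The flipped family is the same construction for the transposed cube with the two
    sequences of eigenvalues exchanged.\<close>
  proof (rule col_bd_bins[where y="\<lambda>l p k. y p l k" and \<alpha>=\<beta> and \<beta>=\<alpha> and s=t and t=s])
    show "\<bar>s p - t l\<bar> \<le> int M" if "p < n" "l < n" for p l using M[OF that(2,1)] by linarith
    show "flip u m p l k = (if s p - t l = m then y l p k else 0)" if "p < n" "l < n" for m p l k
      using that by (auto simp: flip_def u_def)
  qed (use 2 s t in \<open>auto simp: less_imp_le\<close>)
  moreover have "y i j k = (\<Sum>m=-int M..int M. u m i j k)" if "i < n" "j < n" for i j k
    using M[OF that] that by (auto simp: u_def abs_le_iff)
  ultimately show ?thesis unfolding J_bd_def by (intro exI[of _ M] exI[of _ u]) auto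
qed

lemma unitary_sandwich_inverse:
  assumes G: "unitary n G" and F: "unitary n F" and ij: "i < n" "j < n"
  shows "sandwich n G (sandwich n (\<lambda>p i. cnj (G i p)) z F) (\<lambda>l j. cnj (F j l)) i j k = z i j k"
proof -
  have "sandwich n G (sandwich n (\<lambda>p i. cnj (G i p)) z F) (\<lambda>l j. cnj (F j l)) i j k =
     (\<Sum>p<n. \<Sum>l<n. \<Sum>a<n. \<Sum>b<n. (G i p * cnj (G a p)) * (F b l * cnj (F j l)) * z a b k)"
    unfolding sandwich_def sum_distrib_left by (intro sum.cong refl) (simp only: mult_ac)
  also have "\<dots> = (\<Sum>a<n. \<Sum>p<n. \<Sum>l<n. \<Sum>b<n. (G i p * cnj (G a p)) * (F b l * cnj (F j l)) * z a b k)"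
    by (subst (2) sum.swap, subst sum.swap) (rule refl)
  also have "\<dots> = (\<Sum>a<n. \<Sum>b<n. \<Sum>p<n. \<Sum>l<n. (G i p * cnj (G a p)) * (F b l * cnj (F j l)) * z a b k)"
    by (rule sum.cong[OF refl], subst (2) sum.swap, subst sum.swap) (rule refl)
  also have "\<dots> = (\<Sum>a<n. \<Sum>b<n. (\<Sum>p<n. G i p * cnj (G a p)) * (\<Sum>l<n. F b l * cnj (F j l)) * z a b k)"
    unfolding sum_product by (simp only: sum_distrib_right)
  also have "\<dots> = (\<Sum>a<n. \<Sum>b<n. kdelta i a * (kdelta b j * z a b k))"
    using G F ij by (intro sum.cong refl) (simp add: unitary_def mult.assoc)
  also have "\<dots> = z i j k"
    using ij by (simp add: sum_distrib_left[symmetric])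
  finally show ?thesis .
qed

text \<open>For y = G^* z F, with \<open>F\<close> and \<open>G\<close> eigenbases of
  \<open>A\<close> and \<open>B\<close>, the inequality for \<open>star z\<close> and
  \<open>B\<close> becomes the weighted column inequality and the one for \<open>z\<close> and
  \<open>A\<close> the weighted row inequality. The bins are formed for \<open>y\<close> and rotated
  back, which keeps the J-bound.\<close>

lemma gram_contractive_decomposition:
  assumes z: "gram_contractive n z"
  shows "\<exists>M u. supp M u \<and> J_bd n M u 2 \<and> (\<forall>i<n. \<forall>j<n. \<forall>k. z i j k = (\<Sum>m=-int M..int M. u m i j k))"
proof -
  have sz: "square_summable n z" using z by (simp add: gram_contractive_def)
  obtain A B where AB: "psd n A" "psd n B" "\<And>\<xi>. nsq n \<xi> \<le> qf n A \<xi>" "\<And>\<xi>. nsq n \<xi> \<le> qf n B \<xi>"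
      "\<And>\<xi>. qf n (cp_map n z A) \<xi> \<le> 2 * qf n B \<xi>" "\<And>\<xi>. qf n (cp_map n (star z) B) \<xi> \<le> 2 * qf n A \<xi>"
    using subinvariant_pair[OF z] by blast
  obtain F \<alpha> where F: "unitary n F" "\<And>l. l < n \<Longrightarrow> (0::real) < \<alpha> l"
      "\<And>\<xi>. qf n A \<xi> = (\<Sum>l<n. \<alpha> l * (cmod (\<Sum>j<n. cnj (F j l) * \<xi> j))\<^sup>2)"
    using spectral_psd[OF AB(1,3)] by blast
  obtain G \<beta> where G: "unitary n G" "\<And>l. l < n \<Longrightarrow> (0::real) < \<beta> l"
      "\<And>\<xi>. qf n B \<xi> = (\<Sum>l<n. \<beta> l * (cmod (\<Sum>j<n. cnj (G j l) * \<xi> j))\<^sup>2)"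
    using spectral_psd[OF AB(2,4)] by blast
  define y where "y = sandwich n (\<lambda>p i. cnj (G i p)) z F"
  have inv: "(\<Sum>j<n. cnj (F j l) * (\<Sum>l'<n. F j l' * \<xi> l')) = \<xi> l" if F: "unitary n F" and l: "l < n" for F l \<xi>
  proof -
    have "(\<Sum>j<n. cnj (F j l) * (\<Sum>l'<n. F j l' * \<xi> l')) = (\<Sum>l'<n. (\<Sum>j<n. cnj (F j l) * F j l') * \<xi> l')"
      unfolding sum_distrib_left sum_distrib_right by (subst sum.swap) (simp only: mult.assoc)
    also have "\<dots> = (\<Sum>l'<n. kdelta l l' * \<xi> l')" using F l by (simp add: unitary_def)
    finally show ?thesis using l by simp
  qed
  have qA: "qf n A (\<lambda>j. \<Sum>l<n. F j l * \<xi> l) = (\<Sum>l<n. \<alpha> l * (cmod (\<xi> l))\<^sup>2)" for \<xi>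
    unfolding F(3) by (intro sum.cong refl) (simp add: inv[OF F(1)])
  have qB: "qf n B (\<lambda>j. \<Sum>l<n. G j l * \<xi> l) = (\<Sum>l<n. \<beta> l * (cmod (\<xi> l))\<^sup>2)" for \<xi>
    unfolding G(3) by (intro sum.cong refl) (simp add: inv[OF G(1)])
  have "(\<Sum>p<n. \<beta> p * (\<Sum>k<K. (cmod (\<Sum>l<n. y p l k * \<xi> l))\<^sup>2)) \<le> 2 * (\<Sum>l<n. \<alpha> l * (cmod (\<xi> l))\<^sup>2)" for K \<xi>
  proof -
    let ?x = "\<lambda>j. \<Sum>l<n. F j l * \<xi> l"
    have yx: "(\<Sum>l<n. y p l k * \<xi> l) = (\<Sum>i<n. cnj (G i p) * cnj (\<Sum>j<n. cnj (?x j) * star z j i k))" for p k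
    proof -
      have "(\<Sum>l<n. y p l k * \<xi> l) = (\<Sum>l<n. \<Sum>i<n. \<Sum>j<n. cnj (G i p) * (F j l * \<xi> l * z i j k))"
        unfolding y_def sandwich_def sum_distrib_right by (intro sum.cong refl) (simp only: mult_ac)
      also have "\<dots> = (\<Sum>i<n. \<Sum>j<n. \<Sum>l<n. cnj (G i p) * (F j l * \<xi> l * z i j k))"
        by (subst sum.swap, subst (2) sum.swap) (rule refl)
      also have "\<dots> = (\<Sum>i<n. cnj (G i p) * (\<Sum>j<n. ?x j * z i j k))"
        by (simp only: sum_distrib_left sum_distrib_right)
      also have "\<dots> = (\<Sum>i<n. cnj (G i p) * cnj (\<Sum>j<n. cnj (?x j) * star z j i k))"
        by (simp add: star_def)
      finally show ?thesis .
    qed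
    have "(\<Sum>p<n. \<beta> p * (\<Sum>k<K. (cmod (\<Sum>l<n. y p l k * \<xi> l))\<^sup>2)) = (\<Sum>k<K. qf n B (\<lambda>i. cnj (\<Sum>j<n. cnj (?x j) * star z j i k)))"
      unfolding yx G(3) sum_distrib_left by (rule sum.swap)
    also have "\<dots> \<le> qf n (cp_map n (star z) B) ?x"
      by (rule qf_cp_map_partial[OF square_summable_star[OF sz] AB(2)])
    also have "\<dots> \<le> 2 * qf n A ?x" by (rule AB(6))
    finally show ?thesis unfolding qA .
  qed
  moreover have "(\<Sum>l<n. \<alpha> l * (\<Sum>k<K. (cmod (\<Sum>p<n. y p l k * \<eta> p))\<^sup>2)) \<le> 2 * (\<Sum>p<n. \<beta> p * (cmod (\<eta> p))\<^sup>2)" for K \<eta>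
  proof -
    \<comment> \<open>The row inequality pairs \<open>y\<close> with \<eta> bilinearly, whereas the
      form of \<open>B\<close> is sesquilinear; hence the conjugate of \<eta>.\<close>
    let ?g = "\<lambda>i. \<Sum>p<n. G i p * cnj (\<eta> p)"
    have yx: "(\<Sum>p<n. y p l k * \<eta> p) = cnj (\<Sum>j<n. cnj (F j l) * cnj (\<Sum>i<n. cnj (?g i) * z i j k))" for l k
    proof -
      have "(\<Sum>p<n. y p l k * \<eta> p) = (\<Sum>p<n. \<Sum>j<n. \<Sum>i<n. F j l * (cnj (G i p) * \<eta> p * z i j k))"
        unfolding y_def sandwich_def sum_distrib_right
        by (rule sum.cong[OF refl], subst sum.swap, intro sum.cong refl) (simp only: mult_ac)
      also have "\<dots> = (\<Sum>j<n. \<Sum>i<n. \<Sum>p<n. F j l * (cnj (G i p) * \<eta> p * z i j k))"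
        by (subst sum.swap, subst (2) sum.swap) (rule refl)
      also have "\<dots> = (\<Sum>j<n. F j l * (\<Sum>i<n. cnj (?g i) * z i j k))"
        by (simp only: sum_distrib_left sum_distrib_right cnj_sum complex_cnj_mult complex_cnj_cnj)
      finally show ?thesis by (simp only: cnj_sum complex_cnj_mult complex_cnj_cnj)
    qed
    have "(\<Sum>l<n. \<alpha> l * (\<Sum>k<K. (cmod (\<Sum>p<n. y p l k * \<eta> p))\<^sup>2)) = (\<Sum>k<K. qf n A (\<lambda>j. cnj (\<Sum>i<n. cnj (?g i) * z i j k)))"
      unfolding yx F(3) sum_distrib_left complex_mod_cnj by (rule sum.swap)
    also have "\<dots> \<le> qf n (cp_map n z A) ?g"
      by (rule qf_cp_map_partial[OF sz AB(1)])
    also have "\<dots> \<le> 2 * qf n B ?g" by (rule AB(5))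
    finally show ?thesis unfolding qB by simp
  qed
  ultimately obtain M u where u: "supp M u" "J_bd n M u 2"
      and yu: "\<And>i j k. i < n \<Longrightarrow> j < n \<Longrightarrow> y i j k = (\<Sum>m=-int M..int M. u m i j k)"
    using J_bd_bins[where n=n and y=y and \<alpha>=\<alpha> and \<beta>=\<beta>] F(2) G(2) by blast
  define v where "v = (\<lambda>m. sandwich n G (u m) (\<lambda>l j. cnj (F j l)))"
  have "J_bd n M v (1 * 2 * 1)"
    unfolding v_def by (intro J_bd_sandwich[OF u(2)] unitary_opbd G unitary_adjoint F)
  moreover have "z i j k = (\<Sum>m=-int M..int M. v m i j k)" if "i < n" "j < n" for i j k
  proof -
    have "z i j k = sandwich n G y (\<lambda>l j. cnj (F j l)) i j k"
      unfolding y_def by (rule unitary_sandwich_inverse[symmetric, OF G(1) F(1) that])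
    also have "\<dots> = (\<Sum>a<n. \<Sum>b<n. \<Sum>m=-int M..int M. G i a * cnj (F j b) * u m a b k)"
      unfolding sandwich_def by (intro sum.cong refl) (simp add: yu sum_distrib_left)
    also have "\<dots> = (\<Sum>m=-int M..int M. \<Sum>a<n. \<Sum>b<n. G i a * cnj (F j b) * u m a b k)"
      by (simp only: sum.swap[where B="{-int M..int M}"])
    finally show ?thesis by (simp only: v_def sandwich_def)
  qed
  moreover have "supp M v" unfolding v_def by (rule supp_sandwich[OF u(1)])
  ultimately show ?thesis by (intro exI[of _ M] exI[of _ v]) simp
qed

section \<open>The norms of the operator Hilbert space\<close>

lemma cvec_norm_nsq: "cvec_norm v = sqrt (nsq (dim_vec v) (\<lambda>i. v $ i))"
  by (simp add: cvec_norm_def L2_set_def nsq_def)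

lemma cvec_norm_mult:
  assumes "\<alpha> \<in> carrier_mat p n" "v \<in> carrier_vec n"
  shows "cvec_norm (\<alpha> *\<^sub>v v) = sqrt (nsq p (\<lambda>i. \<Sum>j<n. \<alpha> $$ (i, j) * v $ j))"
proof -
  have "nsq p (\<lambda>i. (\<alpha> *\<^sub>v v) $ i) = nsq p (\<lambda>i. \<Sum>j<n. \<alpha> $$ (i, j) * v $ j)"
    using assms by (intro nsq_cong) (simp add: scalar_prod_def lessThan_atLeast0)
  then show ?thesis using assms by (simp add: cvec_norm_nsq)
qed

lemma nsq_matrix_bound: "nsq p (\<lambda>i. \<Sum>j<n. \<alpha> i j * \<xi> j) \<le> (\<Sum>i<p. nsq n (\<alpha> i)) * nsq n \<xi>"
  unfolding nsq_def[of p] sum_distrib_right by (intro sum_mono cauchy_schwarz_complex)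

text \<open>\<open>nsq_matrix_bound\<close> keeps the set under the supremum bounded above; the
  estimate on the unit ball extends to all vectors by scaling.\<close>

lemma op_norm_opbd:
  assumes \<alpha>: "\<alpha> \<in> carrier_mat p n"
  shows "opbd p n (\<lambda>i j. \<alpha> $$ (i, j)) (op_norm \<alpha>)"
proof -
  let ?B = "{v \<in> carrier_vec (dim_col \<alpha>). cvec_norm v \<le> 1}"
  let ?a = "\<lambda>i j. \<alpha> $$ (i, j)"
  have bdd: "bdd_above ((\<lambda>v. cvec_norm (\<alpha> *\<^sub>v v)) ` ?B)"
  proof (rule bdd_aboveI2)
    fix v assume v: "v \<in> ?B"
    then have "nsq n (\<lambda>i. v $ i) \<le> 1" using \<alpha> by (auto simp: cvec_norm_nsq)
    then have "nsq p (\<lambda>i. \<Sum>j<n. ?a i j * v $ j) \<le> (\<Sum>i<p. nsq n (?a i)) * 1"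
      by (intro order_trans[OF nsq_matrix_bound] mult_left_mono sum_nonneg) simp_all
    then show "cvec_norm (\<alpha> *\<^sub>v v) \<le> sqrt (\<Sum>i<p. nsq n (?a i))"
      using v \<alpha> by (simp add: cvec_norm_mult)
  qed
  have up: "cvec_norm (\<alpha> *\<^sub>v v) \<le> op_norm \<alpha>" if "v \<in> ?B" for v
    unfolding op_norm_def by (rule cSUP_upper[OF that bdd])
  have nonneg: "0 \<le> op_norm \<alpha>"
  proof -
    have "0\<^sub>v n \<in> ?B" using \<alpha> by (simp add: cvec_norm_nsq nsq_def)
    from up[OF this] show ?thesis by (rule order_trans[rotated]) (simp add: cvec_norm_nsq)
  qed
  have "nsq p (\<lambda>i. \<Sum>j<n. ?a i j * \<xi> j) \<le> (op_norm \<alpha>)\<^sup>2 * nsq n \<xi>" for \<xi>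
  proof (cases "nsq n \<xi> = 0")
    case True
    then show ?thesis using nsq_matrix_bound[where p=p and n=n and \<alpha>="?a" and \<xi>=\<xi>] by simp
  next
    case False
    then have q: "0 < nsq n \<xi>" by (simp add: order_less_le)
    define c where "c = complex_of_real (1 / sqrt (nsq n \<xi>))"
    have c2: "(cmod c)\<^sup>2 = 1 / nsq n \<xi>" using q by (simp add: c_def norm_divide power_divide)
    define v where "v = vec n (\<lambda>j. c * \<xi> j)"
    have "nsq n (\<lambda>j. v $ j) = 1"
    proof -
      have "nsq n (\<lambda>j. v $ j) = nsq n (\<lambda>j. c * \<xi> j)" by (rule nsq_cong) (simp add: v_def)
      then show ?thesis using q by (simp add: nsq_scale c2)
    qed
    then have "v \<in> ?B" using \<alpha> by (simp add: cvec_norm_nsq) (simp add: v_def)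
    from up[OF this] have "sqrt (nsq p (\<lambda>i. \<Sum>j<n. ?a i j * v $ j)) \<le> op_norm \<alpha>"
      using cvec_norm_mult[OF \<alpha>, of v] by (simp add: v_def)
    then have "nsq p (\<lambda>i. \<Sum>j<n. ?a i j * v $ j) \<le> (op_norm \<alpha>)\<^sup>2"
      by (rule sqrt_le_D)
    also have "nsq p (\<lambda>i. \<Sum>j<n. ?a i j * v $ j) = nsq p (\<lambda>i. c * (\<Sum>j<n. ?a i j * \<xi> j))"
      by (intro nsq_cong) (simp add: v_def sum_distrib_left mult_ac)
    also have "\<dots> = nsq p (\<lambda>i. \<Sum>j<n. ?a i j * \<xi> j) / nsq n \<xi>"
      unfolding nsq_scale c2 by simp
    finally show ?thesis using q by (simp add: field_simps)
  qed
  then show ?thesis using nonneg by (simp add: opbd_def)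
qed

lemma op_norm_le:
  assumes \<alpha>: "\<alpha> \<in> carrier_mat p n" and s: "opbd p n (\<lambda>i j. \<alpha> $$ (i, j)) s"
  shows "op_norm \<alpha> \<le> s"
  unfolding op_norm_def
proof (rule cSUP_least)
  have "0\<^sub>v n \<in> {v \<in> carrier_vec (dim_col \<alpha>). cvec_norm v \<le> 1}"
    using \<alpha> by (simp add: cvec_norm_nsq nsq_def)
  then show "{v \<in> carrier_vec (dim_col \<alpha>). cvec_norm v \<le> 1} \<noteq> {}" by blast
  fix v assume v: "v \<in> {v \<in> carrier_vec (dim_col \<alpha>). cvec_norm v \<le> 1}"
  then have q: "nsq n (\<lambda>i. v $ i) \<le> 1" using \<alpha> by (auto simp: cvec_norm_nsq)
  have "nsq p (\<lambda>i. \<Sum>j<n. \<alpha> $$ (i, j) * v $ j) \<le> s\<^sup>2 * nsq n (\<lambda>i. v $ i)"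
    by (rule opbdD[OF s])
  also have "\<dots> \<le> s\<^sup>2 * 1" by (intro mult_left_mono q) simp
  finally have "sqrt (nsq p (\<lambda>i. \<Sum>j<n. \<alpha> $$ (i, j) * v $ j)) \<le> s"
    using s by (simp add: opbd_def real_le_lsqrt)
  then show "cvec_norm (\<alpha> *\<^sub>v v) \<le> s"
    using cvec_norm_mult[OF \<alpha>, of v] v \<alpha> by simp
qed

section \<open>The Gram matrix as a form on pairs of matrices\<close>

definition cube_of :: "(nat \<Rightarrow> complex) mat \<Rightarrow> cube" where
  "cube_of A i j k = (A $$ (i, j)) k"

lemma sum_flatten:
  fixes f :: "nat \<Rightarrow> 'a::comm_monoid_add"
  shows "(\<Sum>p<m * n. f p) = (\<Sum>i<m. \<Sum>i'<n. f (i * n + i'))"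
proof -
  have "sum f {i * n..<i * n + n} = (\<Sum>i'<n. f (i * n + i'))" for i
    using sum.shift_bounds_nat_ivl[of f 0 "i * n" n] by (simp add: lessThan_atLeast0 add.commute)
  then show ?thesis using sum.nat_group[of f n m] by simp
qed

lemma oh_gram_carrier: "A \<in> carrier_mat n n \<Longrightarrow> oh_gram A \<in> carrier_mat (n * n) (n * n)"
  by (simp add: oh_gram_def)

lemma oh_gram_entry:
  assumes A: "A \<in> carrier_mat n n" and i: "i < n" "i' < n" "j < n" "j' < n"
  shows "oh_gram A $$ (i * n + i', j * n + j') = gram (cube_of A) i i' j j'"
proof -
  have lt: "i * n + i' < n * n" "j * n + j' < n * n"
  proof -
    have "a * n + b < n * n" if "a < n" "b < n" for a b
    proof -
      have "a * n + b < Suc a * n" using that by simp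
      also have "\<dots> \<le> n * n" using that by (intro mult_le_mono1) simp
      finally show ?thesis .
    qed
    then show "i * n + i' < n * n" "j * n + j' < n * n" using i by auto
  qed
  have "kronecker (coord_mat k A) (map_mat cnj (coord_mat k A)) $$ (i * n + i', j * n + j') =
      cube_of A i j k * cnj (cube_of A i' j' k)" for k
    using A i lt by (simp add: kronecker_def coord_mat_def cube_of_def)
  then show ?thesis using A lt by (simp add: oh_gram_def gram_def)
qed

definition flat :: "nat \<Rightarrow> (nat \<Rightarrow> nat \<Rightarrow> complex) \<Rightarrow> nat \<Rightarrow> complex" where
  "flat n v p = v (p div n) (p mod n)"

lemma flat_entry: "i' < n \<Longrightarrow> flat n v (i * n + i') = v i i'"
  by (simp add: flat_def)

lemma nsq_flat: "nsq (n * n) (flat n v) = fro n v"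
  by (simp add: nsq_def sum_flatten flat_entry fro_def)

lemma flat_unflat: "nsq (n * n) \<xi> = fro n (\<lambda>i i'. \<xi> (i * n + i'))"
  by (simp add: nsq_def sum_flatten fro_def)

lemma gram_form_flat:
  assumes A: "A \<in> carrier_mat n n"
  shows "gram_form n (cube_of A) w v =
    (\<Sum>p<n * n. flat n w p * (\<Sum>q<n * n. oh_gram A $$ (p, q) * flat n v q))"
proof -
  have "(\<Sum>p<n * n. flat n w p * (\<Sum>q<n * n. oh_gram A $$ (p, q) * flat n v q)) =
    (\<Sum>i<n. \<Sum>i'<n. w i i' * (\<Sum>j<n. \<Sum>j'<n. gram (cube_of A) i i' j j' * v j j'))"
    unfolding sum_flatten by (intro sum.cong refl arg_cong2[where f="(*)"]) (simp_all add: flat_entry oh_gram_entry[OF A])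
  then show ?thesis by (simp only: gram_form_def sum_distrib_left mult.assoc)
qed

lemma gram_form_le_op_norm:
  assumes A: "A \<in> carrier_mat n n"
  shows "(cmod (gram_form n (cube_of A) w v))\<^sup>2 \<le> (op_norm (oh_gram A))\<^sup>2 * (fro n w * fro n v)"
proof -
  let ?G = "\<lambda>p. \<Sum>q<n * n. oh_gram A $$ (p, q) * flat n v q"
  have "(cmod (gram_form n (cube_of A) w v))\<^sup>2 \<le> nsq (n * n) (flat n w) * nsq (n * n) ?G"
    unfolding gram_form_flat[OF A] by (rule cauchy_schwarz_complex)
  also have "\<dots> \<le> nsq (n * n) (flat n w) * ((op_norm (oh_gram A))\<^sup>2 * nsq (n * n) (flat n v))"
    by (intro mult_left_mono opbdD[OF op_norm_opbd[OF oh_gram_carrier[OF A]]]) simp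
  finally show ?thesis by (simp add: nsq_flat mult_ac)
qed

text \<open>With \<open>w\<close> the conjugate of the image of \<xi>, the Gram form equals the
  squared length of this image; dividing by the length gives the operator bound.\<close>

lemma op_norm_oh_gram_le:
  assumes A: "A \<in> carrier_mat n n" and C: "0 \<le> C"
    and bd: "\<And>w v. cmod (gram_form n (cube_of A) w v) \<le> C * sqrt (fro n w) * sqrt (fro n v)"
  shows "op_norm (oh_gram A) \<le> C"
proof (rule op_norm_le[OF oh_gram_carrier[OF A]])
  have "nsq (n * n) (\<lambda>p. \<Sum>q<n * n. oh_gram A $$ (p, q) * \<xi> q) \<le> C\<^sup>2 * nsq (n * n) \<xi>" for \<xi>
  proof -
    let ?z = "\<lambda>p. \<Sum>q<n * n. oh_gram A $$ (p, q) * \<xi> q"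
    let ?v = "\<lambda>i i'. \<xi> (i * n + i')" and ?w = "\<lambda>i i'. cnj (?z (i * n + i'))"
    have "complex_of_real (nsq (n * n) ?z) = gram_form n (cube_of A) ?w ?v"
      unfolding gram_form_flat[OF A] of_real_nsq sum_flatten[of _ n n]
      by (intro sum.cong refl) (simp add: flat_entry mult.commute)
    from arg_cong[OF this, of cmod] have "nsq (n * n) ?z = cmod (gram_form n (cube_of A) ?w ?v)"
      by (simp only: norm_of_real abs_of_nonneg[OF nsq_nonneg])
    also have "\<dots> \<le> C * sqrt (fro n ?w) * sqrt (fro n ?v)"
      by (rule bd)
    also have "fro n ?w = nsq (n * n) ?z" using flat_unflat[of n "\<lambda>p. cnj (?z p)"] unfolding nsq_cnj by (rule sym)
    also have "fro n ?v = nsq (n * n) \<xi>" by (rule flat_unflat[symmetric])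
    finally have le: "sqrt (nsq (n * n) ?z) * sqrt (nsq (n * n) ?z) \<le> (C * sqrt (nsq (n * n) \<xi>)) * sqrt (nsq (n * n) ?z)"
      by (simp add: mult_ac)
    have "sqrt (nsq (n * n) ?z) \<le> C * sqrt (nsq (n * n) \<xi>)"
    proof (cases "nsq (n * n) ?z = 0")
      case True
      then show ?thesis using C by simp
    next
      case False
      then have "0 < sqrt (nsq (n * n) ?z)" by (simp add: order_less_le)
      with le show ?thesis by (simp only: mult_le_cancel_right_pos)
    qed
    then have "(sqrt (nsq (n * n) ?z))\<^sup>2 \<le> (C * sqrt (nsq (n * n) \<xi>))\<^sup>2" by (rule power_mono) simp
    then show ?thesis by (simp add: power_mult_distrib)
  qed
  then show "opbd (n * n) (n * n) (\<lambda>i j. oh_gram A $$ (i, j)) C" using C by (simp add: opbd_def)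
qed

section \<open>Norm estimates in OH\<close>

lemma OH_simps [simp]:
  "carrier OH = carrier ell2" "x \<oplus>\<^bsub>OH\<^esub> y = (\<lambda>k. x k + y k)" "\<zero>\<^bsub>OH\<^esub> = (\<lambda>_. 0)"
  "c \<odot>\<^bsub>OH\<^esub> x = (\<lambda>k. c * x k)" "mnorm OH A = sqrt (op_norm (oh_gram A))"
  by (simp_all add: OH_def module.defs opspace.defs ell2_def)

lemma ell2_carrier: "x \<in> carrier ell2 \<longleftrightarrow> summable (\<lambda>k. (cmod (x k))\<^sup>2)"
  by (simp add: ell2_def)

lemma matrices_OH:
  "A \<in> matrices OH n \<longleftrightarrow> A \<in> carrier_mat n n \<and> square_summable n (cube_of A)"
  by (auto simp: matrices_def square_summable_def cube_of_def ell2_carrier)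

lemma OH_unit_ball:
  assumes A: "A \<in> matrices OH n" "mnorm OH A \<le> 1"
  shows "gram_contractive n (cube_of A)"
proof -
  have c: "A \<in> carrier_mat n n" using A by (simp add: matrices_OH)
  have "0 \<le> op_norm (oh_gram A)" using op_norm_opbd[OF oh_gram_carrier[OF c]] by (simp add: opbd_def)
  moreover have "op_norm (oh_gram A) \<le> 1" using A(2) by simp
  ultimately have "(op_norm (oh_gram A))\<^sup>2 \<le> 1" by (simp add: power_le_one)
  then have "(op_norm (oh_gram A))\<^sup>2 * (fro n w * fro n v) \<le> 1 * (fro n w * fro n v)" for w v
    by (rule mult_right_mono) simp
  then have "(cmod (gram_form n (cube_of A) w v))\<^sup>2 \<le> fro n w * fro n v" for w v
    using gram_form_le_op_norm[OF c, of w v] order_trans by fastforce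
  then show ?thesis using A by (simp add: gram_contractive_def matrices_OH)
qed

text \<open>The bound for the truncated Gram forms does not depend on \<open>K\<close> and survives
  the limit. The norm of OH is a square root, which turns \<open>4 * gauge_const * c\<^sup>2\<close>
  into the bound claimed.\<close>

lemma OH_norm_le:
  assumes A: "A \<in> matrices OH n" and J: "J_bd n M u c" and g: "gauged n M u (cube_of A)"
  shows "mnorm OH A \<le> 2 * sqrt gauge_const * c"
proof -
  have c: "0 \<le> c" using J by (simp add: J_bd_def)
  have A': "A \<in> carrier_mat n n" "square_summable n (cube_of A)" using A by (simp_all add: matrices_OH)
  have "op_norm (oh_gram A) \<le> 4 * gauge_const * c\<^sup>2"
  proof (rule op_norm_oh_gram_le[OF A'(1)])
    show "0 \<le> 4 * gauge_const * c\<^sup>2" by (simp add: gauge_const_nonneg)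
    fix w v
    show "cmod (gram_form n (cube_of A) w v) \<le> 4 * gauge_const * c\<^sup>2 * sqrt (fro n w) * sqrt (fro n v)"
      by (rule Lim_bounded[OF tendsto_norm[OF gform_tendsto[OF A'(2)]], of 0]) (use gform_bound[OF J g] in blast)
  qed
  then have "sqrt (op_norm (oh_gram A)) \<le> sqrt (4 * gauge_const * c\<^sup>2)" by simp
  also have "\<dots> = 2 * sqrt gauge_const * c" using c by (simp add: real_sqrt_mult)
  finally show ?thesis by simp
qed

lemma ell2_norm_power2: "x \<in> carrier ell2 \<Longrightarrow> (ell2_norm x)\<^sup>2 = (\<Sum>k. (cmod (x k))\<^sup>2)"
  by (simp add: ell2_norm_def suminf_nonneg ell2_carrier)

lemma gram_diagonal:
  assumes "A \<in> matrices OH n" "i < n" "j < n"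
  shows "gram (cube_of A) i i j j = complex_of_real ((ell2_norm (A $$ (i, j)))\<^sup>2)"
proof -
  have x: "A $$ (i, j) \<in> carrier ell2" using assms by (simp add: matrices_def)
  have "(\<lambda>k. complex_of_real ((cmod ((A $$ (i, j)) k))\<^sup>2)) sums complex_of_real (\<Sum>k. (cmod ((A $$ (i, j)) k))\<^sup>2)"
    using x by (intro sums_of_real summable_sums) (simp add: ell2_carrier)
  then show ?thesis
    unfolding ell2_norm_power2[OF x] gram_def
    by (simp add: cube_of_def complex_norm_square sums_iff del: of_real_power)
qed

text \<open>The Gram form is tested on the matrix unit at (0, 0), of Hilbert-Schmidt norm 1, and on
  the identity, of norm sqrt n. The two orders of these arguments pick out the first row and the
  first column, which shows that OH does not distinguish rows from columns.\<close>

lemma OH_test_bound: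
  assumes A: "A \<in> matrices OH n" "mnorm OH A \<le> r" "0 < n"
  shows "(\<Sum>j<n. (ell2_norm (A $$ (0, j)))\<^sup>2) \<le> sqrt (real n) * r\<^sup>2"
    and "(\<Sum>i<n. (ell2_norm (A $$ (i, 0)))\<^sup>2) \<le> sqrt (real n) * r\<^sup>2"
proof -
  define e where "e = (\<lambda>i j. kdelta 0 i * kdelta 0 j)"
  have c: "A \<in> carrier_mat n n" using A by (simp add: matrices_OH)
  have op0: "0 \<le> op_norm (oh_gram A)" using op_norm_opbd[OF oh_gram_carrier[OF c]] by (simp add: opbd_def)
  have op: "op_norm (oh_gram A) \<le> r\<^sup>2" using A(2) by (simp add: sqrt_le_D)
  have fe: "fro n e = 1"
  proof -
    have "fro n e = (\<Sum>i<n. (cmod (kdelta 0 i))\<^sup>2 * nsq n (kdelta 0))"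
      by (simp add: fro_def e_def nsq_def norm_mult power_mult_distrib sum_distrib_left)
    also have "\<dots> = nsq n (kdelta 0) * nsq n (kdelta 0)"
      by (simp add: nsq_def[of n "kdelta 0"] sum_distrib_right)
    finally show ?thesis using nsq_kdelta[OF A(3)] by simp
  qed
  have bd: "cmod (gram_form n (cube_of A) w v) \<le> sqrt (real n) * r\<^sup>2" if "fro n w * fro n v = real n" for w v
  proof -
    have "cmod (gram_form n (cube_of A) w v) \<le> sqrt ((op_norm (oh_gram A))\<^sup>2 * real n)"
      using gram_form_le_op_norm[OF c, of w v] unfolding that by (rule real_le_rsqrt)
    also have "\<dots> = op_norm (oh_gram A) * sqrt (real n)" using op0 by (simp add: real_sqrt_mult)
    also have "\<dots> \<le> r\<^sup>2 * sqrt (real n)" by (intro mult_right_mono op) simp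
    finally show ?thesis by (simp add: mult.commute)
  qed
  have "gram_form n (cube_of A) e kdelta = (\<Sum>i<n. kdelta 0 i * (\<Sum>i'<n. kdelta 0 i' * (\<Sum>j<n. \<Sum>j'<n. gram (cube_of A) i i' j j' * kdelta j j')))"
    by (simp only: gram_form_def e_def sum_distrib_left mult.assoc)
  also have "\<dots> = (\<Sum>j<n. \<Sum>j'<n. gram (cube_of A) 0 0 j j' * kdelta j j')" using A(3) by simp
  also have "\<dots> = (\<Sum>j<n. gram (cube_of A) 0 0 j j)" by (intro sum.cong refl) simp
  also have "\<dots> = complex_of_real (\<Sum>j<n. (ell2_norm (A $$ (0, j)))\<^sup>2)"
    using gram_diagonal[OF A(1) A(3)] by simp
  finally have "\<bar>\<Sum>j<n. (ell2_norm (A $$ (0, j)))\<^sup>2\<bar> \<le> sqrt (real n) * r\<^sup>2"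
    using bd[of e kdelta] fe by (simp add: fro_kdelta del: of_real_sum)
  then show "(\<Sum>j<n. (ell2_norm (A $$ (0, j)))\<^sup>2) \<le> sqrt (real n) * r\<^sup>2" by simp
  have "gram_form n (cube_of A) kdelta e = (\<Sum>i<n. \<Sum>i'<n. kdelta i i' * (\<Sum>j<n. kdelta 0 j * (\<Sum>j'<n. kdelta 0 j' * gram (cube_of A) i i' j j')))"
    unfolding gram_form_def e_def sum_distrib_left by (intro sum.cong refl) (simp only: mult_ac)
  also have "\<dots> = (\<Sum>i<n. gram (cube_of A) i i 0 0)" using A(3) by simp
  also have "\<dots> = complex_of_real (\<Sum>i<n. (ell2_norm (A $$ (i, 0)))\<^sup>2)"
    using gram_diagonal[OF A(1) _ A(3)] by simp
  finally have "\<bar>\<Sum>i<n. (ell2_norm (A $$ (i, 0)))\<^sup>2\<bar> \<le> sqrt (real n) * r\<^sup>2"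
    using bd[of kdelta e] fe by (simp add: fro_kdelta del: of_real_sum)
  then show "(\<Sum>i<n. (ell2_norm (A $$ (i, 0)))\<^sup>2) \<le> sqrt (real n) * r\<^sup>2" by simp
qed

section \<open>The norms of the twisted sum\<close>

definition pairing :: "nat \<Rightarrow> (nat \<Rightarrow> complex) \<Rightarrow> cube \<Rightarrow> (nat \<Rightarrow> complex) \<Rightarrow> nat \<Rightarrow> complex" where
  "pairing n \<eta> A \<xi> k = (\<Sum>i<n. \<Sum>j<n. \<eta> i * \<xi> j * A i j k)"

text \<open>A bound for the norm in the minimal operator space structure of \<open>ell2\<close>:
  pairing both indices with unit vectors must give a vector of length at most \<open>c\<close>. As
  for columns, the truncation at \<open>K\<close> replaces convergence.\<close>

definition min_bd :: "nat \<Rightarrow> cube \<Rightarrow> real \<Rightarrow> bool" where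
  "min_bd n A c \<longleftrightarrow> (\<forall>K \<xi> \<eta>. nsq K (pairing n \<eta> A \<xi>) \<le> c\<^sup>2 * (nsq n \<eta> * nsq n \<xi>))"

definition decomposes :: "nat \<Rightarrow> nat \<Rightarrow> (int \<Rightarrow> cube) \<Rightarrow> cube \<Rightarrow> bool" where
  "decomposes n M u A \<longleftrightarrow> (\<forall>i<n. \<forall>j<n. \<forall>k. A i j (2 * k) = (\<Sum>m=-int M..int M. u m i j k) \<and>
     A i j (2 * k + 1) = (\<Sum>m=-int M..int M. of_int m * u m i j k))"

text \<open>A vector of \<open>ell2\<close> encodes the pair \<open>(w, x)\<close>: the even coordinates form \<open>x\<close> and the odd ones \<open>w\<close>.
  The factor \<open>2\<close> below makes the decomposition \<open>u 0 = x - w\<close>, \<open>u 1 = w\<close> of a single vector admissible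
  for \<open>c\<close> equal to its norm, so that the norm of \<open>ell2\<close> is recovered exactly.\<close>

definition twisted_bd :: "nat \<Rightarrow> cube \<Rightarrow> real \<Rightarrow> bool" where
  "twisted_bd n A c \<longleftrightarrow> 0 \<le> c \<and> min_bd n A c \<and>
     (\<exists>M u. supp M u \<and> J_bd n M u (2 * c) \<and> decomposes n M u A)"

section \<open>The minimal norms\<close>

lemma pairing_sandwich: "pairing n \<eta> A \<xi> k = sandwich n (\<lambda>_. \<eta>) A (\<lambda>b _. \<xi> b) 0 0 k"
  by (simp add: pairing_def sandwich_def)

lemma pairing_of_sandwich:
  "pairing p \<eta> (sandwich n \<alpha> A \<beta>) \<xi> k = pairing n (\<lambda>a. \<Sum>i<p. \<alpha> i a * \<eta> i) A (\<lambda>b. \<Sum>j<p. \<beta> b j * \<xi> j) k"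
proof -
  have "pairing p \<eta> (sandwich n \<alpha> A \<beta>) \<xi> k = (\<Sum>i<p. \<Sum>j<p. \<Sum>a<n. \<Sum>b<n. (\<alpha> i a * \<eta> i) * (\<beta> b j * \<xi> j) * A a b k)"
    unfolding pairing_def sandwich_def sum_distrib_left by (intro sum.cong refl) (simp only: mult_ac)
  also have "\<dots> = (\<Sum>a<n. \<Sum>i<p. \<Sum>j<p. \<Sum>b<n. (\<alpha> i a * \<eta> i) * (\<beta> b j * \<xi> j) * A a b k)"
    by (subst (2) sum.swap, subst sum.swap) (rule refl)
  also have "\<dots> = (\<Sum>a<n. \<Sum>b<n. \<Sum>i<p. \<Sum>j<p. (\<alpha> i a * \<eta> i) * (\<beta> b j * \<xi> j) * A a b k)"
    by (rule sum.cong[OF refl], subst (2) sum.swap, subst sum.swap) (rule refl)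
  also have "\<dots> = pairing n (\<lambda>a. \<Sum>i<p. \<alpha> i a * \<eta> i) A (\<lambda>b. \<Sum>j<p. \<beta> b j * \<xi> j) k"
    unfolding pairing_def sum_product by (simp only: sum_distrib_right)
  finally show ?thesis .
qed

lemma pairing_kdelta:
  assumes "i < n" "j < n"
  shows "pairing n (kdelta i) A (kdelta j) k = A i j k"
proof -
  have "pairing n (kdelta i) A (kdelta j) k = (\<Sum>a<n. kdelta i a * (\<Sum>b<n. kdelta j b * A a b k))"
    by (simp only: pairing_def sum_distrib_left mult.assoc)
  then show ?thesis using assms by simp
qed

lemma pairing_cong:
  "(\<And>i j k. i < n \<Longrightarrow> j < n \<Longrightarrow> A i j k = B i j k) \<Longrightarrow> pairing n \<eta> A \<xi> = pairing n \<eta> B \<xi>"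
  by (intro ext) (simp add: pairing_def)

lemma nsq_L2: "sqrt (nsq K f) = L2_set (\<lambda>k. cmod (f k)) {..<K}"
  by (simp add: nsq_def L2_set_def)

lemma nsq_triangle: "sqrt (nsq K (\<lambda>k. f k + g k)) \<le> sqrt (nsq K f) + sqrt (nsq K g)"
  unfolding nsq_L2 by (intro order_trans[OF L2_set_mono L2_set_triangle_ineq] norm_triangle_ineq) simp

lemma min_bd_sqrt:
  assumes "0 \<le> c"
  shows "min_bd n A c \<longleftrightarrow> (\<forall>K \<xi> \<eta>. sqrt (nsq K (pairing n \<eta> A \<xi>)) \<le> c * (sqrt (nsq n \<eta>) * sqrt (nsq n \<xi>)))"
proof -
  have "c * (sqrt (nsq n \<eta>) * sqrt (nsq n \<xi>)) = sqrt (c\<^sup>2 * (nsq n \<eta> * nsq n \<xi>))" for \<eta> \<xi>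
    using assms by (simp add: real_sqrt_mult)
  then show ?thesis by (simp add: min_bd_def)
qed

lemma min_bd_mono: "min_bd n A c \<Longrightarrow> 0 \<le> c \<Longrightarrow> c \<le> d \<Longrightarrow> min_bd n A d"
  unfolding min_bd_def by (meson mult_right_mono mult_nonneg_nonneg nsq_nonneg order_trans power_mono)

lemma min_bd_cong:
  assumes "\<And>i j k. i < n \<Longrightarrow> j < n \<Longrightarrow> A i j k = B i j k"
  shows "min_bd n A c \<longleftrightarrow> min_bd n B c"
  using pairing_cong[of n A B] assms by (simp add: min_bd_def)

lemma min_bd_add:
  assumes "min_bd n A c" "min_bd n B d" "0 \<le> c" "0 \<le> d"
  shows "min_bd n (\<lambda>i j k. A i j k + B i j k) (c + d)"
proof -
  have "0 \<le> c + d" using assms by simp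
  note iff = min_bd_sqrt[OF this]
  have eq: "pairing n \<eta> (\<lambda>i j k. A i j k + B i j k) \<xi> = (\<lambda>k. pairing n \<eta> A \<xi> k + pairing n \<eta> B \<xi> k)" for \<eta> \<xi>
    by (intro ext) (simp add: pairing_def distrib_left sum.distrib)
  show ?thesis
    unfolding iff eq distrib_right using assms
    by (auto simp: min_bd_sqrt intro!: order_trans[OF nsq_triangle] add_mono)
qed

lemma min_bd_scale:
  assumes "min_bd n A c"
  shows "min_bd n (\<lambda>i j k. a * A i j k) (cmod a * c)"
proof -
  have eq: "pairing n \<eta> (\<lambda>i j k. a * A i j k) \<xi> = (\<lambda>k. a * pairing n \<eta> A \<xi> k)" for \<eta> \<xi>
    by (intro ext) (simp add: pairing_def sum_distrib_left mult_ac)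
  show ?thesis
    unfolding min_bd_def eq nsq_scale power_mult_distrib mult.assoc
    using assms by (auto simp: min_bd_def intro!: mult_left_mono)
qed

lemma min_bd_sandwich:
  assumes "min_bd n A c" "opbd p n \<alpha> s" "opbd n p \<beta> t"
  shows "min_bd p (sandwich n \<alpha> A \<beta>) (s * c * t)"
  unfolding min_bd_def
proof (intro allI)
  fix K :: nat and \<xi> \<eta> :: "nat \<Rightarrow> complex"
  let ?e = "\<lambda>a. \<Sum>i<p. \<alpha> i a * \<eta> i" and ?x = "\<lambda>b. \<Sum>j<p. \<beta> b j * \<xi> j"
  have "nsq K (pairing p \<eta> (sandwich n \<alpha> A \<beta>) \<xi>) = nsq K (pairing n ?e A ?x)"
    by (simp only: pairing_of_sandwich[abs_def])
  also have "\<dots> \<le> c\<^sup>2 * (nsq n ?e * nsq n ?x)"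
    using assms(1) by (simp add: min_bd_def)
  also have "\<dots> \<le> c\<^sup>2 * ((s\<^sup>2 * nsq p \<eta>) * (t\<^sup>2 * nsq p \<xi>))"
    using opbdD[OF opbd_transpose[OF assms(2)]] opbdD[OF assms(3)]
    by (intro mult_left_mono mult_mono) simp_all
  finally show "nsq K (pairing p \<eta> (sandwich n \<alpha> A \<beta>) \<xi>) \<le> (s * c * t)\<^sup>2 * (nsq p \<eta> * nsq p \<xi>)"
    by (simp add: power_mult_distrib mult_ac)
qed

lemma pairing_block_sum:
  "pairing (m + n) \<eta> (block_sum m A B) \<xi> k =
     pairing m \<eta> A \<xi> k + pairing n (\<lambda>i. \<eta> (m + i)) B (\<lambda>j. \<xi> (m + j)) k"
  by (simp add: pairing_def sum_lessThan_add block_sum_def)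

lemma sqrt_cauchy_schwarz2:
  assumes "0 \<le> a" "0 \<le> b" "0 \<le> c" "0 \<le> d"
  shows "sqrt a * sqrt b + sqrt c * sqrt d \<le> sqrt (a + c) * sqrt (b + d)"
proof -
  have "(sqrt a * sqrt b + sqrt c * sqrt d)\<^sup>2 \<le> (a + c) * (b + d)"
    using assms sum_squares_bound[of "sqrt a * sqrt d" "sqrt b * sqrt c"]
    by (simp add: power2_sum power_mult_distrib algebra_simps)
  then have "sqrt a * sqrt b + sqrt c * sqrt d \<le> sqrt ((a + c) * (b + d))"
    by (rule real_le_rsqrt)
  then show ?thesis by (simp add: real_sqrt_mult)
qed

lemma min_bd_block_sum:
  assumes "min_bd m A c" "min_bd n B c" "0 \<le> c"
  shows "min_bd (m + n) (block_sum m A B) c"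
  unfolding min_bd_sqrt[OF assms(3)]
proof (intro allI)
  fix K :: nat and \<xi> \<eta> :: "nat \<Rightarrow> complex"
  let ?e = "\<lambda>i. \<eta> (m + i)" and ?x = "\<lambda>i. \<xi> (m + i)"
  have "sqrt (nsq K (pairing (m + n) \<eta> (block_sum m A B) \<xi>)) \<le> sqrt (nsq K (pairing m \<eta> A \<xi>)) + sqrt (nsq K (pairing n ?e B ?x))"
    unfolding pairing_block_sum[abs_def] by (rule nsq_triangle)
  also have "\<dots> \<le> c * (sqrt (nsq m \<eta>) * sqrt (nsq m \<xi>)) + c * (sqrt (nsq n ?e) * sqrt (nsq n ?x))"
    using assms by (intro add_mono) (simp_all add: min_bd_sqrt)
  also have "\<dots> = c * (sqrt (nsq m \<eta>) * sqrt (nsq m \<xi>) + sqrt (nsq n ?e) * sqrt (nsq n ?x))"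
    by (simp add: distrib_left)
  also have "\<dots> \<le> c * (sqrt (nsq (m + n) \<eta>) * sqrt (nsq (m + n) \<xi>))"
    unfolding nsq_add by (intro mult_left_mono sqrt_cauchy_schwarz2 assms(3)) simp_all
  finally show "sqrt (nsq K (pairing (m + n) \<eta> (block_sum m A B) \<xi>)) \<le> c * (sqrt (nsq (m + n) \<eta>) * sqrt (nsq (m + n) \<xi>))" .
qed

section \<open>Stability of the bounds that define the twisted sum\<close>

lemma decomposes_mono:
  assumes "decomposes n M u A" "supp M u" "M \<le> M'"
  shows "decomposes n M' u A"
proof -
  have "(\<Sum>m=-int M'..int M'. u m i j k) = (\<Sum>m=-int M..int M. u m i j k)"
    "(\<Sum>m=-int M'..int M'. of_int m * u m i j k) = (\<Sum>m=-int M..int M. of_int m * u m i j k)" for i j k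
    by (rule supp_sum[OF assms(2,3)], simp)+
  then show ?thesis using assms(1) by (simp add: decomposes_def)
qed

lemma decomposes_cong:
  assumes "decomposes n M u A" "\<And>i j k. i < n \<Longrightarrow> j < n \<Longrightarrow> A i j k = B i j k"
  shows "decomposes n M u B"
  using assms by (simp add: decomposes_def)

lemma twisted_bd_cong:
  assumes "twisted_bd n A c" "\<And>i j k. i < n \<Longrightarrow> j < n \<Longrightarrow> A i j k = B i j k"
  shows "twisted_bd n B c"
  using assms min_bd_cong[of n A B c] decomposes_cong[of n _ _ A B] unfolding twisted_bd_def by blast

lemma twisted_bd_mono: "twisted_bd n A c \<Longrightarrow> c \<le> d \<Longrightarrow> twisted_bd n A d"
proof -
  assume A: "twisted_bd n A c" and le: "c \<le> d"
  obtain M u where u: "supp M u" "J_bd n M u (2 * c)" "decomposes n M u A"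
    using A unfolding twisted_bd_def by blast
  have "J_bd n M u (2 * d)" using le by (intro J_bd_mono[OF u(2)]) simp
  then show "twisted_bd n A d"
    using A le u min_bd_mono[of n A c d] unfolding twisted_bd_def by auto
qed

lemma twisted_bd_nonneg: "twisted_bd n A c \<Longrightarrow> 0 \<le> c"
  by (simp add: twisted_bd_def)

lemma twisted_bd_common:
  assumes "twisted_bd m A c" "twisted_bd n B d"
  obtains M u v where "supp M u" "J_bd m M u (2 * c)" "decomposes m M u A"
    "supp M v" "J_bd n M v (2 * d)" "decomposes n M v B"
proof -
  obtain M u where u: "supp M u" "J_bd m M u (2 * c)" "decomposes m M u A"
    using assms(1) unfolding twisted_bd_def by blast
  obtain N v where v: "supp N v" "J_bd n N v (2 * d)" "decomposes n N v B"
    using assms(2) unfolding twisted_bd_def by blast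
  have "M \<le> max M N" "N \<le> max M N" by simp_all
  then show thesis
    using that[OF supp_mono[OF u(1)] J_bd_supp[OF u(1) _ u(2)] decomposes_mono[OF u(3,1)]
        supp_mono[OF v(1)] J_bd_supp[OF v(1) _ v(2)] decomposes_mono[OF v(3,1)]] by blast
qed

lemma twisted_bd_add:
  assumes A: "twisted_bd n A c" and B: "twisted_bd n B d"
  shows "twisted_bd n (\<lambda>i j k. A i j k + B i j k) (c + d)"
proof -
  obtain M u v where u: "supp M u" "J_bd n M u (2 * c)" "decomposes n M u A"
    and v: "supp M v" "J_bd n M v (2 * d)" "decomposes n M v B"
    using twisted_bd_common[OF A B] .
  let ?w = "\<lambda>m i j k. u m i j k + v m i j k"
  have "supp M ?w" using u(1) v(1) by (simp add: supp_def)
  moreover have "J_bd n M ?w (2 * (c + d))" using J_bd_add[OF u(2) v(2)] by (simp add: distrib_left)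
  moreover have "decomposes n M ?w (\<lambda>i j k. A i j k + B i j k)"
    using u(3) v(3) by (simp add: decomposes_def sum.distrib distrib_left)
  ultimately show ?thesis
    using A B min_bd_add[of n A c B d] unfolding twisted_bd_def by (auto intro: add_nonneg_nonneg)
qed

lemma twisted_bd_scale:
  assumes A: "twisted_bd n A c"
  shows "twisted_bd n (\<lambda>i j k. a * A i j k) (cmod a * c)"
proof -
  obtain M u where u: "supp M u" "J_bd n M u (2 * c)" "decomposes n M u A"
    using A unfolding twisted_bd_def by blast
  let ?w = "\<lambda>m i j k. a * u m i j k"
  have "supp M ?w" using u(1) by (simp add: supp_def)
  moreover have "J_bd n M ?w (2 * (cmod a * c))" using J_bd_scale[OF u(2), of a] by (simp add: mult_ac)
  moreover have "decomposes n M ?w (\<lambda>i j k. a * A i j k)"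
    using u(3) by (simp add: decomposes_def sum_distrib_left mult_ac)
  ultimately show ?thesis
    using A min_bd_scale[of n A c a] unfolding twisted_bd_def by auto
qed

lemma decomposes_sandwich:
  assumes "decomposes n M u A"
  shows "decomposes p M (\<lambda>m. sandwich n \<alpha> (u m) \<beta>) (sandwich n \<alpha> A \<beta>)"
proof -
  have lin: "sandwich n \<alpha> A \<beta> i j k' = (\<Sum>m=-int M..int M. e m * sandwich n \<alpha> (u m) \<beta> i j k)"
    if "\<And>a b. a < n \<Longrightarrow> b < n \<Longrightarrow> A a b k' = (\<Sum>m=-int M..int M. e m * u m a b k)" for e k k' i j
  proof -
    have "sandwich n \<alpha> A \<beta> i j k' = (\<Sum>a<n. \<Sum>b<n. \<Sum>m=-int M..int M. e m * (\<alpha> i a * \<beta> b j * u m a b k))"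
    proof -
      have "\<alpha> i a * \<beta> b j * A a b k' = (\<Sum>m=-int M..int M. e m * (\<alpha> i a * \<beta> b j * u m a b k))" if "a < n" "b < n" for a b
        unfolding \<open>\<And>a b. a < n \<Longrightarrow> b < n \<Longrightarrow> A a b k' = (\<Sum>m=-int M..int M. e m * u m a b k)\<close>[OF that] sum_distrib_left
        by (intro sum.cong refl) (simp only: mult_ac)
      then show ?thesis unfolding sandwich_def by (intro sum.cong refl) simp
    qed
    also have "\<dots> = (\<Sum>m=-int M..int M. \<Sum>a<n. \<Sum>b<n. e m * (\<alpha> i a * \<beta> b j * u m a b k))"
      by (simp only: sum.swap[where B="{-int M..int M}"])
    finally show ?thesis by (simp add: sandwich_def sum_distrib_left)
  qed
  show ?thesis
    using assms lin[of _ "\<lambda>_. 1"] lin[of _ of_int] unfolding decomposes_def by simp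
qed

lemma twisted_bd_sandwich:
  assumes A: "twisted_bd n A c" and op: "opbd p n \<alpha> s" "opbd n p \<beta> t"
  shows "twisted_bd p (sandwich n \<alpha> A \<beta>) (s * c * t)"
proof -
  obtain M u where u: "supp M u" "J_bd n M u (2 * c)" "decomposes n M u A"
    using A unfolding twisted_bd_def by blast
  have "J_bd p M (\<lambda>m. sandwich n \<alpha> (u m) \<beta>) (2 * (s * c * t))"
    using J_bd_sandwich[OF u(2) op] by (simp add: mult_ac)
  then show ?thesis
    using A op min_bd_sandwich[OF _ op, of A c] supp_sandwich[OF u(1), of n \<alpha> \<beta>] decomposes_sandwich[OF u(3), of p \<alpha> \<beta>]
    unfolding twisted_bd_def opbd_def by (auto intro!: mult_nonneg_nonneg)
qed

lemma twisted_bd_block_sum: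
  assumes A: "twisted_bd m A c" and B: "twisted_bd n B c"
  shows "twisted_bd (m + n) (block_sum m A B) c"
proof -
  obtain M u v where u: "supp M u" "J_bd m M u (2 * c)" "decomposes m M u A"
    and v: "supp M v" "J_bd n M v (2 * c)" "decomposes n M v B"
    using twisted_bd_common[OF A B] .
  have "decomposes (m + n) M (\<lambda>l. block_sum m (u l) (v l)) (block_sum m A B)"
    using u(3) v(3) by (auto simp: decomposes_def block_sum_def)
  then show ?thesis
    using A B min_bd_block_sum[of m A c n B] supp_block_sum[OF u(1) v(1), of m] J_bd_block_sum[OF u(2) v(2)]
    unfolding twisted_bd_def by blast
qed

text \<open>This is the minimal norm tested on basis vectors. It makes the norm definite, gives half
  of the isometry with \<open>ell2\<close>, and forces entries with a finite bound into
  \<open>ell2\<close>.\<close>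

lemma twisted_bd_entry:
  assumes "twisted_bd n A c" "i < n" "j < n"
  shows "nsq K (A i j) \<le> c\<^sup>2"
proof -
  have "nsq K (pairing n (kdelta i) A (kdelta j)) \<le> c\<^sup>2 * (nsq n (kdelta i) * nsq n (kdelta j))"
    using assms(1) by (simp add: twisted_bd_def min_bd_def)
  moreover have "pairing n (kdelta i) A (kdelta j) = A i j"
    using assms by (intro ext) (simp add: pairing_kdelta)
  ultimately show ?thesis using assms by (simp add: nsq_kdelta)
qed

section \<open>An explicit two-term decomposition\<close>

definition hs_norm2 :: "nat \<Rightarrow> cube \<Rightarrow> real" where
  "hs_norm2 n A = (\<Sum>i<n. \<Sum>j<n. \<Sum>k. (cmod (A i j k))\<^sup>2)"

lemma nsq_le_suminf:
  "summable (\<lambda>k. (cmod (f k))\<^sup>2) \<Longrightarrow> nsq K f \<le> (\<Sum>k. (cmod (f k))\<^sup>2)"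
  unfolding nsq_def by (rule sum_le_suminf) simp_all

lemma sum_double: "(\<Sum>k<2 * K. f k) = (\<Sum>k<K. f (2 * k) + f (2 * k + 1))" for f :: "nat \<Rightarrow> 'a::comm_monoid_add"
  by (induction K) (simp_all add: add.assoc)

lemma interval_unit: "{-int 1..int 1} = {-1, 0, 1}"
  by auto

text \<open>It serves twice: matrices over \<open>ell2\<close> have some finite bound, so the
  infimum defining their norm is over a nonempty set; and at size one the bound is the norm of
  \<open>ell2\<close> itself.\<close>

lemma twisted_bd_hs_norm:
  assumes A: "square_summable n A"
  shows "twisted_bd n A (sqrt (hs_norm2 n A))"
proof -
  have nonneg: "0 \<le> hs_norm2 n A"
    unfolding hs_norm2_def using A by (intro sum_nonneg suminf_nonneg) (simp_all add: square_summable_def)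
  define u where "u = (\<lambda>m::int. \<lambda>i j k. if m = 0 then A i j (2 * k) - A i j (2 * k + 1) else if m = 1 then A i j (2 * k + 1) else 0)"
  have part: "(\<Sum>k<K. \<Sum>i<n. nsq n (\<lambda>j. A i j k)) \<le> hs_norm2 n A" for K
  proof -
    have "(\<Sum>k<K. \<Sum>i<n. nsq n (\<lambda>j. A i j k)) = (\<Sum>i<n. \<Sum>j<n. nsq K (A i j))"
      unfolding nsq_def by (subst sum.swap, rule sum.cong[OF refl], rule sum.swap)
    also have "\<dots> \<le> hs_norm2 n A"
      unfolding hs_norm2_def using A by (intro sum_mono nsq_le_suminf) (simp add: square_summable_def)
    finally show ?thesis .
  qed
  have "min_bd n A (sqrt (hs_norm2 n A))"
    unfolding min_bd_def
  proof (intro allI)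
    fix K :: nat and \<xi> \<eta> :: "nat \<Rightarrow> complex"
    have "nsq K (pairing n \<eta> A \<xi>) \<le> (\<Sum>k<K. (\<Sum>i<n. nsq n (\<lambda>j. A i j k)) * (nsq n \<eta> * nsq n \<xi>))"
      unfolding nsq_def[of K]
    proof (rule sum_mono)
      fix k
      have "pairing n \<eta> A \<xi> k = (\<Sum>i<n. \<eta> i * (\<Sum>j<n. A i j k * \<xi> j))"
        unfolding pairing_def sum_distrib_left by (intro sum.cong refl) (simp only: mult_ac)
      then have "(cmod (pairing n \<eta> A \<xi> k))\<^sup>2 \<le> nsq n \<eta> * nsq n (\<lambda>i. \<Sum>j<n. A i j k * \<xi> j)"
        using cauchy_schwarz_complex by simp
      also have "\<dots> \<le> nsq n \<eta> * ((\<Sum>i<n. nsq n (\<lambda>j. A i j k)) * nsq n \<xi>)"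
        by (intro mult_left_mono nsq_matrix_bound) simp
      finally show "(cmod (pairing n \<eta> A \<xi> k))\<^sup>2 \<le> (\<Sum>i<n. nsq n (\<lambda>j. A i j k)) * (nsq n \<eta> * nsq n \<xi>)"
        by (simp only: mult_ac)
    qed
    also have "\<dots> \<le> hs_norm2 n A * (nsq n \<eta> * nsq n \<xi>)"
      unfolding sum_distrib_right[symmetric] by (intro mult_right_mono part) simp
    finally show "nsq K (pairing n \<eta> A \<xi>) \<le> (sqrt (hs_norm2 n A))\<^sup>2 * (nsq n \<eta> * nsq n \<xi>)"
      using nonneg by simp
  qed
  moreover have "supp 1 u" by (auto simp: supp_def u_def fun_eq_iff)
  moreover have "decomposes n 1 u A"
    unfolding decomposes_def interval_unit by (simp add: u_def)
  moreover have "J_bd n 1 u (2 * sqrt (hs_norm2 n A))"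
  proof -
    define S where "S = (\<lambda>(v :: cube) (K :: nat). \<Sum>k<K. \<Sum>i<n. nsq n (\<lambda>j. v i j k))"
    have colq: "colq n K v \<xi> \<le> S v K * nsq n \<xi>" for v :: cube and K \<xi>
      unfolding colq_def S_def sum_distrib_right[of _ "{..<K}"] by (intro sum_mono nsq_matrix_bound)
    have S0: "0 \<le> S v K" for v :: cube and K by (simp add: S_def sum_nonneg)
    have transp: "S (\<lambda>i j. v j i) K = S v K" for v :: cube and K
      unfolding S_def nsq_def by (rule sum.cong[OF refl], rule sum.swap)
    \<comment> \<open>The weights 1 and 2 are \<open>2 powi m\<close> at m = 0 and m = 1. In the
      flipped family the second weight drops to 1/2, so the same inequality covers the rows.\<close>
    have tot: "S (u 0) K + 2 * S (u 1) K \<le> 4 * hs_norm2 n A" for K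
    proof -
      have "S (u 0) K + 2 * S (u 1) K = (\<Sum>k<K. \<Sum>i<n. \<Sum>j<n. (cmod (u 0 i j k))\<^sup>2 + 2 * (cmod (u 1 i j k))\<^sup>2)"
        by (simp add: S_def nsq_def sum.distrib sum_distrib_left)
      also have "\<dots> \<le> (\<Sum>k<K. \<Sum>i<n. \<Sum>j<n. 4 * ((cmod (A i j (2 * k)))\<^sup>2 + (cmod (A i j (2 * k + 1)))\<^sup>2))"
      proof (intro sum_mono)
        fix k i j
        have "(cmod (x - w))\<^sup>2 + 2 * (cmod w)\<^sup>2 \<le> 4 * ((cmod x)\<^sup>2 + (cmod w)\<^sup>2)" for x w :: complex
        proof -
          have "(cmod (x - w))\<^sup>2 \<le> (cmod x + cmod w)\<^sup>2" by (intro power_mono norm_triangle_ineq4) simp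
          also have "\<dots> \<le> 2 * (cmod x)\<^sup>2 + 2 * (cmod w)\<^sup>2"
            using sum_squares_bound[of "cmod x" "cmod w"] by (simp add: power2_sum)
          finally have "(cmod (x - w))\<^sup>2 \<le> 2 * (cmod x)\<^sup>2 + 2 * (cmod w)\<^sup>2" .
          then show ?thesis using zero_le_power2[of "cmod x"] unfolding distrib_left by linarith
        qed
        then show "(cmod (u 0 i j k))\<^sup>2 + 2 * (cmod (u 1 i j k))\<^sup>2 \<le> 4 * ((cmod (A i j (2 * k)))\<^sup>2 + (cmod (A i j (2 * k + 1)))\<^sup>2)"
          by (simp add: u_def)
      qed
      also have "\<dots> = 4 * (\<Sum>k<K. (\<Sum>i<n. nsq n (\<lambda>j. A i j (2 * k))) + (\<Sum>i<n. nsq n (\<lambda>j. A i j (2 * k + 1))))"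
        by (simp only: nsq_def sum.distrib sum_distrib_left[symmetric])
      also have "\<dots> = 4 * (\<Sum>k<2 * K. \<Sum>i<n. nsq n (\<lambda>j. A i j k))"
        by (simp only: sum_double)
      also have "\<dots> \<le> 4 * hs_norm2 n A" by (intro mult_left_mono part) simp
      finally show ?thesis .
    qed
    have flip_u: "flip u 0 = (\<lambda>i j. u 0 j i)" "flip u (-1) = (\<lambda>i j. u 1 j i)" "flip u 1 = (\<lambda>_ _ _. 0)"
      by (simp_all add: flip_def u_def fun_eq_iff)
    have sum3: "(\<Sum>m\<in>{-1, 0, 1}. f m) = f (-1) + f 0 + f 1" for f :: "int \<Rightarrow> real" by simp
    have um: "u (-1) = (\<lambda>_ _ _. 0)" by (simp add: u_def fun_eq_iff)
    have fin: "(2 * sqrt (hs_norm2 n A))\<^sup>2 = 4 * hs_norm2 n A" using nonneg by (simp add: power_mult_distrib)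
    have "col_bd n 1 u (2 * sqrt (hs_norm2 n A))"
      unfolding col_bd_def interval_unit fin
    proof (intro allI)
      fix K :: nat and \<xi> :: "nat \<Rightarrow> complex"
      have "(\<Sum>m\<in>{-1, 0, 1}. 2 powi m * colq n K (u m) \<xi>) = colq n K (u 0) \<xi> + 2 * colq n K (u 1) \<xi>"
        unfolding sum3 by (simp add: arg_cong[OF um, of "\<lambda>v. colq n K v \<xi>"])
      also have "\<dots> \<le> S (u 0) K * nsq n \<xi> + 2 * (S (u 1) K * nsq n \<xi>)"
        by (intro add_mono mult_left_mono colq) simp
      also have "\<dots> = (S (u 0) K + 2 * S (u 1) K) * nsq n \<xi>" by (simp add: distrib_right)
      also have "\<dots> \<le> 4 * hs_norm2 n A * nsq n \<xi>" by (intro mult_right_mono tot) simp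
      finally show "(\<Sum>m\<in>{-1, 0, 1}. 2 powi m * colq n K (u m) \<xi>) \<le> 4 * hs_norm2 n A * nsq n \<xi>" .
    qed
    moreover have "col_bd n 1 (flip u) (2 * sqrt (hs_norm2 n A))"
      unfolding col_bd_def interval_unit fin
    proof (intro allI)
      fix K :: nat and \<xi> :: "nat \<Rightarrow> complex"
      have "(\<Sum>m\<in>{-1, 0, 1}. 2 powi m * colq n K (flip u m) \<xi>) = colq n K (flip u 0) \<xi> + 1/2 * colq n K (flip u (-1)) \<xi>"
        unfolding sum3 by (simp add: arg_cong[OF flip_u(3), of "\<lambda>v. colq n K v \<xi>"] power_int_minus)
      also have "\<dots> \<le> S (flip u 0) K * nsq n \<xi> + 1/2 * (S (flip u (-1)) K * nsq n \<xi>)"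
        by (intro add_mono mult_left_mono colq) simp
      also have "\<dots> = (S (u 0) K + 1/2 * S (u 1) K) * nsq n \<xi>"
        unfolding flip_u transp[of "u 0"] transp[of "u 1"] by (simp add: distrib_right)
      also have "\<dots> \<le> 4 * hs_norm2 n A * nsq n \<xi>"
        using tot[of K] S0[of "u 1" K] by (intro mult_right_mono) auto
      finally show "(\<Sum>m\<in>{-1, 0, 1}. 2 powi m * colq n K (flip u m) \<xi>) \<le> 4 * hs_norm2 n A * nsq n \<xi>" .
    qed
    ultimately show ?thesis using nonneg by (simp add: J_bd_def)
  qed
  ultimately show ?thesis using nonneg unfolding twisted_bd_def by auto
qed

section \<open>Domination of the minimal norm by the J-norm\<close>

text \<open>The first summand is the constant of \<open>min_bd_of_J_bd\<close>. Adding 1 makes the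
  constant at least 1, so that enlarging \<open>c\<close> by it also preserves the J-bound.\<close>

definition equiv_const :: real where
  "equiv_const = 2 * sqrt gauge_const + 1"

lemma equiv_const_ge_1: "1 \<le> equiv_const"
  by (simp add: equiv_const_def gauge_const_nonneg)

text \<open>Pairing with \<eta> and \<xi> compresses the family to size one. There columns and rows
  coincide, so both weights are available at once, and sum_m (2^m + 2^(-m)) |v_m|^2 controls the two
  sums over \<open>v m\<close> and \<open>m * v m\<close>.\<close>

lemma min_bd_of_J_bd:
  assumes J: "J_bd n M u c" and dec: "decomposes n M u A"
  shows "min_bd n A (2 * sqrt gauge_const * c)"
  unfolding min_bd_def
proof (intro allI)
  fix K :: nat and \<xi> \<eta> :: "nat \<Rightarrow> complex"
  let ?I = "{-int M..int M}"
  define v where "v = (\<lambda>m. sandwich n (\<lambda>_. \<eta>) (u m) (\<lambda>b _. \<xi> b))"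
  define d where "d = sqrt (nsq n \<eta>) * c * sqrt (nsq n \<xi>)"
  have op: "opbd 1 n (\<lambda>_. \<zeta>) (sqrt (nsq n \<zeta>))" for \<zeta>
    using cauchy_schwarz_complex[of \<zeta> _ n] by (simp add: opbd_def nsq_def[of "Suc 0"])
  have Jv: "J_bd 1 M v d"
    unfolding v_def d_def by (rule J_bd_sandwich[OF J op opbd_transpose[OF op]])
  have "decomposes 1 M v (sandwich n (\<lambda>_. \<eta>) A (\<lambda>b _. \<xi> b))"
    unfolding v_def by (rule decomposes_sandwich[OF dec])
  then have even: "pairing n \<eta> A \<xi> (2 * k) = (\<Sum>m\<in>?I. 1 * v m 0 0 k)"
    and odd: "pairing n \<eta> A \<xi> (2 * k + 1) = (\<Sum>m\<in>?I. of_int m * v m 0 0 k)" for k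
    by (simp_all add: decomposes_def pairing_sandwich)
  let ?w = "\<lambda>k. \<Sum>m\<in>?I. (2 powi m * 1\<^sup>2 + 2 powi (- m) * 1\<^sup>2) * (cmod (v m 0 0 k))\<^sup>2"
  \<comment> \<open>The pointwise estimate with s = t = 1 and \<open>m0\<close> = 0 admits both
    coefficient sequences, the constant 1 and \<open>m\<close>.\<close>
  have pt: "1 * 1 * (cmod (\<Sum>m\<in>?I. e m * v m 0 0 k))\<^sup>2 \<le> gauge_const * ?w k"
    if "\<And>m. cmod (e m) \<le> 1 + real_of_int \<bar>m - 0\<bar>" for e k
    by (rule bracketed_pointwise[OF _ _ _ _ that]) simp_all
  have w: "(\<Sum>k<K. ?w k) \<le> 2 * d\<^sup>2"
  proof -
    have "(\<Sum>k<K. ?w k) = (\<Sum>m\<in>?I. 2 powi m * (\<Sum>k<K. (cmod (v m 0 0 k))\<^sup>2)) + (\<Sum>m\<in>?I. 2 powi (- m) * (\<Sum>k<K. (cmod (v m 0 0 k))\<^sup>2))"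
      by (subst sum.swap) (simp add: distrib_right sum.distrib sum_distrib_left)
    also have "(\<Sum>m\<in>?I. 2 powi (- m) * (\<Sum>k<K. (cmod (v m 0 0 k))\<^sup>2)) = (\<Sum>m\<in>?I. 2 powi m * (\<Sum>k<K. (cmod (flip v m 0 0 k))\<^sup>2))"
      using sum_int_uminus[of "\<lambda>m. 2 powi m * (\<Sum>k<K. (cmod (flip v m 0 0 k))\<^sup>2)" M] by (simp add: flip_def)
    also have "(\<Sum>m\<in>?I. 2 powi m * (\<Sum>k<K. (cmod (v m 0 0 k))\<^sup>2)) + \<dots> \<le> d\<^sup>2 + d\<^sup>2"
      using col_bd_basis[of 1 M v d 0 K] col_bd_basis[of 1 M "flip v" d 0 K] Jv
      by (intro add_mono) (simp_all add: J_bd_def)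
    finally show ?thesis by simp
  qed
  have "nsq K (pairing n \<eta> A \<xi>) \<le> nsq (2 * K) (pairing n \<eta> A \<xi>)"
    unfolding nsq_def by (rule sum_mono2) auto
  also have "\<dots> = (\<Sum>k<K. (cmod (pairing n \<eta> A \<xi> (2 * k)))\<^sup>2 + (cmod (pairing n \<eta> A \<xi> (2 * k + 1)))\<^sup>2)"
    by (simp only: nsq_def sum_double)
  also have "\<dots> \<le> (\<Sum>k<K. gauge_const * ?w k + gauge_const * ?w k)"
    unfolding even odd using pt[of "\<lambda>_. 1"] pt[of of_int] by (intro sum_mono add_mono) simp_all
  also have "\<dots> = 2 * gauge_const * (\<Sum>k<K. ?w k)" by (simp only: sum.distrib sum_distrib_left[symmetric])
  also have "\<dots> \<le> 2 * gauge_const * (2 * d\<^sup>2)"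
    by (intro mult_left_mono w) (simp add: gauge_const_nonneg)
  also have "\<dots> = (2 * sqrt gauge_const * c)\<^sup>2 * (nsq n \<eta> * nsq n \<xi>)"
    by (simp add: d_def power_mult_distrib gauge_const_nonneg)
  finally show "nsq K (pairing n \<eta> A \<xi>) \<le> (2 * sqrt gauge_const * c)\<^sup>2 * (nsq n \<eta> * nsq n \<xi>)" .
qed

lemma twisted_bd_of_J_bd:
  assumes "supp M u" "J_bd n M u c" "decomposes n M u A"
  shows "twisted_bd n A (equiv_const * c)"
proof -
  have c: "0 \<le> c" using assms(2) by (simp add: J_bd_def)
  have "min_bd n A (equiv_const * c)"
    by (rule min_bd_mono[OF min_bd_of_J_bd[OF assms(2,3)]])
      (simp_all add: c gauge_const_nonneg equiv_const_def mult_right_mono)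
  moreover have "c \<le> 2 * (equiv_const * c)"
    using mult_right_mono[OF equiv_const_ge_1 c] c by linarith
  then have "J_bd n M u (2 * (equiv_const * c))" by (rule J_bd_mono[OF assms(2)])
  ultimately show ?thesis
    using assms c equiv_const_ge_1 unfolding twisted_bd_def by (auto intro!: mult_nonneg_nonneg)
qed

text \<open>A shift by one multiplies the column weights by 2 and the row weights by 1/2, so the
  squared bounds grow at most by 2, within the factor 4 allowed here.\<close>

lemma J_bd_shift:
  assumes "J_bd n M v c"  "supp M v"
  shows "J_bd n (Suc M) (\<lambda>m. v (m - 1)) (2 * c)" "supp (Suc M) (\<lambda>m. v (m - 1))"
proof -
  show "supp (Suc M) (\<lambda>m. v (m - 1))" using assms(2) by (auto simp: supp_def)
  have c: "0 \<le> c" using assms by (simp add: J_bd_def)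
  let ?I = "{-int (Suc M)..int (Suc M)}"
  have shift: "(\<Sum>m\<in>?I. f (m + d)) = (\<Sum>m=-int M..int M. f m)"
    if d: "\<bar>d\<bar> = 1" and f: "\<And>m. int M < \<bar>m\<bar> \<Longrightarrow> f m = 0" for f :: "int \<Rightarrow> real" and d
  proof -
    have "inj_on (\<lambda>m. m + d) ?I" by (simp add: inj_on_def)
    then have "(\<Sum>m\<in>?I. f (m + d)) = (\<Sum>m\<in>(\<lambda>m. m + d) ` ?I. f m)"
      by (simp only: sum.reindex o_def)
    also have "\<dots> = (\<Sum>m=-int M..int M. f m)"
    proof (rule sum.mono_neutral_right)
      show "{-int M..int M} \<subseteq> (\<lambda>m. m + d) ` ?I"
      proof
        fix m assume "m \<in> {-int M..int M}"
        then have "m - d \<in> ?I" using d by auto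
        then show "m \<in> (\<lambda>m. m + d) ` ?I" by (metis diff_add_cancel imageI)
      qed
      show "\<forall>i\<in>(\<lambda>m. m + d) ` ?I - {-int M..int M}. f i = 0"
        using f by auto
    qed simp
    finally show ?thesis .
  qed
  have z: "colq n K (v m) \<xi> = 0" "colq n K (flip v m) \<xi> = 0" if "int M < \<bar>m\<bar>" for m K \<xi>
  proof -
    have "v m = (\<lambda>_ _ _. 0)" "flip v m = (\<lambda>_ _ _. 0)"
      using that assms(2) supp_flip[of M v] unfolding supp_def by blast+
    then show "colq n K (v m) \<xi> = 0" "colq n K (flip v m) \<xi> = 0" by (simp_all only: colq_zero)
  qed
  have "col_bd n (Suc M) (\<lambda>m. v (m - 1)) (2 * c)"
    unfolding col_bd_def
  proof (intro allI)
    fix K :: nat and \<xi> :: "nat \<Rightarrow> complex"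
    have "(\<Sum>m\<in>?I. 2 powi m * colq n K (v (m - 1)) \<xi>) = (\<Sum>m\<in>?I. 2 * (2 powi (m + - 1) * colq n K (v (m + - 1)) \<xi>))"
      by (intro sum.cong refl) (simp add: power_int_diff)
    also have "\<dots> = 2 * (\<Sum>m=-int M..int M. 2 powi m * colq n K (v m) \<xi>)"
      unfolding sum_distrib_left[symmetric] by (subst shift) (simp_all add: z)
    also have "\<dots> \<le> 2 * (c\<^sup>2 * nsq n \<xi>)"
      using assms by (intro mult_left_mono) (simp_all add: J_bd_def col_bd_def)
    also have "\<dots> \<le> (2 * c)\<^sup>2 * nsq n \<xi>" by (simp add: power_mult_distrib mult_right_mono)
    finally show "(\<Sum>m\<in>?I. 2 powi m * colq n K (v (m - 1)) \<xi>) \<le> (2 * c)\<^sup>2 * nsq n \<xi>" .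
  qed
  moreover have "col_bd n (Suc M) (flip (\<lambda>m. v (m - 1))) (2 * c)"
    unfolding col_bd_def
  proof (intro allI)
    fix K :: nat and \<xi> :: "nat \<Rightarrow> complex"
    have fl: "flip (\<lambda>m. v (m - 1)) m = flip v (m + 1)" for m
    proof -
      have "- m - 1 = - (m + 1)" by simp
      then show ?thesis by (intro ext) (simp only: flip_def)
    qed
    have "(\<Sum>m\<in>?I. 2 powi m * colq n K (flip (\<lambda>m. v (m - 1)) m) \<xi>) = (\<Sum>m\<in>?I. 1/2 * (2 powi (m + 1) * colq n K (flip v (m + 1)) \<xi>))"
      by (intro sum.cong refl) (simp add: fl power_int_add)
    also have "\<dots> = 1/2 * (\<Sum>m=-int M..int M. 2 powi m * colq n K (flip v m) \<xi>)"
      unfolding sum_distrib_left[symmetric] by (subst shift) (simp_all add: z)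
    also have "\<dots> \<le> 1/2 * (c\<^sup>2 * nsq n \<xi>)"
      using assms by (intro mult_left_mono) (simp_all add: J_bd_def col_bd_def)
    also have "\<dots> \<le> (2 * c)\<^sup>2 * nsq n \<xi>" by (simp add: power_mult_distrib mult_right_mono)
    finally show "(\<Sum>m\<in>?I. 2 powi m * colq n K (flip (\<lambda>m. v (m - 1)) m) \<xi>) \<le> (2 * c)\<^sup>2 * nsq n \<xi>" .
  qed
  ultimately show "J_bd n (Suc M) (\<lambda>m. v (m - 1)) (2 * c)" using c by (simp add: J_bd_def)
qed

text \<open>Summation by parts: if \<open>\<Sum>m. v m = w\<close> then \<open>u m = v (m - 1) - v m\<close> satisfies
  \<open>\<Sum>m. u m = 0\<close> and \<open>\<Sum>m. m * u m = w\<close>.\<close>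

lemma J_bd_difference:
  assumes "J_bd n M v c" "supp M v"
  shows "\<exists>u. supp (Suc M) u \<and> J_bd n (Suc M) u (3 * c) \<and>
    (\<forall>i j k. (\<Sum>m=-int (Suc M)..int (Suc M). u m i j k) = 0 \<and>
      (\<Sum>m=-int (Suc M)..int (Suc M). of_int m * u m i j k) = (\<Sum>m=-int M..int M. v m i j k))"
proof -
  let ?I = "{-int (Suc M)..int (Suc M)}"
  define u where "u = (\<lambda>m i j k. v (m - 1) i j k + (-1) * v m i j k)"
  have "J_bd n (Suc M) u (2 * c + cmod (-1) * c)"
    unfolding u_def by (intro J_bd_add J_bd_shift[OF assms] J_bd_scale J_bd_supp[OF assms(2) _ assms(1)]) simp
  then have "J_bd n (Suc M) u (3 * c)" by simp
  moreover have "supp (Suc M) u"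
    using assms(2) by (auto simp: u_def supp_def)
  moreover have "(\<Sum>m\<in>?I. u m i j k) = 0 \<and> (\<Sum>m\<in>?I. of_int m * u m i j k) = (\<Sum>m=-int M..int M. v m i j k)" for i j k
  proof -
    have v0: "v m i j k = 0" if "int M < \<bar>m\<bar>" for m using assms(2) that by (simp add: supp_def)
    have shift: "(\<Sum>m\<in>?I. f (m - 1) * v (m - 1) i j k) = (\<Sum>m=-int M..int M. f m * v m i j k)" for f :: "int \<Rightarrow> complex"
    proof -
      have "inj_on (\<lambda>m. m - 1) ?I" by (simp add: inj_on_def)
      then have "(\<Sum>m\<in>?I. f (m - 1) * v (m - 1) i j k) = (\<Sum>m\<in>(\<lambda>m. m - 1) ` ?I. f m * v m i j k)"
        by (simp only: sum.reindex o_def)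
      also have "\<dots> = (\<Sum>m=-int M..int M. f m * v m i j k)"
      proof (rule sum.mono_neutral_right)
        show "{-int M..int M} \<subseteq> (\<lambda>m. m - 1) ` ?I"
        proof
          fix m assume "m \<in> {-int M..int M}"
          then have "m + 1 \<in> ?I" by auto
          then show "m \<in> (\<lambda>m. m - 1) ` ?I" by (metis add_diff_cancel_right' imageI)
        qed
        show "\<forall>i'\<in>(\<lambda>m. m - 1) ` ?I - {-int M..int M}. f i' * v i' i j k = 0"
          using v0 by auto
      qed simp
      finally show ?thesis .
    qed
    have same: "(\<Sum>m\<in>?I. f m * v m i j k) = (\<Sum>m=-int M..int M. f m * v m i j k)" for f :: "int \<Rightarrow> complex"
      by (rule supp_sum[OF assms(2)]) simp_all
    have "(\<Sum>m\<in>?I. u m i j k) = 0"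
      using shift[of "\<lambda>_. 1"] same[of "\<lambda>_. 1"] by (simp add: u_def sum_subtractf)
    moreover have "(\<Sum>m\<in>?I. of_int m * u m i j k) = (\<Sum>m=-int M..int M. v m i j k)"
    proof -
      \<comment> \<open>With m = (m - 1) + 1 in the shifted sum the parts weighted by the index
        cancel, and one copy of the sum of \<open>v\<close> remains.\<close>
      have "(\<Sum>m\<in>?I. of_int m * u m i j k) = (\<Sum>m\<in>?I. of_int ((m - 1) + 1) * v (m - 1) i j k) - (\<Sum>m\<in>?I. of_int m * v m i j k)"
        by (simp add: u_def sum_subtractf right_diff_distrib)
      also have "\<dots> = (\<Sum>m=-int M..int M. of_int (m + 1) * v m i j k) - (\<Sum>m=-int M..int M. of_int m * v m i j k)"
        using shift[of "\<lambda>m. of_int (m + 1)"] same[of of_int] by simp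
      also have "\<dots> = (\<Sum>m=-int M..int M. v m i j k)"
        by (simp add: sum_subtractf[symmetric] left_diff_distrib[symmetric])
      finally show ?thesis .
    qed
    ultimately show ?thesis ..
  qed
  ultimately show ?thesis by blast
qed

section \<open>The twisted sum as an operator space\<close>

definition twisted_norm :: "(nat \<Rightarrow> complex) mat \<Rightarrow> real" where
  "twisted_norm A = Inf {c. twisted_bd (dim_row A) (cube_of A) c}"

definition twisted :: "(nat \<Rightarrow> complex) opspace" where
  "twisted = module.extend ell2 (opspace.fields twisted_norm)"

lemma twisted_simps [simp]:
  "carrier twisted = carrier ell2" "x \<oplus>\<^bsub>twisted\<^esub> y = (\<lambda>k. x k + y k)" "\<zero>\<^bsub>twisted\<^esub> = (\<lambda>_. 0)"
  "c \<odot>\<^bsub>twisted\<^esub> x = (\<lambda>k. c * x k)" "mnorm twisted A = twisted_norm A"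
  by (simp_all add: twisted_def module.defs opspace.defs ell2_def)

section \<open>The vector space structure of \<open>ell2\<close> and of the twisted sum\<close>

lemma ell2_iff_bounded: "x \<in> carrier ell2 \<longleftrightarrow> (\<exists>B. \<forall>K. nsq K x \<le> B)"
proof
  assume "x \<in> carrier ell2"
  then have "\<forall>K. nsq K x \<le> (\<Sum>k. (cmod (x k))\<^sup>2)" by (simp add: ell2_carrier nsq_le_suminf)
  then show "\<exists>B. \<forall>K. nsq K x \<le> B" by blast
next
  assume "\<exists>B. \<forall>K. nsq K x \<le> B"
  then show "x \<in> carrier ell2"
    unfolding ell2_carrier nsq_def by (auto intro: summableI_nonneg_bounded)
qed

lemma nsq_add_le: "nsq K (\<lambda>k. x k + y k) \<le> 2 * nsq K x + 2 * nsq K y"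
proof -
  have "(cmod (a + b))\<^sup>2 \<le> 2 * (cmod a)\<^sup>2 + 2 * (cmod b)\<^sup>2" for a b
  proof -
    have "(cmod (a + b))\<^sup>2 \<le> (cmod a + cmod b)\<^sup>2" by (intro power_mono norm_triangle_ineq) simp
    then show ?thesis using sum_squares_bound[of "cmod a" "cmod b"] by (simp add: power2_sum)
  qed
  then show ?thesis
    unfolding nsq_def sum_distrib_left sum.distrib[symmetric] by (intro sum_mono)
qed

lemma ell2_add:
  assumes "x \<in> carrier ell2" "y \<in> carrier ell2"
  shows "(\<lambda>k. x k + y k) \<in> carrier ell2"
proof -
  obtain B C where "\<And>K. nsq K x \<le> B" "\<And>K. nsq K y \<le> C" using assms unfolding ell2_iff_bounded by blast
  then have "nsq K (\<lambda>k. x k + y k) \<le> 2 * B + 2 * C" for K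
    by (intro order_trans[OF nsq_add_le] add_mono) simp_all
  then show ?thesis unfolding ell2_iff_bounded by blast
qed

lemma ell2_scale: "x \<in> carrier ell2 \<Longrightarrow> (\<lambda>k. c * x k) \<in> carrier ell2"
  by (simp add: ell2_carrier norm_mult power_mult_distrib summable_mult)

lemma ell2_zero: "(\<lambda>_. 0) \<in> carrier ell2"
  by (simp add: ell2_carrier)

lemma ell2_diff:
  assumes "x \<in> carrier ell2" "y \<in> carrier ell2"
  shows "(\<lambda>k. x k - y k) \<in> carrier ell2"
  using ell2_add[OF assms(1) ell2_scale[OF assms(2), of "-1"]] by simp

lemma cring_complex_ring: "cring complex_ring"
  by (rule cringI) (auto simp: complex_ring_def algebra_simps
      intro!: abelian_groupI comm_monoidI exI[of _ "- x" for x])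

lemma module_twisted: "module complex_ring twisted"
proof (rule moduleI[OF cring_complex_ring])
  show "abelian_group twisted"
  proof (rule abelian_groupI)
    fix x assume "x \<in> carrier twisted"
    then show "\<exists>y\<in>carrier twisted. y \<oplus>\<^bsub>twisted\<^esub> x = \<zero>\<^bsub>twisted\<^esub>"
      using ell2_scale[of x "-1"] by (intro bexI[of _ "\<lambda>k. -1 * x k"]) simp_all
  qed (simp_all add: ell2_add ell2_zero algebra_simps)
qed (simp_all add: ell2_scale complex_ring_def algebra_simps)

interpretation twisted: module complex_ring twisted
  by (rule module_twisted)

lemma finsum_twisted:
  assumes "finite S" "\<And>a. a \<in> S \<Longrightarrow> f a \<in> carrier ell2"
  shows "finsum twisted f S = (\<lambda>k. \<Sum>a\<in>S. f a k)"
  using assms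
proof (induction S)
  case empty
  then show ?case by simp
next
  case (insert a S)
  then have "f \<in> S \<rightarrow> carrier twisted" "f a \<in> carrier twisted" by auto
  then show ?case using insert by (simp add: twisted.M.finsum_insert)
qed

lemma twisted_uminus:
  assumes "y \<in> carrier ell2"
  shows "\<ominus>\<^bsub>twisted\<^esub> y = (\<lambda>k. - y k)"
  using assms ell2_scale[OF assms, of "-1"] by (intro twisted.M.minus_equality) simp_all

lemma twisted_minus:
  assumes "y \<in> carrier ell2"
  shows "x \<ominus>\<^bsub>twisted\<^esub> y = (\<lambda>k. x k - y k)"
  using twisted_uminus[OF assms] by (simp add: a_minus_def)

lemma matrices_twisted:
  "A \<in> matrices twisted n \<longleftrightarrow> A \<in> carrier_mat n n \<and> square_summable n (cube_of A)"
  by (auto simp: matrices_def square_summable_def cube_of_def ell2_carrier)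

section \<open>Ruan's axioms for the infimum of the admissible bounds\<close>

lemma twisted_norm_bdd: "bdd_below {c. twisted_bd n A c}"
  using twisted_bd_nonneg by (intro bdd_belowI[of _ 0]) auto

lemma twisted_norm_le: "dim_row A = n \<Longrightarrow> twisted_bd n (cube_of A) c \<Longrightarrow> twisted_norm A \<le> c"
  unfolding twisted_norm_def by (auto intro!: cInf_lower twisted_norm_bdd)

text \<open>Admissible bounds are upward closed, so every number above the infimum is one. The
  axioms are proved with such numbers and an arbitrarily small excess.\<close>

lemma twisted_norm_less:
  assumes "A \<in> matrices twisted n" "twisted_norm A < c"
  shows "twisted_bd n (cube_of A) c"
proof -
  have A: "dim_row A = n" "square_summable n (cube_of A)" using assms(1) by (auto simp: matrices_twisted)
  have "\<exists>d\<in>{c. twisted_bd n (cube_of A) c}. d < c"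
    using assms(2) twisted_bd_hs_norm[OF A(2)] unfolding twisted_norm_def A(1)
    by (intro cInf_lessD) auto
  then show ?thesis using twisted_bd_mono[of n "cube_of A" _ c] by auto
qed

lemma twisted_norm_nonneg:
  assumes "A \<in> matrices twisted n"
  shows "0 \<le> twisted_norm A"
proof -
  have A: "dim_row A = n" "square_summable n (cube_of A)" using assms by (auto simp: matrices_twisted)
  show ?thesis
    using twisted_bd_hs_norm[OF A(2)] twisted_bd_nonneg unfolding twisted_norm_def A(1)
    by (intro cInf_greatest) auto
qed

lemma twisted_norm_eq_0:
  assumes "A \<in> matrices twisted n" "twisted_norm A = 0"
  shows "A = mat_zero twisted n n"
proof -
  have "(cube_of A) i j k = 0" if ij: "i < n" "j < n" for i j k
  proof -
    have "(cmod (cube_of A i j k))\<^sup>2 \<le> 0"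
    proof (rule field_le_epsilon)
      fix e :: real assume e: "0 < e"
      then have "twisted_bd n (cube_of A) (sqrt e)"
        using assms by (intro twisted_norm_less) simp_all
      from twisted_bd_entry[OF this ij, of "Suc k"] e have "nsq (Suc k) (cube_of A i j) \<le> e" by simp
      moreover have "(cmod (cube_of A i j k))\<^sup>2 \<le> nsq (Suc k) (cube_of A i j)"
        unfolding nsq_def by (rule member_le_sum) auto
      ultimately show "(cmod (cube_of A i j k))\<^sup>2 \<le> 0 + e" by simp
    qed
    then show ?thesis by simp
  qed
  then show ?thesis
    using assms(1) by (intro eq_matI) (auto simp: mat_zero_def matrices_def cube_of_def fun_eq_iff)
qed

lemma twisted_norm_zero: "twisted_norm (mat_zero twisted n n) = 0"
proof -
  have m: "mat_zero twisted n n \<in> matrices twisted n"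
    by (auto simp: matrices_def mat_zero_def ell2_zero)
  have "hs_norm2 n (cube_of (mat_zero twisted n n)) = 0"
    by (simp add: hs_norm2_def cube_of_def mat_zero_def)
  then have "twisted_bd n (cube_of (mat_zero twisted n n)) 0"
    using twisted_bd_hs_norm[of n "cube_of (mat_zero twisted n n)"] m by (simp add: matrices_twisted)
  from twisted_norm_le[OF _ this] twisted_norm_nonneg[OF m] show ?thesis
    by (simp add: mat_zero_def)
qed

lemma twisted_norm_add:
  assumes A: "A \<in> matrices twisted n" and B: "B \<in> matrices twisted n"
  shows "twisted_norm (mat_add twisted A B) \<le> twisted_norm A + twisted_norm B"
proof (rule field_le_epsilon)
  fix e :: real assume e: "0 < e"
  have c: "A \<in> carrier_mat n n" "B \<in> carrier_mat n n" using A B by (simp_all add: matrices_twisted)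
  have "twisted_bd n (\<lambda>i j k. cube_of A i j k + cube_of B i j k) ((twisted_norm A + e / 2) + (twisted_norm B + e / 2))"
    by (intro twisted_bd_add twisted_norm_less A B) (simp_all add: e)
  then have "twisted_bd n (cube_of (mat_add twisted A B)) ((twisted_norm A + e / 2) + (twisted_norm B + e / 2))"
    by (rule twisted_bd_cong) (use c in \<open>simp add: cube_of_def mat_add_def\<close>)
  then have "twisted_norm (mat_add twisted A B) \<le> (twisted_norm A + e / 2) + (twisted_norm B + e / 2)"
    by (rule twisted_norm_le[rotated]) (use c in \<open>simp add: mat_add_def\<close>)
  then show "twisted_norm (mat_add twisted A B) \<le> twisted_norm A + twisted_norm B + e" by simp
qed

lemma twisted_norm_scale_le:
  assumes A: "A \<in> matrices twisted n"
  shows "twisted_norm (mat_scale twisted c A) \<le> cmod c * twisted_norm A"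
proof (rule field_le_epsilon)
  fix e :: real assume e: "0 < e"
  have cA: "A \<in> carrier_mat n n" using A by (simp add: matrices_twisted)
  \<comment> \<open>The excess is divided by |c| + 1 so that the choice makes sense for c = 0
    too.\<close>
  define d where "d = e / (cmod c + 1)"
  have pos: "0 < cmod c + 1" by (rule add_nonneg_pos) simp_all
  have d: "0 < d" using e pos by (simp add: d_def)
  have "twisted_bd n (\<lambda>i j k. c * cube_of A i j k) (cmod c * (twisted_norm A + d))"
    by (intro twisted_bd_scale twisted_norm_less[OF A]) (use d in linarith)
  then have "twisted_bd n (cube_of (mat_scale twisted c A)) (cmod c * (twisted_norm A + d))"
    by (rule twisted_bd_cong) (use cA in \<open>simp add: cube_of_def mat_scale_def\<close>)
  then have "twisted_norm (mat_scale twisted c A) \<le> cmod c * (twisted_norm A + d)"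
    by (rule twisted_norm_le[rotated]) (use cA in \<open>simp add: mat_scale_def\<close>)
  also have "\<dots> \<le> cmod c * twisted_norm A + (cmod c + 1) * d"
    using d by (simp add: distrib_left distrib_right)
  also have "\<dots> = cmod c * twisted_norm A + e" using pos by (simp add: d_def)
  finally show "twisted_norm (mat_scale twisted c A) \<le> cmod c * twisted_norm A + e" .
qed

lemma mat_scale_matrices:
  assumes "A \<in> matrices twisted n"
  shows "mat_scale twisted c A \<in> matrices twisted n"
  using assms by (auto simp: matrices_def mat_scale_def ell2_scale)

lemma twisted_norm_scale:
  assumes A: "A \<in> matrices twisted n"
  shows "twisted_norm (mat_scale twisted c A) = cmod c * twisted_norm A"
proof (cases "c = 0")
  case True
  then have "mat_scale twisted c A = mat_zero twisted n n"
    using A by (intro eq_matI) (auto simp: mat_scale_def mat_zero_def matrices_def)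
  then show ?thesis using True by (simp add: twisted_norm_zero)
next
  case False
  have "mat_scale twisted (1 / c) (mat_scale twisted c A) = A"
    using A False by (intro eq_matI) (auto simp: mat_scale_def matrices_def)
  then have "twisted_norm A \<le> cmod (1 / c) * twisted_norm (mat_scale twisted c A)"
    using twisted_norm_scale_le[OF mat_scale_matrices[OF A], of "1 / c" c] by simp
  then have "cmod c * twisted_norm A \<le> twisted_norm (mat_scale twisted c A)"
    using False by (simp add: norm_divide field_simps)
  then show ?thesis using twisted_norm_scale_le[OF A, of c] by simp
qed

lemma cube_of_mat_sandwich:
  assumes A: "A \<in> matrices twisted n" and \<alpha>: "\<alpha> \<in> carrier_mat m n" and \<beta>: "\<beta> \<in> carrier_mat n m" and ij: "i < m" "j < m"
  shows "cube_of (mat_sandwich twisted \<alpha> A \<beta>) i j k =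
    sandwich n (\<lambda>i j. \<alpha> $$ (i, j)) (cube_of A) (\<lambda>i j. \<beta> $$ (i, j)) i j k"
proof -
  have dim: "dim_row A = n" "dim_col A = n" and el: "\<And>a b. a < n \<Longrightarrow> b < n \<Longrightarrow> A $$ (a, b) \<in> carrier ell2"
    using A by (auto simp: matrices_def)
  let ?f = "\<lambda>a b. (\<alpha> $$ (i, a) * \<beta> $$ (b, j)) \<odot>\<^bsub>twisted\<^esub> (A $$ (a, b))"
  have inner: "(\<Oplus>\<^bsub>twisted\<^esub>b\<in>{..<n}. ?f a b) = (\<lambda>k. \<Sum>b<n. ?f a b k)" if "a < n" for a
    using that by (intro finsum_twisted) (auto simp: el ell2_scale)
  have sum_el: "(\<lambda>k. \<Sum>b<m'. ?f a b k) \<in> carrier ell2" if "a < n" "m' \<le> n" for a m'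
    using that(2)
  proof (induction m')
    case 0
    then show ?case by (simp add: ell2_zero)
  next
    case (Suc m')
    then show ?case using that by (simp add: ell2_add ell2_scale el)
  qed
  have "mat_sandwich twisted \<alpha> A \<beta> $$ (i, j) = (\<Oplus>\<^bsub>twisted\<^esub>a\<in>{..<n}. \<Oplus>\<^bsub>twisted\<^esub>b\<in>{..<n}. ?f a b)"
    using ij \<alpha> \<beta> by (simp add: mat_sandwich_def dim)
  also have "\<dots> = (\<lambda>k. \<Sum>a<n. (\<Oplus>\<^bsub>twisted\<^esub>b\<in>{..<n}. ?f a b) k)"
    using inner sum_el by (intro finsum_twisted) (simp_all del: twisted_simps)
  also have "\<dots> = (\<lambda>k. \<Sum>a<n. \<Sum>b<n. ?f a b k)"
    by (intro ext sum.cong refl) (simp only: inner lessThan_iff)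
  finally show ?thesis by (simp add: cube_of_def sandwich_def)
qed

lemma twisted_norm_sandwich:
  assumes A: "A \<in> matrices twisted n" and \<alpha>: "\<alpha> \<in> carrier_mat m n" and \<beta>: "\<beta> \<in> carrier_mat n m"
  shows "twisted_norm (mat_sandwich twisted \<alpha> A \<beta>) \<le> op_norm \<alpha> * twisted_norm A * op_norm \<beta>"
proof (rule field_le_epsilon)
  fix e :: real assume e: "0 < e"
  let ?s = "op_norm \<alpha>" and ?t = "op_norm \<beta>"
  have st: "0 \<le> ?s" "0 \<le> ?t" using op_norm_opbd[OF \<alpha>] op_norm_opbd[OF \<beta>] by (simp_all add: opbd_def)
  define d where "d = e / (?s * ?t + 1)"
  have pos: "0 < ?s * ?t + 1" using st by (simp add: add_nonneg_pos)
  have d: "0 < d" using e pos by (simp add: d_def)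
  have "twisted_bd m (sandwich n (\<lambda>i j. \<alpha> $$ (i, j)) (cube_of A) (\<lambda>i j. \<beta> $$ (i, j))) (?s * (twisted_norm A + d) * ?t)"
    by (intro twisted_bd_sandwich op_norm_opbd \<alpha> \<beta> twisted_norm_less[OF A]) (use d in linarith)
  then have "twisted_bd m (cube_of (mat_sandwich twisted \<alpha> A \<beta>)) (?s * (twisted_norm A + d) * ?t)"
    by (rule twisted_bd_cong) (simp add: cube_of_mat_sandwich[OF A \<alpha> \<beta>])
  then have "twisted_norm (mat_sandwich twisted \<alpha> A \<beta>) \<le> ?s * (twisted_norm A + d) * ?t"
    by (rule twisted_norm_le[rotated]) (use \<alpha> in \<open>simp add: mat_sandwich_def\<close>)
  also have "\<dots> \<le> ?s * twisted_norm A * ?t + (?s * ?t + 1) * d"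
    using d by (simp add: distrib_left distrib_right mult_ac)
  also have "\<dots> = ?s * twisted_norm A * ?t + e" using pos by (simp add: d_def)
  finally show "twisted_norm (mat_sandwich twisted \<alpha> A \<beta>) \<le> ?s * twisted_norm A * ?t + e" .
qed

lemma cube_of_mat_dsum:
  assumes "A \<in> matrices twisted m" "B \<in> matrices twisted n" "i < m + n" "j < m + n"
  shows "cube_of (mat_dsum twisted A B) i j k = block_sum m (cube_of A) (cube_of B) i j k"
  using assms by (auto simp: cube_of_def mat_dsum_def block_sum_def mat_zero_def matrices_def)

lemma opbd_inclusion: "d + p \<le> q \<Longrightarrow> opbd p q (\<lambda>i. kdelta (d + i)) 1"
proof -
  assume le: "d + p \<le> q"
  have "nsq p (\<lambda>i. \<Sum>j<q. kdelta (d + i) j * \<xi> j) \<le> nsq q \<xi>" for \<xi>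
  proof -
    have "nsq p (\<lambda>i. \<Sum>j<q. kdelta (d + i) j * \<xi> j) = nsq p (\<lambda>i. \<xi> (d + i))"
      using le by (intro nsq_cong) simp
    also have "\<dots> \<le> nsq (d + p) \<xi>" by (simp add: nsq_add)
    also have "\<dots> \<le> nsq q \<xi>" unfolding nsq_def using le by (intro sum_mono2) auto
    finally show ?thesis .
  qed
  then show "opbd p q (\<lambda>i. kdelta (d + i)) 1" by (simp add: opbd_def)
qed

text \<open>A diagonal block is the product with a coordinate inclusion and its transpose, both of
  norm at most 1. This is the lower estimate in the direct sum axiom.\<close>

lemma twisted_bd_compression:
  assumes A: "twisted_bd q A c" and le: "d + p \<le> q"
  shows "twisted_bd p (\<lambda>i j. A (d + i) (d + j)) c"
proof -
  have "twisted_bd p (sandwich q (\<lambda>i. kdelta (d + i)) A (\<lambda>i j. kdelta (d + j) i)) (1 * c * 1)"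
    by (intro twisted_bd_sandwich[OF A] opbd_inclusion[OF le] opbd_transpose[OF opbd_inclusion[OF le]])
  then have "twisted_bd p (sandwich q (\<lambda>i. kdelta (d + i)) A (\<lambda>i j. kdelta (d + j) i)) c" by simp
  then show ?thesis
  proof (rule twisted_bd_cong)
    fix i j k assume "i < p" "j < p"
    then show "sandwich q (\<lambda>i. kdelta (d + i)) A (\<lambda>i j. kdelta (d + j) i) i j k = A (d + i) (d + j) k"
      using pairing_kdelta[of "d + i" q "d + j" A k] le by (simp add: pairing_def sandwich_def)
  qed
qed

lemma mat_dsum_matrices:
  assumes "A \<in> matrices twisted m" "B \<in> matrices twisted n"
  shows "mat_dsum twisted A B \<in> matrices twisted (m + n)"
  using assms by (auto simp: matrices_def mat_dsum_def mat_zero_def ell2_zero)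

lemma twisted_norm_dsum:
  assumes A: "A \<in> matrices twisted m" and B: "B \<in> matrices twisted n"
  shows "twisted_norm (mat_dsum twisted A B) = max (twisted_norm A) (twisted_norm B)"
proof (rule antisym)
  have dims: "dim_row A = m" "dim_row B = n" using A B by (auto simp: matrices_def)
  show "twisted_norm (mat_dsum twisted A B) \<le> max (twisted_norm A) (twisted_norm B)"
  proof (rule field_le_epsilon)
    fix e :: real assume e: "0 < e"
    let ?c = "max (twisted_norm A) (twisted_norm B) + e"
    have "twisted_bd (m + n) (block_sum m (cube_of A) (cube_of B)) ?c"
      by (intro twisted_bd_block_sum twisted_norm_less A B) (use e in auto)
    then have "twisted_bd (m + n) (cube_of (mat_dsum twisted A B)) ?c"
      by (rule twisted_bd_cong) (simp add: cube_of_mat_dsum[OF A B])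
    then show "twisted_norm (mat_dsum twisted A B) \<le> ?c"
      by (rule twisted_norm_le[rotated]) (simp add: mat_dsum_def dims)
  qed
  show "max (twisted_norm A) (twisted_norm B) \<le> twisted_norm (mat_dsum twisted A B)"
  proof (rule field_le_epsilon)
    fix e :: real assume e: "0 < e"
    let ?c = "twisted_norm (mat_dsum twisted A B) + e"
    have bd: "twisted_bd (m + n) (cube_of (mat_dsum twisted A B)) ?c"
      by (intro twisted_norm_less mat_dsum_matrices A B) (use e in simp)
    have "twisted_bd m (cube_of A) ?c"
      using twisted_bd_compression[OF bd, of 0 m]
      by (rule twisted_bd_cong) (simp_all add: cube_of_mat_dsum[OF A B] block_sum_def)
    moreover have "twisted_bd n (cube_of B) ?c"
      using twisted_bd_compression[OF bd, of m n]
      by (rule twisted_bd_cong) (simp_all add: cube_of_mat_dsum[OF A B] block_sum_def)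
    ultimately show "max (twisted_norm A) (twisted_norm B) \<le> ?c"
      using twisted_norm_le dims by simp
  qed
qed

lemma operator_space_twisted: "operator_space twisted"
proof (intro operator_space.intro operator_space_axioms.intro module_twisted)
  fix A :: "(nat \<Rightarrow> complex) mat" and n assume A: "A \<in> matrices twisted n"
  show "0 \<le> mnorm twisted A" using twisted_norm_nonneg[OF A] by simp
  show "mnorm twisted A = 0 \<longleftrightarrow> A = mat_zero twisted n n"
    using twisted_norm_eq_0[OF A] twisted_norm_zero by auto
  show "mnorm twisted (mat_scale twisted c A) = cmod c * mnorm twisted A" for c
    using twisted_norm_scale[OF A] by simp
  show "mnorm twisted (mat_add twisted A B) \<le> mnorm twisted A + mnorm twisted B" if "B \<in> matrices twisted n" for B
    using twisted_norm_add[OF A that] by simp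
  show "mnorm twisted (mat_sandwich twisted \<alpha> A \<beta>) \<le> op_norm \<alpha> * mnorm twisted A * op_norm \<beta>"
    if "\<alpha> \<in> carrier_mat m n" "\<beta> \<in> carrier_mat n m" for \<alpha> \<beta> m
    using twisted_norm_sandwich[OF A that] by simp
  show "mnorm twisted (mat_dsum twisted A B) = max (mnorm twisted A) (mnorm twisted B)" if "B \<in> matrices twisted m" for B m
    using twisted_norm_dsum[OF A that] by simp
qed

section \<open>The norm of single vectors\<close>

lemma nsq_le_ell2_norm: "x \<in> carrier ell2 \<Longrightarrow> nsq K x \<le> (ell2_norm x)\<^sup>2"
  by (simp add: ell2_norm_power2 nsq_le_suminf ell2_carrier)

lemma ell2_norm_nonneg: "x \<in> carrier ell2 \<Longrightarrow> 0 \<le> ell2_norm x"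
  by (simp add: ell2_norm_def suminf_nonneg ell2_carrier)

lemma ell2_norm_le:
  assumes "\<And>K. nsq K x \<le> c\<^sup>2" "0 \<le> c"
  shows "ell2_norm x \<le> c"
proof -
  have "x \<in> carrier ell2" using assms(1) unfolding ell2_iff_bounded by blast
  then have "(\<Sum>k. (cmod (x k))\<^sup>2) \<le> c\<^sup>2"
    using assms(1) unfolding nsq_def by (intro suminf_le_const) (simp_all add: ell2_carrier)
  then show ?thesis unfolding ell2_norm_def using assms(2) by (rule real_le_lsqrt[rotated])
qed

text \<open>The two-term decomposition gives the upper bound, with the Hilbert-Schmidt norm at size
  one equal to the norm of \<open>x\<close>; the minimal norm gives the lower bound.\<close>

lemma space_norm_twisted:
  assumes x: "x \<in> carrier ell2"
  shows "space_norm twisted x = ell2_norm x"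
proof -
  let ?A = "mat 1 1 (\<lambda>_. x)"
  have m: "?A \<in> matrices twisted 1" using x by (auto simp: matrices_def)
  have entry: "cube_of ?A 0 0 = x" by (simp add: cube_of_def fun_eq_iff)
  have "hs_norm2 1 (cube_of ?A) = (\<Sum>k. (cmod (x k))\<^sup>2)" by (simp add: hs_norm2_def cube_of_def)
  then have "twisted_bd 1 (cube_of ?A) (ell2_norm x)"
    using twisted_bd_hs_norm[of 1 "cube_of ?A"] m by (simp add: ell2_norm_def matrices_twisted)
  then have "twisted_norm ?A \<le> ell2_norm x" by (intro twisted_norm_le) simp_all
  moreover have "ell2_norm x \<le> twisted_norm ?A"
  proof (rule field_le_epsilon)
    fix e :: real assume "0 < e"
    then have bd: "twisted_bd 1 (cube_of ?A) (twisted_norm ?A + e)" by (intro twisted_norm_less[OF m]) simp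
    show "ell2_norm x \<le> twisted_norm ?A + e"
      using twisted_bd_entry[OF bd, of 0 0] entry twisted_bd_nonneg[OF bd] by (intro ell2_norm_le) simp_all
  qed
  ultimately show ?thesis by (simp add: space_norm_def)
qed

lemma isometric_twisted: "isometric_to_ell2 twisted"
  unfolding isometric_to_ell2_def
proof (intro exI[of _ id] conjI ballI)
  show "Defs.linear_map twisted ell2 id"
    by (auto simp: Defs.linear_map_def hom_def ell2_def)
qed (simp_all add: space_norm_twisted)

section \<open>Even and odd coordinates\<close>

definition even_part :: "(nat \<Rightarrow> complex) \<Rightarrow> nat \<Rightarrow> complex" where
  "even_part z k = z (2 * k)"

definition odd_part :: "(nat \<Rightarrow> complex) \<Rightarrow> nat \<Rightarrow> complex" where
  "odd_part z k = z (2 * k + 1)"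

definition interleave :: "(nat \<Rightarrow> complex) \<Rightarrow> (nat \<Rightarrow> complex) \<Rightarrow> nat \<Rightarrow> complex" where
  "interleave x w k = (if even k then x (k div 2) else w (k div 2))"

definition twisted_kernel :: "(nat \<Rightarrow> complex) set" where
  "twisted_kernel = {z \<in> carrier ell2. even_part z = (\<lambda>_. 0)}"

text \<open>These sets are the cosets of the kernel; indexing them by the common even part
  identifies the quotient with \<open>ell2\<close>.\<close>

definition fiber :: "(nat \<Rightarrow> complex) \<Rightarrow> (nat \<Rightarrow> complex) set" where
  "fiber x = {z \<in> carrier ell2. even_part z = x}"

lemma interleave_simps [simp]:
  "interleave x w (2 * k) = x k" "interleave x w (Suc (2 * k)) = w k"
  "even_part (interleave x w) = x" "odd_part (interleave x w) = w"
  by (simp_all add: interleave_def even_part_def odd_part_def fun_eq_iff)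

lemma interleave_parts [simp]: "interleave (even_part z) (odd_part z) = z"
  by (auto simp: interleave_def even_part_def odd_part_def fun_eq_iff)

lemma even_part_linear [simp]:
  "even_part (\<lambda>k. x k + y k) = (\<lambda>k. even_part x k + even_part y k)"
  "even_part (\<lambda>k. x k - y k) = (\<lambda>k. even_part x k - even_part y k)"
  "even_part (\<lambda>k. c * x k) = (\<lambda>k. c * even_part x k)"
  by (simp_all add: even_part_def fun_eq_iff)

lemma nsq_double: "nsq (2 * K) z = nsq K (even_part z) + nsq K (odd_part z)"
  by (simp only: nsq_def sum_double sum.distrib even_part_def odd_part_def)

lemma ell2_parts:
  assumes "z \<in> carrier ell2"
  shows "even_part z \<in> carrier ell2" "odd_part z \<in> carrier ell2"
proof -
  obtain B where B: "\<And>K. nsq K z \<le> B" using assms unfolding ell2_iff_bounded by blast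
  have "nsq K (even_part z) \<le> B" "nsq K (odd_part z) \<le> B" for K
    using B[of "2 * K"] nsq_nonneg[of K "even_part z"] nsq_nonneg[of K "odd_part z"] unfolding nsq_double by linarith+
  then show "even_part z \<in> carrier ell2" "odd_part z \<in> carrier ell2" unfolding ell2_iff_bounded by blast+
qed

lemma ell2_interleave:
  assumes "x \<in> carrier ell2" "w \<in> carrier ell2"
  shows "interleave x w \<in> carrier ell2"
proof -
  obtain B C where "\<And>K. nsq K x \<le> B" "\<And>K. nsq K w \<le> C" using assms unfolding ell2_iff_bounded by blast
  then have "nsq (2 * K) (interleave x w) \<le> B + C" for K by (simp add: nsq_double add_mono)
  moreover have "nsq K (interleave x w) \<le> nsq (2 * K) (interleave x w)" for K
    unfolding nsq_def by (rule sum_mono2) auto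
  ultimately show ?thesis unfolding ell2_iff_bounded by (meson order_trans)
qed

section \<open>Complete isomorphisms onto the operator Hilbert space\<close>

lemma linear_mapI:
  assumes "\<And>x. x \<in> carrier X \<Longrightarrow> T x \<in> carrier Z"
    and "\<And>x y. x \<in> carrier X \<Longrightarrow> y \<in> carrier X \<Longrightarrow> T (x \<oplus>\<^bsub>X\<^esub> y) = T x \<oplus>\<^bsub>Z\<^esub> T y"
    and "\<And>c x. x \<in> carrier X \<Longrightarrow> T (c \<odot>\<^bsub>X\<^esub> x) = c \<odot>\<^bsub>Z\<^esub> T x"
  shows "Defs.linear_map X Z T"
  using assms by (auto simp: Defs.linear_map_def hom_def)

lemma linear_mapD:
  assumes "Defs.linear_map X Z T"
  shows "x \<in> carrier X \<Longrightarrow> T x \<in> carrier Z"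
    and "x \<in> carrier X \<Longrightarrow> y \<in> carrier X \<Longrightarrow> T (x \<oplus>\<^bsub>X\<^esub> y) = T x \<oplus>\<^bsub>Z\<^esub> T y"
    and "x \<in> carrier X \<Longrightarrow> T (c \<odot>\<^bsub>X\<^esub> x) = c \<odot>\<^bsub>Z\<^esub> T x"
  using assms by (auto simp: Defs.linear_map_def hom_def)

lemma completely_boundedI:
  assumes "Defs.linear_map X Z T"
    and "\<And>n A. A \<in> matrices X n \<Longrightarrow> mnorm X A \<le> 1 \<Longrightarrow> mnorm Z (map_mat T A) \<le> C"
  shows "completely_bounded X Z T"
proof -
  have "(SUP n. amp_norm X Z T n) \<le> ennreal C"
    unfolding amp_norm_def using assms(2) by (intro SUP_least ennreal_leI) auto
  then show ?thesis using assms(1) by (auto simp: completely_bounded_def intro: le_less_trans)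
qed

lemma completely_boundedE:
  assumes "completely_bounded X Z T"
  obtains C where "0 \<le> C" "\<And>n A. A \<in> matrices X n \<Longrightarrow> mnorm X A \<le> 1 \<Longrightarrow> mnorm Z (map_mat T A) \<le> C"
proof -
  let ?S = "SUP n. amp_norm X Z T n"
  have fin: "?S < \<infinity>" using assms by (simp add: completely_bounded_def)
  have "mnorm Z (map_mat T A) \<le> enn2real ?S" if "A \<in> matrices X n" "mnorm X A \<le> 1" for n A
  proof -
    have "ennreal (mnorm Z (map_mat T A)) \<le> amp_norm X Z T n"
      unfolding amp_norm_def using that by (intro SUP_upper) simp
    also have "\<dots> \<le> ?S" by (rule SUP_upper) simp
    finally have "ennreal (mnorm Z (map_mat T A)) \<le> ennreal (enn2real ?S)"
      using fin by simp
    then show ?thesis by (simp add: ennreal_le_iff)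
  qed
  then show ?thesis using that[of "enn2real ?S"] by simp
qed

text \<open>With an explicit inverse \<open>S\<close> all estimates avoid \<open>inv_into\<close>,
  which agrees with \<open>S\<close> on the carrier and hence on matrices over OH.\<close>

lemma completely_isomorphic_OH:
  assumes T: "Defs.linear_map X OH T" and S: "Defs.linear_map OH X S"
    and ST: "\<And>x. x \<in> carrier X \<Longrightarrow> S (T x) = x" and TS: "\<And>z. z \<in> carrier ell2 \<Longrightarrow> T (S z) = z"
    and C: "\<And>n A. A \<in> matrices X n \<Longrightarrow> mnorm X A \<le> 1 \<Longrightarrow> mnorm OH (map_mat T A) \<le> C"
    and D: "\<And>n B. B \<in> matrices OH n \<Longrightarrow> mnorm OH B \<le> 1 \<Longrightarrow> mnorm X (map_mat S B) \<le> D"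
  shows "completely_isomorphic X OH"
proof -
  have Tc: "T x \<in> carrier ell2" if "x \<in> carrier X" for x using linear_mapD(1)[OF T that] by simp
  have Sc: "S z \<in> carrier X" if "z \<in> carrier ell2" for z using linear_mapD(1)[OF S] that by simp
  have bij: "bij_betw T (carrier X) (carrier OH)"
    by (rule bij_betw_byWitness[where f'=S]) (auto simp: ST TS Tc Sc)
  have inv: "inv_into (carrier X) T z = S z" if "z \<in> carrier ell2" for z
    using bij that by (metis Sc TS bij_betw_imp_inj_on inv_into_f_f)
  have "Defs.linear_map OH X (inv_into (carrier X) T)"
  proof (rule linear_mapI)
    show "inv_into (carrier X) T (x \<oplus>\<^bsub>OH\<^esub> y) = inv_into (carrier X) T x \<oplus>\<^bsub>X\<^esub> inv_into (carrier X) T y"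
      if "x \<in> carrier OH" "y \<in> carrier OH" for x y
      using linear_mapD(2)[OF S that] that by (simp add: inv ell2_add)
    show "inv_into (carrier X) T (c \<odot>\<^bsub>OH\<^esub> x) = c \<odot>\<^bsub>X\<^esub> inv_into (carrier X) T x" if "x \<in> carrier OH" for c x
      using linear_mapD(3)[OF S that] that by (simp add: inv ell2_scale)
  qed (simp add: inv Sc)
  moreover have "map_mat (inv_into (carrier X) T) B = map_mat S B" if "B \<in> matrices OH n" for B n
    using that by (intro eq_matI) (auto simp: matrices_def inv)
  ultimately have "completely_bounded OH X (inv_into (carrier X) T)"
    using D by (intro completely_boundedI) auto
  then show ?thesis
    unfolding completely_isomorphic_def complete_isomorphism_def
    using bij completely_boundedI[OF T, of C] C by blast
qed

section \<open>The subspace\<close>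

lemma subspace_simps [simp]:
  "carrier (subspace_opspace X Y) = Y" "x \<oplus>\<^bsub>subspace_opspace X Y\<^esub> y = x \<oplus>\<^bsub>X\<^esub> y"
  "c \<odot>\<^bsub>subspace_opspace X Y\<^esub> x = c \<odot>\<^bsub>X\<^esub> x" "mnorm (subspace_opspace X Y) = mnorm X"
  by (simp_all add: subspace_opspace_def)

lemma decomposesD:
  assumes "decomposes n M u A" "i < n" "j < n"
  shows "A i j (2 * k) = (\<Sum>m=-int M..int M. u m i j k)"
    "A i j (2 * k + 1) = (\<Sum>m=-int M..int M. of_int m * u m i j k)"
  using assms by (simp_all add: decomposes_def)

text \<open>For lifts whose odd coordinates are prescribed as sums over a family, square summability
  is not known in advance; the minimal norm supplies it.\<close>

lemma matrices_twisted_of_bd: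
  assumes "A \<in> carrier_mat n n" "twisted_bd n (cube_of A) c"
  shows "A \<in> matrices twisted n"
proof -
  have "cube_of A i j \<in> carrier ell2" if "i < n" "j < n" for i j
    unfolding ell2_iff_bounded using twisted_bd_entry[OF assms(2) that] by blast
  then show ?thesis using assms(1) by (simp add: matrices_twisted square_summable_def ell2_carrier)
qed

text \<open>Reading off \<open>w\<close> is bounded because on the kernel \<open>w\<close> is gauged
  by the family itself. The inverse takes a J-bounded family summing to \<open>w\<close> and applies
  summation by parts, which produces a family for the pair with first sum 0. The constant 6 is 3
  times the bound 2 of the factorization.\<close>

lemma kernel_isomorphic_OH: "completely_isomorphic (subspace_opspace twisted twisted_kernel) OH"
proof (rule completely_isomorphic_OH[where T=odd_part and S="interleave (\<lambda>_. 0)"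
      and C="2 * sqrt gauge_const * 4" and D="equiv_const * 6"])
  show "Defs.linear_map (subspace_opspace twisted twisted_kernel) OH odd_part"
    by (rule linear_mapI) (auto simp: twisted_kernel_def ell2_parts odd_part_def)
  show "Defs.linear_map OH (subspace_opspace twisted twisted_kernel) (interleave (\<lambda>_. 0))"
    by (rule linear_mapI) (auto simp: twisted_kernel_def ell2_interleave ell2_zero interleave_def)
  show "interleave (\<lambda>_. 0) (odd_part x) = x" if "x \<in> carrier (subspace_opspace twisted twisted_kernel)" for x
    using that interleave_parts[of x] by (simp add: twisted_kernel_def)
next
  fix n A assume A: "A \<in> matrices (subspace_opspace twisted twisted_kernel) n"
    and "mnorm (subspace_opspace twisted twisted_kernel) A \<le> 1"
  \<comment> \<open>The infimum need not be attained, so 1 is relaxed to 2; the factor 2 in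
    \<open>twisted_bd\<close> then gives the J-bound 4.\<close>
  then have n1: "twisted_norm A < 2" by simp
  have c: "A \<in> carrier_mat n n" using A by (simp add: matrices_def)
  have e: "A $$ (i, j) \<in> carrier ell2" "even_part (A $$ (i, j)) = (\<lambda>_. 0)" if "i < n" "j < n" for i j
    using A that by (simp_all add: matrices_def twisted_kernel_def)
  have "A \<in> matrices twisted n" using c e by (simp add: matrices_def)
  from twisted_norm_less[OF this n1] obtain M u where u: "J_bd n M u (2 * 2)" "decomposes n M u (cube_of A)"
    unfolding twisted_bd_def by blast
  show "mnorm OH (map_mat odd_part A) \<le> 2 * sqrt gauge_const * 4"
  proof (rule OH_norm_le)
    show "map_mat odd_part A \<in> matrices OH n"
      using c e by (simp add: matrices_def ell2_parts)
    show "J_bd n M u 4" using u(1) by simp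
    show "gauged n M u (cube_of (map_mat odd_part A))"
      unfolding gauged_def
    proof (intro allI exI conjI impI)
      fix m0 :: int
      \<comment> \<open>The coefficients are m - m0, which is legitimate because the plain sum of
        the family vanishes on the kernel.\<close>
      show "cmod (of_int (m - m0)) \<le> 1 + real_of_int \<bar>m - m0\<bar>" for m
        unfolding norm_of_int by simp
      fix i j k assume ij: "i < n" "j < n"
      have "(\<Sum>m=-int M..int M. u m i j k) = 0"
        using decomposesD(1)[OF u(2) ij, of k] fun_cong[OF e(2)[OF ij], of k] by (simp add: cube_of_def even_part_def)
      moreover have "(\<Sum>m=-int M..int M. of_int (m - m0) * u m i j k) =
          (\<Sum>m=-int M..int M. of_int m * u m i j k) - of_int m0 * (\<Sum>m=-int M..int M. u m i j k)"
        by (simp add: left_diff_distrib sum_subtractf sum_distrib_left)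
      ultimately show "cube_of (map_mat odd_part A) i j k = (\<Sum>m=-int M..int M. of_int (m - m0) * u m i j k)"
        using decomposesD(2)[OF u(2) ij, of k] c ij by (simp add: cube_of_def odd_part_def)
    qed
  qed
next
  fix n B assume B: "B \<in> matrices OH n" "mnorm OH B \<le> 1"
  have c: "B \<in> carrier_mat n n" using B by (simp add: matrices_def)
  obtain M v where v: "supp M v" "J_bd n M v 2"
      and Bv: "\<And>i j k. i < n \<Longrightarrow> j < n \<Longrightarrow> cube_of B i j k = (\<Sum>m=-int M..int M. v m i j k)"
    using gram_contractive_decomposition[OF OH_unit_ball[OF B]] by blast
  obtain u where u: "supp (Suc M) u" "J_bd n (Suc M) u (3 * 2)"
      and us: "\<And>i j k. (\<Sum>m=-int (Suc M)..int (Suc M). u m i j k) = 0"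
        "\<And>i j k. (\<Sum>m=-int (Suc M)..int (Suc M). of_int m * u m i j k) = (\<Sum>m=-int M..int M. v m i j k)"
    using J_bd_difference[OF v(2,1)] by blast
  have "decomposes n (Suc M) u (cube_of (map_mat (interleave (\<lambda>_. 0)) B))"
    unfolding decomposes_def us using c by (simp add: cube_of_def Bv[symmetric])
  from twisted_bd_of_J_bd[OF u this]
  show "mnorm (subspace_opspace twisted twisted_kernel) (map_mat (interleave (\<lambda>_. 0)) B) \<le> equiv_const * 6"
    using c by (simp add: twisted_norm_le[of _ n])
qed simp

section \<open>Closedness of the kernel\<close>

lemma Metric_space_twisted: "Metric_space (carrier twisted) (space_dist twisted)"
proof
  have dist: "space_dist twisted x y = ell2_norm (\<lambda>k. x k - y k)" if "x \<in> carrier ell2" "y \<in> carrier ell2" for x y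
    using that by (simp add: space_dist_def twisted_minus space_norm_twisted ell2_diff)
  show "0 \<le> space_dist twisted x y" for x y
    by (simp add: space_dist_def twisted_minus space_norm_twisted ell2_diff ell2_norm_nonneg)
  show "space_dist twisted x y = space_dist twisted y x" for x y
  proof -
    have "ell2_norm (\<lambda>k. x k - y k) = ell2_norm (\<lambda>k. y k - x k)"
      by (simp add: ell2_norm_def norm_minus_commute)
    then show ?thesis using dist[of x y] dist[of y x] by (auto simp: space_dist_def)
  qed
  show "space_dist twisted x y = 0 \<longleftrightarrow> x = y" if "x \<in> carrier twisted" "y \<in> carrier twisted" for x y
  proof
    assume "space_dist twisted x y = 0"
    then have "ell2_norm (\<lambda>k. x k - y k) = 0" using that dist by simp
    moreover have "summable (\<lambda>k. (cmod (x k - y k))\<^sup>2)" using ell2_diff[of x y] that by (simp add: ell2_carrier)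
    ultimately have "\<forall>k. (cmod (x k - y k))\<^sup>2 = 0"
      by (subst (asm) ell2_norm_def) (simp add: suminf_eq_zero_iff)
    then show "x = y" by (simp add: fun_eq_iff)
  qed (use that dist in \<open>simp add: ell2_norm_def\<close>)
  show "space_dist twisted x z \<le> space_dist twisted x y + space_dist twisted y z"
    if "x \<in> carrier twisted" "y \<in> carrier twisted" "z \<in> carrier twisted" for x y z
  proof -
    let ?f = "\<lambda>k. x k - y k" and ?g = "\<lambda>k. y k - z k"
    have f: "?f \<in> carrier ell2" "?g \<in> carrier ell2" using that by (simp_all add: ell2_diff)
    have "ell2_norm (\<lambda>k. x k - z k) \<le> ell2_norm ?f + ell2_norm ?g"
    proof (rule ell2_norm_le)
      fix K
      have "sqrt (nsq K (\<lambda>k. x k - z k)) \<le> sqrt (nsq K ?f) + sqrt (nsq K ?g)"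
        using nsq_triangle[of K ?f ?g] by simp
      also have "\<dots> \<le> ell2_norm ?f + ell2_norm ?g"
        using nsq_le_ell2_norm[OF f(1), of K] nsq_le_ell2_norm[OF f(2), of K] ell2_norm_nonneg[OF f(1)] ell2_norm_nonneg[OF f(2)]
        by (intro add_mono real_le_lsqrt) simp_all
      finally show "nsq K (\<lambda>k. x k - z k) \<le> (ell2_norm ?f + ell2_norm ?g)\<^sup>2" by (rule sqrt_le_D)
    qed (simp add: ell2_norm_nonneg f)
    then show ?thesis using dist that by simp
  qed
qed

text \<open>The complement is open: within distance |x (2 k)| of \<open>x\<close>, a nonzero even
  coordinate cannot become 0.\<close>

lemma closed_subspace_kernel: "closed_subspace twisted_kernel twisted"
  unfolding closed_subspace_def
proof
  show "Module.submodule twisted_kernel complex_ring twisted"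
    by (rule twisted.submoduleI)
      (auto simp: twisted_kernel_def ell2_zero ell2_add ell2_scale even_part_def fun_eq_iff twisted_uminus
        intro!: ell2_scale[where c="-1", simplified])
  interpret ms: Metric_space "carrier twisted" "space_dist twisted" by (rule Metric_space_twisted)
  have "openin ms.mtopology (carrier twisted - twisted_kernel)"
    unfolding ms.openin_mtopology
  proof (intro conjI allI impI)
    fix x assume x: "x \<in> carrier twisted - twisted_kernel"
    then obtain k where k: "x (2 * k) \<noteq> 0" by (auto simp: twisted_kernel_def even_part_def fun_eq_iff)
    show "\<exists>r>0. ms.mball x r \<subseteq> carrier twisted - twisted_kernel"
    proof (intro exI conjI subsetI)
      show "0 < cmod (x (2 * k))" using k by simp
      fix y assume y: "y \<in> ms.mball x (cmod (x (2 * k)))"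
      then have yx: "y \<in> carrier ell2" "x \<in> carrier ell2" "space_dist twisted x y < cmod (x (2 * k))"
        unfolding ms.in_mball by simp_all
      have d: "(\<lambda>k. x k - y k) \<in> carrier ell2" using yx by (simp add: ell2_diff)
      have "y \<notin> twisted_kernel"
      proof
        assume "y \<in> twisted_kernel"
        then have "y (2 * k) = 0" by (auto simp: twisted_kernel_def even_part_def fun_eq_iff)
        then have "(cmod (x (2 * k)))\<^sup>2 = (cmod (x (2 * k) - y (2 * k)))\<^sup>2" by simp
        also have "\<dots> \<le> nsq (Suc (2 * k)) (\<lambda>k. x k - y k)"
          unfolding nsq_def by (rule member_le_sum[where f="\<lambda>j. (cmod (x j - y j))\<^sup>2"]) auto
        also have "\<dots> \<le> (ell2_norm (\<lambda>k. x k - y k))\<^sup>2" by (rule nsq_le_ell2_norm[OF d])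
        finally have "cmod (x (2 * k)) \<le> ell2_norm (\<lambda>k. x k - y k)"
          by (rule power2_le_imp_le) (rule ell2_norm_nonneg[OF d])
        then show False using yx by (simp add: space_dist_def twisted_minus space_norm_twisted d)
      qed
      then show "y \<in> carrier twisted - twisted_kernel" using yx by simp
    qed
  qed simp
  then show "closedin ms.mtopology twisted_kernel"
    unfolding closedin_def ms.topspace_mtopology by (auto simp: twisted_kernel_def)
qed

section \<open>The quotient\<close>

lemma kernel_coset:
  assumes "z \<in> carrier ell2"
  shows "twisted_kernel +>\<^bsub>twisted\<^esub> z = fiber (even_part z)"
proof (intro equalityI subsetI)
  fix u assume "u \<in> twisted_kernel +>\<^bsub>twisted\<^esub> z"
  then show "u \<in> fiber (even_part z)"
    using assms by (auto simp: a_r_coset_def' twisted_kernel_def fiber_def ell2_add)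
next
  fix u assume u: "u \<in> fiber (even_part z)"
  then have "(\<lambda>k. u k - z k) \<in> twisted_kernel"
    using assms by (auto simp: twisted_kernel_def fiber_def ell2_diff even_part_def fun_eq_iff)
  moreover have "u = (\<lambda>k. u k - z k) \<oplus>\<^bsub>twisted\<^esub> z" by simp
  ultimately show "u \<in> twisted_kernel +>\<^bsub>twisted\<^esub> z" unfolding a_r_coset_def' by blast
qed

abbreviation "twisted_quotient \<equiv> quotient_opspace twisted twisted_kernel"

lemma fiber_interleave:
  assumes "x \<in> carrier ell2" shows "interleave x (\<lambda>_. 0) \<in> fiber x"
  using assms by (simp add: fiber_def ell2_interleave ell2_zero)

lemma carrier_twisted_quotient: "carrier twisted_quotient = fiber ` carrier ell2"
proof -
  have "carrier twisted_quotient = (\<lambda>z. fiber (even_part z)) ` carrier ell2"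
    by (auto simp: quotient_opspace_def A_RCOSETS_def' kernel_coset)
  also have "\<dots> = fiber ` carrier ell2"
  proof (intro equalityI subsetI)
    fix U assume "U \<in> fiber ` carrier ell2"
    then obtain x where "x \<in> carrier ell2" "U = fiber x" by blast
    then show "U \<in> (\<lambda>z. fiber (even_part z)) ` carrier ell2"
      by (intro image_eqI[of _ _ "interleave x (\<lambda>_. 0)"]) (simp_all add: ell2_interleave ell2_zero)
  qed (auto simp: ell2_parts)
  finally show ?thesis .
qed

lemma quotient_add:
  assumes "x \<in> carrier ell2" "y \<in> carrier ell2"
  shows "fiber x \<oplus>\<^bsub>twisted_quotient\<^esub> fiber y = fiber (\<lambda>k. x k + y k)"
proof (intro equalityI subsetI)
  fix u assume "u \<in> fiber x \<oplus>\<^bsub>twisted_quotient\<^esub> fiber y"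
  then show "u \<in> fiber (\<lambda>k. x k + y k)"
    by (auto simp: quotient_opspace_def set_add_def' fiber_def ell2_add)
next
  fix u assume u: "u \<in> fiber (\<lambda>k. x k + y k)"
  let ?v = "interleave x (\<lambda>_. 0)"
  have v: "?v \<in> fiber x" by (rule fiber_interleave[OF assms(1)])
  have "(\<lambda>k. u k - ?v k) \<in> fiber y"
    using u v by (auto simp: fiber_def ell2_diff even_part_def fun_eq_iff)
  moreover have "u = ?v \<oplus>\<^bsub>twisted\<^esub> (\<lambda>k. u k - ?v k)" by simp
  ultimately show "u \<in> fiber x \<oplus>\<^bsub>twisted_quotient\<^esub> fiber y"
    using v unfolding quotient_opspace_def by (auto simp: set_add_def' simp del: twisted_simps)
qed

lemma quotient_smult:
  assumes "x \<in> carrier ell2"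
  shows "c \<odot>\<^bsub>twisted_quotient\<^esub> fiber x = fiber (\<lambda>k. c * x k)"
proof (intro equalityI subsetI)
  fix u assume "u \<in> c \<odot>\<^bsub>twisted_quotient\<^esub> fiber x"
  then show "u \<in> fiber (\<lambda>k. c * x k)"
    by (auto simp: quotient_opspace_def set_add_def' fiber_def twisted_kernel_def intro!: ell2_add ell2_scale)
next
  fix u assume u: "u \<in> fiber (\<lambda>k. c * x k)"
  let ?v = "interleave x (\<lambda>_. 0)"
  have v: "?v \<in> fiber x" by (rule fiber_interleave[OF assms])
  have "(\<lambda>k. u k - c * ?v k) \<in> twisted_kernel"
    using u v by (auto simp: fiber_def twisted_kernel_def ell2_diff ell2_scale even_part_def fun_eq_iff)
  moreover have "u = (c \<odot>\<^bsub>twisted\<^esub> ?v) \<oplus>\<^bsub>twisted\<^esub> (\<lambda>k. u k - c * ?v k)" by simp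
  ultimately show "u \<in> c \<odot>\<^bsub>twisted_quotient\<^esub> fiber x"
    using v unfolding quotient_opspace_def by (auto simp: set_add_def' simp del: twisted_simps)
qed

text \<open>All elements of a fiber have the same even part, so the choice does not matter.\<close>

definition fiber_base :: "(nat \<Rightarrow> complex) set \<Rightarrow> nat \<Rightarrow> complex" where
  "fiber_base U = even_part (SOME z. z \<in> U)"

lemma fiber_base_fiber [simp]: "x \<in> carrier ell2 \<Longrightarrow> fiber_base (fiber x) = x"
  using someI[of "\<lambda>z. z \<in> fiber x", OF fiber_interleave] by (simp add: fiber_base_def fiber_def)

lemma mnorm_twisted_quotient:
  "mnorm twisted_quotient U = Inf {twisted_norm A | A. A \<in> matrices twisted (dim_row U) \<and>
     map_mat (\<lambda>x. twisted_kernel +>\<^bsub>twisted\<^esub> x) A = U}"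
  by (simp add: quotient_opspace_def)

lemma map_mat_coset:
  assumes "A \<in> matrices twisted n"
  shows "map_mat (\<lambda>x. twisted_kernel +>\<^bsub>twisted\<^esub> x) A = map_mat fiber (map_mat even_part A)"
  using assms by (intro eq_matI) (auto simp: matrices_def kernel_coset)

text \<open>For any lift the even part is the plain sum of its family, which is gauged with constant
  coefficients 1. Conversely, a J-bounded family for \<open>B\<close> is turned into a lift by
  taking as odd part the sum of \<open>m * u m\<close>, so that the same family decomposes the
  lift.\<close>

lemma quotient_isomorphic_OH: "completely_isomorphic twisted_quotient OH"
proof (rule completely_isomorphic_OH[where T=fiber_base and S=fiber
      and C="2 * sqrt gauge_const * 4" and D="equiv_const * 2"])
  show "Defs.linear_map twisted_quotient OH fiber_base"
    by (rule linear_mapI) (auto simp: carrier_twisted_quotient quotient_add quotient_smult ell2_add ell2_scale)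
  show "Defs.linear_map OH twisted_quotient fiber"
    by (rule linear_mapI) (auto simp: carrier_twisted_quotient quotient_add quotient_smult)
  show "fiber (fiber_base U) = U" if "U \<in> carrier twisted_quotient" for U
    using that by (auto simp: carrier_twisted_quotient)
next
  fix n U assume U: "U \<in> matrices twisted_quotient n" and n1: "mnorm twisted_quotient U \<le> 1"
  let ?N = "{twisted_norm A | A. A \<in> matrices twisted (dim_row U) \<and> map_mat (\<lambda>x. twisted_kernel +>\<^bsub>twisted\<^esub> x) A = U}"
  have c: "U \<in> carrier_mat n n" using U by (simp add: matrices_def)
  have Ue: "U $$ (i, j) \<in> fiber ` carrier ell2" if "i < n" "j < n" for i j
    using U that by (simp add: matrices_def carrier_twisted_quotient)
  \<comment> \<open>Only shows that \<open>U\<close> has some lift, as \<open>Inf\<close> says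
    nothing about an empty set.\<close>
  let ?A = "map_mat (\<lambda>V. interleave (fiber_base V) (\<lambda>_. 0)) U"
  have A: "?A \<in> matrices twisted n"
    using c Ue by (fastforce simp: matrices_def ell2_interleave ell2_zero)
  have "map_mat (\<lambda>x. twisted_kernel +>\<^bsub>twisted\<^esub> x) ?A = U"
    unfolding map_mat_coset[OF A] using c Ue by (intro eq_matI) fastforce+
  then have ne: "?N \<noteq> {}" using A c by blast
  have "Inf ?N < 2" using n1 unfolding mnorm_twisted_quotient by simp
  from cInf_lessD[OF ne this] obtain r where "r \<in> ?N" "r < 2" by blast
  then obtain A where A: "A \<in> matrices twisted n" "map_mat (\<lambda>x. twisted_kernel +>\<^bsub>twisted\<^esub> x) A = U" "twisted_norm A < 2"
    using c by auto
  from twisted_norm_less[OF A(1,3)] obtain M u where u: "J_bd n M u (2 * 2)" "decomposes n M u (cube_of A)"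
    unfolding twisted_bd_def by blast
  have cA: "A \<in> carrier_mat n n" and Ae: "\<And>i j. i < n \<Longrightarrow> j < n \<Longrightarrow> A $$ (i, j) \<in> carrier ell2"
    using A by (simp_all add: matrices_def)
  have eq: "map_mat fiber_base U = map_mat even_part A"
    unfolding A(2)[symmetric] map_mat_coset[OF A(1)] using cA Ae by (intro eq_matI) (auto simp: ell2_parts)
  show "mnorm OH (map_mat fiber_base U) \<le> 2 * sqrt gauge_const * 4"
    unfolding eq
  proof (rule OH_norm_le)
    show "map_mat even_part A \<in> matrices OH n"
      using cA Ae by (simp add: matrices_def ell2_parts)
    show "J_bd n M u 4" using u(1) by simp
    show "gauged n M u (cube_of (map_mat even_part A))"
      unfolding gauged_def
    proof (intro allI exI[of _ "\<lambda>_. 1"] conjI impI)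
      fix i j k assume "i < n" "j < n"
      then show "cube_of (map_mat even_part A) i j k = (\<Sum>m=-int M..int M. 1 * u m i j k)"
        using decomposesD(1)[OF u(2), of i j k] cA by (simp add: cube_of_def even_part_def)
    qed simp
  qed
next
  fix n B assume B: "B \<in> matrices OH n" "mnorm OH B \<le> 1"
  have c: "B \<in> carrier_mat n n" using B by (simp add: matrices_def)
  obtain M u where u: "supp M u" "J_bd n M u 2"
      and Bu: "\<And>i j k. i < n \<Longrightarrow> j < n \<Longrightarrow> cube_of B i j k = (\<Sum>m=-int M..int M. u m i j k)"
    using gram_contractive_decomposition[OF OH_unit_ball[OF B]] by blast
  let ?A = "mat n n (\<lambda>(i, j). interleave (B $$ (i, j)) (\<lambda>k. \<Sum>m=-int M..int M. of_int m * u m i j k))"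
  have "decomposes n M u (cube_of ?A)"
    unfolding decomposes_def by (simp add: cube_of_def Bu[symmetric])
  from twisted_bd_of_J_bd[OF u this] have bd: "twisted_bd n (cube_of ?A) (equiv_const * 2)" .
  have A: "?A \<in> matrices twisted n" by (rule matrices_twisted_of_bd[OF _ bd]) simp
  have "map_mat (\<lambda>x. twisted_kernel +>\<^bsub>twisted\<^esub> x) ?A = map_mat fiber B"
    unfolding map_mat_coset[OF A] using c by (intro eq_matI) auto
  then have "mnorm twisted_quotient (map_mat fiber B) \<le> twisted_norm ?A"
    unfolding mnorm_twisted_quotient using A c twisted_norm_nonneg
    by (intro cInf_lower bdd_belowI[of _ 0]) auto
  also have "\<dots> \<le> equiv_const * 2" by (rule twisted_norm_le[OF _ bd]) simp
  finally show "mnorm twisted_quotient (map_mat fiber B) \<le> equiv_const * 2" .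
qed simp

section \<open>The twisted sum is not completely isomorphic to the operator Hilbert space\<close>

lemma OH_norm_1_1:
  assumes "z \<in> carrier ell2"
  shows "mnorm OH (mat 1 1 (\<lambda>_. z)) \<le> ell2_norm z"
proof -
  let ?A = "mat 1 1 (\<lambda>_. z)"
  have m: "?A \<in> matrices OH 1" using assms by (auto simp: matrices_def)
  have "op_norm (oh_gram ?A) \<le> (ell2_norm z)\<^sup>2"
  proof (rule op_norm_oh_gram_le)
    fix w v
    have "gram_form 1 (cube_of ?A) w v = w 0 0 * complex_of_real ((ell2_norm z)\<^sup>2) * v 0 0"
      using gram_diagonal[OF m, of 0 0] by (simp add: gram_form_def)
    then show "cmod (gram_form 1 (cube_of ?A) w v) \<le> (ell2_norm z)\<^sup>2 * sqrt (fro 1 w) * sqrt (fro 1 v)"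
      by (simp add: fro_def norm_mult norm_power)
  qed simp_all
  then have "sqrt (op_norm (oh_gram ?A)) \<le> sqrt ((ell2_norm z)\<^sup>2)" by (rule real_sqrt_le_mono)
  then show ?thesis using ell2_norm_nonneg[OF assms] by simp
qed

section \<open>Test rows and test columns\<close>

text \<open>A single term, at m = M, whose first row consists of basis vectors. Having one term
  forces \<open>w\<close> to be \<open>M\<close> times \<open>x\<close>.\<close>

definition row_test :: "nat \<Rightarrow> int \<Rightarrow> cube" where
  "row_test M m i j k = (if m = int M \<and> i = 0 then kdelta j k else 0)"

text \<open>For \<open>n = 4 ^ M\<close> the weights of rows and of columns balance at \<open>m = M\<close>: both bounds are \<open>2 ^ M\<close>.\<close>

lemma kdelta_sum_if: "(\<Sum>j<n. kdelta j k * f j) = (if k < n then f k else 0)"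
  by (cases "k < n") (simp, auto simp: kdelta_def intro!: sum.neutral)

text \<open>The column form of a row of orthonormal vectors is at most the squared length and is
  weighted by 2^M; its row form is at most n = 4^M times the squared length and is weighted by
  2^(-M).\<close>

lemma row_test_J_bd: "J_bd (4 ^ M) M (row_test M) (sqrt (2 ^ M))"
proof -
  let ?n = "4 ^ M :: nat" and ?I = "{-int M..int M}"
  have zero: "row_test M m = (\<lambda>_ _ _. 0)" if "m \<noteq> int M" for m
    using that by (simp add: row_test_def fun_eq_iff)
  have fzero: "flip (row_test M) m = (\<lambda>_ _ _. 0)" if "m \<noteq> - int M" for m
    using that by (auto simp: row_test_def flip_def fun_eq_iff)
  have n: "0 < ?n" by simp
  have "col_bd ?n M (row_test M) (sqrt (2 ^ M))"
    unfolding col_bd_def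
  proof (intro allI)
    fix K :: nat and \<xi> :: "nat \<Rightarrow> complex"
    have "(\<Sum>m\<in>?I. 2 powi m * colq ?n K (row_test M m) \<xi>) = (\<Sum>m\<in>{int M}. 2 powi m * colq ?n K (row_test M m) \<xi>)"
      by (rule sum.mono_neutral_right) (auto simp: zero)
    also have "\<dots> = 2 ^ M * colq ?n K (row_test M (int M)) \<xi>" by simp
    also have "colq ?n K (row_test M (int M)) \<xi> \<le> nsq ?n \<xi>"
    proof -
      have "nsq ?n (\<lambda>i. \<Sum>j<?n. row_test M (int M) i j k * \<xi> j) = (if k < ?n then (cmod (\<xi> k))\<^sup>2 else 0)" for k
      proof -
        have "(\<Sum>j<?n. row_test M (int M) i j k * \<xi> j) = (if k < ?n then \<xi> k else 0) * kdelta 0 i" for i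
        proof (cases "i = 0")
          case True
          then show ?thesis using kdelta_sum_if[of k \<xi> ?n] by (simp add: row_test_def) (simp add: kdelta_def)
        qed (simp add: row_test_def kdelta_def)
        then show ?thesis by (simp only: nsq_scale nsq_kdelta[OF n]) simp
      qed
      then have "colq ?n K (row_test M (int M)) \<xi> = (\<Sum>k<K. if k < ?n then (cmod (\<xi> k))\<^sup>2 else 0)"
        by (simp add: colq_def)
      also have "\<dots> \<le> (\<Sum>k\<in>{..<K} \<union> {..<?n}. if k < ?n then (cmod (\<xi> k))\<^sup>2 else 0)"
        by (rule sum_mono2) auto
      also have "\<dots> = (\<Sum>k<?n. (cmod (\<xi> k))\<^sup>2)"
        by (rule sum.mono_neutral_cong_right) auto
      finally show ?thesis by (simp add: nsq_def)
    qed
    finally show "(\<Sum>m\<in>?I. 2 powi m * colq ?n K (row_test M m) \<xi>) \<le> (sqrt (2 ^ M))\<^sup>2 * nsq ?n \<xi>"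
      by (simp add: mult_left_mono)
  qed
  moreover have "col_bd ?n M (flip (row_test M)) (sqrt (2 ^ M))"
    unfolding col_bd_def
  proof (intro allI)
    fix K :: nat and \<xi> :: "nat \<Rightarrow> complex"
    have "(\<Sum>m\<in>?I. 2 powi m * colq ?n K (flip (row_test M) m) \<xi>) = (\<Sum>m\<in>{- int M}. 2 powi m * colq ?n K (flip (row_test M) m) \<xi>)"
      by (rule sum.mono_neutral_right) (auto simp: fzero)
    also have "\<dots> = colq ?n K (flip (row_test M) (- int M)) \<xi> / 2 ^ M"
      by (simp add: power_int_minus field_simps)
    also have "\<dots> \<le> (4 ^ M * nsq ?n \<xi>) / 2 ^ M"
    proof (intro divide_right_mono)
      have "nsq ?n (\<lambda>i. \<Sum>j<?n. flip (row_test M) (- int M) i j k * \<xi> j) = (if k < ?n then (cmod (\<xi> 0))\<^sup>2 else 0)" for k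
      proof -
        have "(\<Sum>j<?n. flip (row_test M) (- int M) i j k * \<xi> j) = \<xi> 0 * kdelta i k" for i
        proof -
          have "(\<Sum>j<?n. flip (row_test M) (- int M) i j k * \<xi> j) = (\<Sum>j<?n. kdelta 0 j * (kdelta i k * \<xi> j))"
            by (intro sum.cong refl) (simp add: flip_def row_test_def, simp add: kdelta_def)
          then show ?thesis using n by simp
        qed
        then have "nsq ?n (\<lambda>i. \<Sum>j<?n. flip (row_test M) (- int M) i j k * \<xi> j) = (cmod (\<xi> 0))\<^sup>2 * nsq ?n (\<lambda>i. kdelta i k)"
          by (simp add: nsq_scale)
        also have "nsq ?n (\<lambda>i. kdelta i k) = (if k < ?n then 1 else 0)"
          by (simp add: nsq_def kdelta_def if_distrib if_distribR cong: if_cong)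
        finally show ?thesis by simp
      qed
      then have "colq ?n K (flip (row_test M) (- int M)) \<xi> = (\<Sum>k<K. if k < ?n then (cmod (\<xi> 0))\<^sup>2 else 0)"
        by (simp add: colq_def)
      also have "\<dots> \<le> (\<Sum>k\<in>{..<K} \<union> {..<?n}. if k < ?n then (cmod (\<xi> 0))\<^sup>2 else 0)"
        by (rule sum_mono2) auto
      also have "\<dots> = (\<Sum>k<?n. (cmod (\<xi> 0))\<^sup>2)"
        by (rule sum.mono_neutral_cong_right) auto
      also have "\<dots> \<le> 4 ^ M * nsq ?n \<xi>"
        using member_le_sum[of 0 "{..<?n}" "\<lambda>j. (cmod (\<xi> j))\<^sup>2"] by (simp add: nsq_def)
      finally show "colq ?n K (flip (row_test M) (- int M)) \<xi> \<le> 4 ^ M * nsq ?n \<xi>" .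
    qed simp
    also have "\<dots> = (sqrt (2 ^ M))\<^sup>2 * nsq ?n \<xi>"
    proof -
      have "(4::real) ^ M = 2 ^ M * 2 ^ M" by (simp add: power_mult_distrib[symmetric])
      then show ?thesis by simp
    qed
    finally show "(\<Sum>m\<in>?I. 2 powi m * colq ?n K (flip (row_test M) m) \<xi>) \<le> (sqrt (2 ^ M))\<^sup>2 * nsq ?n \<xi>" .
  qed
  ultimately show ?thesis by (simp add: J_bd_def)
qed

lemma row_test_supp: "supp M (row_test M)"
  by (auto simp: supp_def row_test_def fun_eq_iff)

lemma ell2_kdelta: "kdelta j \<in> carrier ell2"
proof -
  have "nsq K (kdelta j) \<le> 1" for K
    by (simp add: nsq_def kdelta_def if_distrib if_distribR cong: if_cong)
  then show ?thesis unfolding ell2_iff_bounded by blast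
qed

text \<open>The parallelogram law with the nonnegative contribution of \<open>x\<close>
  dropped.\<close>

lemma ell2_norm_parallelogram:
  assumes "x \<in> carrier ell2" "y \<in> carrier ell2"
  shows "2 * (ell2_norm y)\<^sup>2 \<le> (ell2_norm (\<lambda>k. x k + y k))\<^sup>2 + (ell2_norm (\<lambda>k. x k - y k))\<^sup>2"
proof -
  have s: "summable (\<lambda>k. (cmod (y k))\<^sup>2)" "summable (\<lambda>k. (cmod (x k + y k))\<^sup>2)" "summable (\<lambda>k. (cmod (x k - y k))\<^sup>2)"
    using assms ell2_add[OF assms] ell2_diff[OF assms] by (simp_all add: ell2_carrier)
  have "2 * (\<Sum>k. (cmod (y k))\<^sup>2) = (\<Sum>k. 2 * (cmod (y k))\<^sup>2)"
    using s(1) by (simp add: suminf_mult)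
  also have "\<dots> \<le> (\<Sum>k. (cmod (x k + y k))\<^sup>2 + (cmod (x k - y k))\<^sup>2)"
  proof (intro suminf_le summable_mult summable_add s)
    fix k
    have "(cmod (a + b))\<^sup>2 + (cmod (a - b))\<^sup>2 = 2 * (cmod a)\<^sup>2 + 2 * (cmod b)\<^sup>2" for a b
      unfolding cmod_power2 by (simp add: power2_eq_square algebra_simps)
    then show "2 * (cmod (y k))\<^sup>2 \<le> (cmod (x k + y k))\<^sup>2 + (cmod (x k - y k))\<^sup>2" by simp
  qed
  also have "\<dots> = (\<Sum>k. (cmod (x k + y k))\<^sup>2) + (\<Sum>k. (cmod (x k - y k))\<^sup>2)"
    by (rule suminf_add[symmetric]) (rule s)+
  finally show ?thesis
    using assms ell2_add[OF assms] ell2_diff[OF assms] by (simp add: ell2_norm_power2)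
qed

text \<open>Scaling by 1 / R brings \<open>A\<close> into the unit ball, where complete boundedness
  of \<open>T\<close> and the test bounds of OH apply; row and column receive the same
  estimate.\<close>

lemma twisted_test_bound:
  assumes lin: "Defs.linear_map twisted OH T"
    and C: "\<And>n A. A \<in> matrices twisted n \<Longrightarrow> twisted_norm A \<le> 1 \<Longrightarrow> mnorm OH (map_mat T A) \<le> C"
    and A: "A \<in> carrier_mat n n" "twisted_bd n (cube_of A) R" and R: "0 < R" and n: "0 < n"
  shows "(\<Sum>j<n. (ell2_norm (T (A $$ (0, j))))\<^sup>2) \<le> sqrt (real n) * C\<^sup>2 * R\<^sup>2"
    and "(\<Sum>i<n. (ell2_norm (T (A $$ (i, 0))))\<^sup>2) \<le> sqrt (real n) * C\<^sup>2 * R\<^sup>2"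
proof -
  let ?c = "complex_of_real (1 / R)"
  let ?B = "mat_scale twisted ?c A"
  have Am: "A \<in> matrices twisted n" by (rule matrices_twisted_of_bd[OF A])
  have Ae: "A $$ (i, j) \<in> carrier ell2" if "i < n" "j < n" for i j using Am that by (simp add: matrices_def)
  have Bm: "?B \<in> matrices twisted n" by (rule mat_scale_matrices[OF Am])
  have eq: "twisted_norm ?B = 1 / R * twisted_norm A"
    using R by (simp add: twisted_norm_scale[OF Am] norm_divide)
  have "twisted_norm A \<le> R" using A by (intro twisted_norm_le) auto
  then have "twisted_norm ?B \<le> 1" unfolding eq using R by (simp add: field_simps)
  from C[OF Bm this] have TB: "mnorm OH (map_mat T ?B) \<le> C" .
  have entry: "map_mat T ?B $$ (i, j) = (\<lambda>k. ?c * T (A $$ (i, j)) k)" if "i < n" "j < n" for i j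
    using linear_mapD(3)[OF lin, of "A $$ (i, j)" ?c] Ae[OF that] A(1) that by (simp add: mat_scale_def)
  have TBm: "map_mat T ?B \<in> matrices OH n"
    using Bm linear_mapD(1)[OF lin] by (auto simp: matrices_def)
  have norm: "(ell2_norm (map_mat T ?B $$ (i, j)))\<^sup>2 = (ell2_norm (T (A $$ (i, j))))\<^sup>2 / R\<^sup>2" if "i < n" "j < n" for i j
  proof -
    have t: "T (A $$ (i, j)) \<in> carrier ell2" using linear_mapD(1)[OF lin] Ae[OF that] by simp
    have "(ell2_norm (\<lambda>k. ?c * T (A $$ (i, j)) k))\<^sup>2 = (\<Sum>k. (1 / R)\<^sup>2 * (cmod (T (A $$ (i, j)) k))\<^sup>2)"
      unfolding ell2_norm_power2[OF ell2_scale[OF t]] using R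
      by (simp add: norm_mult norm_divide power_mult_distrib power_divide)
    also have "\<dots> = (1 / R)\<^sup>2 * (ell2_norm (T (A $$ (i, j))))\<^sup>2"
      using t by (simp add: suminf_mult ell2_norm_power2[OF t] ell2_carrier)
    finally show ?thesis unfolding entry[OF that] by (simp add: power_divide)
  qed
  have "(\<Sum>j<n. (ell2_norm (T (A $$ (0, j))))\<^sup>2 / R\<^sup>2) \<le> sqrt (real n) * C\<^sup>2"
    using OH_test_bound(1)[OF TBm TB n] norm[OF n] by simp
  then show "(\<Sum>j<n. (ell2_norm (T (A $$ (0, j))))\<^sup>2) \<le> sqrt (real n) * C\<^sup>2 * R\<^sup>2"
    using R by (simp add: sum_divide_distrib[symmetric] field_simps)
  have "(\<Sum>i<n. (ell2_norm (T (A $$ (i, 0))))\<^sup>2 / R\<^sup>2) \<le> sqrt (real n) * C\<^sup>2"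
    using OH_test_bound(2)[OF TBm TB n] norm[OF _ n] by simp
  then show "(\<Sum>i<n. (ell2_norm (T (A $$ (i, 0))))\<^sup>2) \<le> sqrt (real n) * C\<^sup>2 * R\<^sup>2"
    using R by (simp add: sum_divide_distrib[symmetric] field_simps)
qed

lemma twisted_bd_row:
  "twisted_bd (4 ^ M) (cube_of (mat (4 ^ M) (4 ^ M) (\<lambda>(i, j). if i = 0 then interleave (kdelta j) (\<lambda>k. of_nat M * kdelta j k) else (\<lambda>_. 0))))
     (equiv_const * sqrt (2 ^ M))"
proof (rule twisted_bd_of_J_bd[OF row_test_supp row_test_J_bd])
  have "(\<Sum>m=-int M..int M. row_test M m i j k) = (if i = 0 then kdelta j k else 0)"
    "(\<Sum>m=-int M..int M. of_int m * row_test M m i j k) = (if i = 0 then of_nat M * kdelta j k else 0)" for i j k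
    by (auto simp: row_test_def if_distrib if_distribR cong: if_cong)
  then show "decomposes (4 ^ M) M (row_test M) (cube_of (mat (4 ^ M) (4 ^ M) (\<lambda>(i, j). if i = 0 then interleave (kdelta j) (\<lambda>k. of_nat M * kdelta j k) else (\<lambda>_. 0))))"
    by (simp add: decomposes_def cube_of_def)
qed

text \<open>Flipping moves the single term to m = -M. The resulting opposite sign of
  \<open>w\<close> for rows and columns is what OH cannot reproduce.\<close>

lemma twisted_bd_column:
  "twisted_bd (4 ^ M) (cube_of (mat (4 ^ M) (4 ^ M) (\<lambda>(i, j). if j = 0 then interleave (kdelta i) (\<lambda>k. - (of_nat M * kdelta i k)) else (\<lambda>_. 0))))
     (equiv_const * sqrt (2 ^ M))"
proof (rule twisted_bd_of_J_bd)
  show "supp M (flip (row_test M))" using row_test_supp by simp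
  show "J_bd (4 ^ M) M (flip (row_test M)) (sqrt (2 ^ M))" unfolding J_bd_flip by (rule row_test_J_bd)
  have "(\<Sum>m=-int M..int M. flip (row_test M) m i j k) = (if j = 0 then kdelta i k else 0)"
    "(\<Sum>m=-int M..int M. of_int m * flip (row_test M) m i j k) = (if j = 0 then - (of_nat M * kdelta i k) else 0)" for i j k
  proof -
    have "flip (row_test M) m i j k = (if m = - int M then if j = 0 then kdelta i k else 0 else 0)" for m
      by (auto simp: flip_def row_test_def)
    moreover from this have "of_int m * flip (row_test M) m i j k = (if m = - int M then if j = 0 then - (of_nat M * kdelta i k) else 0 else 0)" for m
      by simp
    moreover have "(\<Sum>m=-int M..int M. if m = - int M then c else 0) = c" for c :: complex by simp
    ultimately show "(\<Sum>m=-int M..int M. flip (row_test M) m i j k) = (if j = 0 then kdelta i k else 0)"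
      "(\<Sum>m=-int M..int M. of_int m * flip (row_test M) m i j k) = (if j = 0 then - (of_nat M * kdelta i k) else 0)"
      by (simp_all only:)
  qed
  then show "decomposes (4 ^ M) M (flip (row_test M)) (cube_of (mat (4 ^ M) (4 ^ M) (\<lambda>(i, j). if j = 0 then interleave (kdelta i) (\<lambda>k. - (of_nat M * kdelta i k)) else (\<lambda>_. 0))))"
    by (simp add: decomposes_def cube_of_def)
qed

text \<open>Complete boundedness of the inverse is used on matrices of size one only, where the norm
  of OH is at most, and the twisted norm equal to, the norm of \<open>ell2\<close>.\<close>

lemma bounded_below_of_inverse:
  assumes iso: "complete_isomorphism twisted OH T"
  shows "\<exists>d>0. \<forall>x\<in>carrier ell2. d * ell2_norm x \<le> ell2_norm (T x)"
proof -
  let ?S = "inv_into (carrier twisted) T"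
  have lin: "Defs.linear_map twisted OH T" and bij: "bij_betw T (carrier ell2) (carrier ell2)"
    and cb: "completely_bounded OH twisted ?S"
    using iso by (simp_all add: complete_isomorphism_def completely_bounded_def)
  obtain D where D: "0 \<le> D" "\<And>n B. B \<in> matrices OH n \<Longrightarrow> mnorm OH B \<le> 1 \<Longrightarrow> mnorm twisted (map_mat ?S B) \<le> D"
    using completely_boundedE[OF cb] by blast
  have T0: "T (\<lambda>_. 0) = (\<lambda>_. 0)"
    using linear_mapD(3)[OF lin, of "\<lambda>_. 0" 0] ell2_zero by simp
  \<comment> \<open>\<open>D\<close> may be 0, hence the 1 added before division.\<close>
  have "1 / (D + 1) * ell2_norm x \<le> ell2_norm (T x)" if x: "x \<in> carrier ell2" for x
  proof (cases "ell2_norm (T x) = 0")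
    case True
    have Tx: "T x \<in> carrier ell2" using bij x by (auto simp: bij_betw_def)
    have "\<forall>k. T x k = 0"
      using True Tx by (simp add: ell2_norm_def ell2_carrier suminf_eq_zero_iff)
    then have "T x = T (\<lambda>_. 0)" using T0 by (simp add: fun_eq_iff)
    then have "x = (\<lambda>_. 0)" using bij x ell2_zero by (auto simp: bij_betw_def inj_on_def)
    then show ?thesis using ell2_norm_nonneg[OF Tx] by (simp add: ell2_norm_def)
  next
    case False
    have Tx: "T x \<in> carrier ell2" using bij x by (auto simp: bij_betw_def)
    then have pos: "0 < ell2_norm (T x)" using False ell2_norm_nonneg[OF Tx] by simp
    define c where "c = complex_of_real (1 / ell2_norm (T x))"
    have cc: "cmod c = 1 / ell2_norm (T x)" using pos by (simp add: c_def norm_divide)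
    let ?y = "\<lambda>k. c * x k"
    have y: "?y \<in> carrier ell2" by (rule ell2_scale[OF x])
    have scale: "ell2_norm (\<lambda>k. c * z k) = cmod c * ell2_norm z" if "z \<in> carrier ell2" for z
      using that by (simp add: ell2_norm_def norm_mult power_mult_distrib suminf_mult ell2_carrier real_sqrt_mult)
    have Ty: "T ?y = (\<lambda>k. c * T x k)" using linear_mapD(3)[OF lin, of x c] x by simp
    have Ty_in: "T ?y \<in> carrier ell2" unfolding Ty by (rule ell2_scale[OF Tx])
    have "mnorm OH (mat 1 1 (\<lambda>_. T ?y)) \<le> 1"
      using OH_norm_1_1[OF Ty_in] pos unfolding Ty scale[OF Tx] cc by simp
    moreover have "mat 1 1 (\<lambda>_. T ?y) \<in> matrices OH 1" using Ty_in by (simp add: matrices_def)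
    ultimately have "mnorm twisted (map_mat ?S (mat 1 1 (\<lambda>_. T ?y))) \<le> D" by (rule D(2)[rotated])
    moreover have "map_mat ?S (mat 1 1 (\<lambda>_. T ?y)) = mat 1 1 (\<lambda>_. ?y)"
      using bij y by (intro eq_matI) (simp_all add: bij_betw_def)
    ultimately have "ell2_norm ?y \<le> D"
      using space_norm_twisted[OF y] by (simp add: space_norm_def)
    then have "ell2_norm x \<le> D * ell2_norm (T x)"
      unfolding scale[OF x] cc using pos by (simp add: field_simps)
    also have "\<dots> \<le> (D + 1) * ell2_norm (T x)" using pos by simp
    finally show ?thesis using D(1) by (simp add: field_simps)
  qed
  then show ?thesis using D(1) by (intro exI[of _ "1 / (D + 1)"]) auto
qed

lemma ell2_norm_kdelta_odd: "ell2_norm (interleave (\<lambda>_. 0) (kdelta j)) \<ge> 1"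
proof -
  let ?x = "interleave (\<lambda>_. 0) (kdelta j)"
  have x: "?x \<in> carrier ell2" by (intro ell2_interleave ell2_zero ell2_kdelta)
  have "1 = nsq (Suc j) (kdelta j)" by (simp add: nsq_kdelta)
  also have "\<dots> \<le> nsq (2 * Suc j) ?x" by (simp only: nsq_double interleave_simps) simp
  also have "\<dots> \<le> (ell2_norm ?x)\<^sup>2" by (rule nsq_le_ell2_norm[OF x])
  finally have "1\<^sup>2 \<le> (ell2_norm ?x)\<^sup>2" by simp
  then show ?thesis by (rule power2_le_imp_le) (rule ell2_norm_nonneg[OF x])
qed

lemma twisted_not_isomorphic_OH: "\<not> completely_isomorphic twisted OH"
proof
  assume "completely_isomorphic twisted OH"
  then obtain T where iso: "complete_isomorphism twisted OH T" by (auto simp: completely_isomorphic_def)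
  have lin: "Defs.linear_map twisted OH T" and cb: "completely_bounded twisted OH T"
    using iso by (simp_all add: complete_isomorphism_def completely_bounded_def)
  obtain C where C: "0 \<le> C" "\<And>n A. A \<in> matrices twisted n \<Longrightarrow> mnorm twisted A \<le> 1 \<Longrightarrow> mnorm OH (map_mat T A) \<le> C"
    using completely_boundedE[OF cb] by blast
  have C': "\<And>n A. A \<in> matrices twisted n \<Longrightarrow> twisted_norm A \<le> 1 \<Longrightarrow> mnorm OH (map_mat T A) \<le> C"
    using C(2) by simp
  obtain d where d: "0 < d" "\<And>x. x \<in> carrier ell2 \<Longrightarrow> d * ell2_norm x \<le> ell2_norm (T x)"
    using bounded_below_of_inverse[OF iso] by blast
  have main: "(real M * d)\<^sup>2 \<le> (C * equiv_const)\<^sup>2" for M :: nat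
  proof -
    let ?n = "4 ^ M :: nat"
    let ?e = "\<lambda>j. interleave (kdelta j) (\<lambda>_. 0)" and ?f = "\<lambda>j. interleave (\<lambda>_. 0) (kdelta j)"
    have ef: "?e j \<in> carrier ell2" "?f j \<in> carrier ell2" for j
      by (intro ell2_interleave ell2_zero ell2_kdelta)+
    have Tef: "T (?e j) \<in> carrier ell2" "T (?f j) \<in> carrier ell2" for j
      using linear_mapD(1)[OF lin] ef by simp_all
    have comb: "T (\<lambda>k. ?e j k + a * ?f j k) = (\<lambda>k. T (?e j) k + a * T (?f j) k)" for j a
      using linear_mapD(2)[OF lin, of "?e j" "\<lambda>k. a * ?f j k"] linear_mapD(3)[OF lin, of "?f j" a] ef
      by (simp add: ell2_scale)
    have row: "T (interleave (kdelta j) (\<lambda>k. of_nat M * kdelta j k)) = (\<lambda>k. T (?e j) k + of_nat M * T (?f j) k)" for j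
      unfolding comb[symmetric] by (rule arg_cong[where f=T]) (auto simp: interleave_def fun_eq_iff)
    have column: "T (interleave (kdelta j) (\<lambda>k. - (of_nat M * kdelta j k))) = (\<lambda>k. T (?e j) k - of_nat M * T (?f j) k)" for j
    proof -
      have "interleave (kdelta j) (\<lambda>k. - (of_nat M * kdelta j k)) = (\<lambda>k. ?e j k + (- of_nat M) * ?f j k)"
        by (auto simp: interleave_def fun_eq_iff)
      then show ?thesis by (simp only: comb) simp
    qed
    have R: "0 < equiv_const * sqrt (2 ^ M)" using equiv_const_ge_1 by simp
    have n: "0 < ?n" by simp
    \<comment> \<open>For n = 4^M both sqrt n and the square of sqrt (2^M) equal 2^M, so the bound
      for the whole row is \<open>n\<close> times a constant: a bounded average per entry, against
      the growth M^2 obtained below.\<close>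
    have bound: "sqrt (real ?n) * C\<^sup>2 * (equiv_const * sqrt (2 ^ M))\<^sup>2 = real ?n * (C * equiv_const)\<^sup>2"
    proof -
      have "real ?n = (2 ^ M)\<^sup>2" by (simp add: power2_eq_square power_mult_distrib[symmetric])
      then show ?thesis by (simp add: power_mult_distrib power2_eq_square)
    qed
    have 1: "(\<Sum>j<?n. (ell2_norm (\<lambda>k. T (?e j) k + of_nat M * T (?f j) k))\<^sup>2) \<le> real ?n * (C * equiv_const)\<^sup>2"
      using twisted_test_bound(1)[OF lin C' _ twisted_bd_row R n] unfolding bound by (simp add: row)
    have 2: "(\<Sum>j<?n. (ell2_norm (\<lambda>k. T (?e j) k - of_nat M * T (?f j) k))\<^sup>2) \<le> real ?n * (C * equiv_const)\<^sup>2"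
      using twisted_test_bound(2)[OF lin C' _ twisted_bd_column R n] unfolding bound by (simp add: column)
    have "2 * (real M * d)\<^sup>2 \<le> (ell2_norm (\<lambda>k. T (?e j) k + of_nat M * T (?f j) k))\<^sup>2 + (ell2_norm (\<lambda>k. T (?e j) k - of_nat M * T (?f j) k))\<^sup>2" for j
    proof -
      have g: "(\<lambda>k. of_nat M * ?f j k) \<in> carrier ell2" by (rule ell2_scale[OF ef(2)])
      have Tg: "T (\<lambda>k. of_nat M * ?f j k) = (\<lambda>k. of_nat M * T (?f j) k)"
        using linear_mapD(3)[OF lin, of "?f j" "of_nat M"] ef by simp
      have "d * 1 \<le> d * ell2_norm (?f j)"
        using d(1) ell2_norm_kdelta_odd by (intro mult_left_mono) simp_all
      also have "\<dots> \<le> ell2_norm (T (?f j))" by (rule d(2)[OF ef(2)])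
      finally have "(d * 1)\<^sup>2 \<le> (ell2_norm (T (?f j)))\<^sup>2" using d(1) by (intro power_mono) simp_all
      then have "(real M)\<^sup>2 * d\<^sup>2 \<le> (real M)\<^sup>2 * (ell2_norm (T (?f j)))\<^sup>2" by (intro mult_left_mono) simp_all
      also have "\<dots> = (ell2_norm (\<lambda>k. of_nat M * T (?f j) k))\<^sup>2"
        using Tef(2)[of j] by (simp add: ell2_norm_power2 ell2_scale norm_mult power_mult_distrib suminf_mult ell2_carrier)
      finally have "(real M * d)\<^sup>2 \<le> (ell2_norm (\<lambda>k. of_nat M * T (?f j) k))\<^sup>2" by (simp add: power_mult_distrib)
      \<comment> \<open>Row and column differ in the sign of the odd part, so the parallelogram law
        isolates the image of \<open>M\<close> times the odd basis vector, whatever \<open>T\<close>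
        does to the even one.\<close>
      then show ?thesis
        using ell2_norm_parallelogram[OF Tef(1)[of j] ell2_scale[OF Tef(2)[of j], of "of_nat M"]] by linarith
    qed
    then have "(\<Sum>j<?n. 2 * (real M * d)\<^sup>2) \<le> (\<Sum>j<?n. (ell2_norm (\<lambda>k. T (?e j) k + of_nat M * T (?f j) k))\<^sup>2 + (ell2_norm (\<lambda>k. T (?e j) k - of_nat M * T (?f j) k))\<^sup>2)"
      by (intro sum_mono)
    also have "\<dots> \<le> 2 * (real ?n * (C * equiv_const)\<^sup>2)"
      unfolding sum.distrib using 1 2 by linarith
    finally have "real ?n * (real M * d)\<^sup>2 \<le> real ?n * (C * equiv_const)\<^sup>2" by simp
    then show ?thesis using n by (simp only: mult_le_cancel_left_pos of_nat_0_less_iff)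
  qed
  obtain M :: nat where M: "C * equiv_const / d < real M" using reals_Archimedean2 by blast
  have "0 \<le> C * equiv_const" using C(1) equiv_const_ge_1 by simp
  moreover have "C * equiv_const < real M * d" using M d(1) by (simp add: field_simps)
  ultimately have "(C * equiv_const)\<^sup>2 < (real M * d)\<^sup>2" by (intro power_strict_mono) simp_all
  then show False using main[of M] by simp
qed

theorem mainTheorem4:
  shows "\<exists>X :: (nat \<Rightarrow> complex) opspace.
    operator_space X \<and> isometric_to_ell2 X \<and>
    (\<exists>Y. closed_subspace Y X \<and>
         completely_isomorphic (subspace_opspace X Y) OH \<and>
         completely_isomorphic (quotient_opspace X Y) OH) \<and>
    \<not> completely_isomorphic X OH"
  using operator_space_twisted isometric_twisted closed_subspace_kernel kernel_isomorphic_OH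
    quotient_isomorphic_OH twisted_not_isomorphic_OH by blast

end
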